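(* Let $p$ be a prime. Then $K_0(\mathcal{B}(\mathbb{Q}_p(\mathbb{N}))) = 0$.
   Context: $\mathbb{Q}_p(\mathbb{N})$ is the set of maps $\xi:\mathbb{N}\to\mathbb{Q}_p$ with $|\xi(i)|_p\le 1$ for all but finitely many $i$; it is a $\mathbb{Z}_p$-module under coordinatewise operations. It carries the topology $\tau$ in which $A\subseteq\mathbb{Q}_p(\mathbb{N})$ is open iff for every finite $P\subseteq\mathbb{N}$ the set $A\cap\big(\prod_{i\in P}\mathbb{Q}_p\times\prod_{j\notin P}\mathbb{Z}_p\big)$ is open in the product topology. $\mathcal{B}(\mathbb{Q}_p(\mathbb{N}))$ is the ring of all $\tau$-continuous $\mathbb{Z}_p$-linear maps $\mathbb{Q}_p(\mathbb{N})\to\mathbb{Q}_p(\mathbb{N})$. $K_0$ is the algebraic $K_0$-group of a unital ring. *)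

theory Defs
  imports "HOL-Analysis.Function_Topology" "HOL-Algebra.Ring" "HOL-Computational_Algebra.Primes"
begin

text \<open>A p-adic number x = sum of (x k) * p^k over integers k, with digits x k in {0..p-1}
  and only finitely many nonzero digits at negative positions. This representation is
  canonical, so HOL equality is equality of p-adic numbers.\<close>

type_synonym padic = "int \<Rightarrow> nat"

definition Qp :: "nat \<Rightarrow> padic set" where
  "Qp p = {x. (\<forall>k. x k < p) \<and> (\<exists>m. \<forall>k<m. x k = 0)}"

definition Zp :: "nat \<Rightarrow> padic set" where
  "Zp p = {x \<in> Qp p. \<forall>k<0. x k = 0}"

text \<open>Truncation: the rational number sum of x k * p^k over k < N (a representative of x mod p^N).\<close>
definition padic_trunc :: "nat \<Rightarrow> padic \<Rightarrow> int \<Rightarrow> rat" where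
  "padic_trunc p x N = (\<Sum>k\<in>{k. k < N \<and> x k \<noteq> 0}. of_nat (x k) * (of_nat p) powi k)"

text \<open>k-th base-p digit of a nonnegative rational with p-power denominator.\<close>
definition digit_of :: "nat \<Rightarrow> int \<Rightarrow> rat \<Rightarrow> nat" where
  "digit_of p k r = nat (\<lfloor>r / (of_nat p powi k)\<rfloor> mod int p)"

definition padic_add :: "nat \<Rightarrow> padic \<Rightarrow> padic \<Rightarrow> padic" where
  "padic_add p x y = (\<lambda>k. digit_of p k (padic_trunc p x (k + 1) + padic_trunc p y (k + 1)))"

definition padic_depth :: "nat \<Rightarrow> padic \<Rightarrow> nat" where
  "padic_depth p x = (LEAST N::nat. \<forall>k < - int N. x k = 0)"

text \<open>Product a*x (used for a in Z_p, x in Q_p); computed modulo p^(k+1) via truncations.\<close>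
definition padic_mult :: "nat \<Rightarrow> padic \<Rightarrow> padic \<Rightarrow> padic" where
  "padic_mult p a x = (\<lambda>k. let T = k + 1 + int (padic_depth p x) in
      digit_of p k (padic_trunc p a T * padic_trunc p x T))"

text \<open>The p-adic topology on Q_p: U is open iff around each point it contains
  a ball {y. |y - x|_p \<le> p^(-n)} = {y. digits of y and x agree below n}.\<close>
definition Qp_top :: "nat \<Rightarrow> padic topology" where
  "Qp_top p = topology (\<lambda>U. U \<subseteq> Qp p \<and>
      (\<forall>x\<in>U. \<exists>n::int. {y \<in> Qp p. \<forall>k<n. y k = x k} \<subseteq> U))"

definition QpN :: "nat \<Rightarrow> (nat \<Rightarrow> padic) set" where
  "QpN p = {\<xi>. (\<forall>i. \<xi> i \<in> Qp p) \<and> finite {i. \<xi> i \<notin> Zp p}}"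

definition QpN_add :: "nat \<Rightarrow> (nat \<Rightarrow> padic) \<Rightarrow> (nat \<Rightarrow> padic) \<Rightarrow> (nat \<Rightarrow> padic)" where
  "QpN_add p \<xi> \<eta> = (\<lambda>i. padic_add p (\<xi> i) (\<eta> i))"

definition QpN_smult :: "nat \<Rightarrow> padic \<Rightarrow> (nat \<Rightarrow> padic) \<Rightarrow> (nat \<Rightarrow> padic)" where
  "QpN_smult p a \<xi> = (\<lambda>i. padic_mult p a (\<xi> i))"

definition QpN_zero :: "nat \<Rightarrow> padic" where
  "QpN_zero i = (\<lambda>k. 0)"

definition QpN_box :: "nat \<Rightarrow> nat set \<Rightarrow> (nat \<Rightarrow> padic) set" where
  "QpN_box p P = {\<xi>. (\<forall>i\<in>P. \<xi> i \<in> Qp p) \<and> (\<forall>j. j \<notin> P \<longrightarrow> \<xi> j \<in> Zp p)}"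

definition tau :: "nat \<Rightarrow> (nat \<Rightarrow> padic) topology" where
  "tau p = topology (\<lambda>A. A \<subseteq> QpN p \<and>
      (\<forall>P. finite P \<longrightarrow>
         openin (subtopology (product_topology (\<lambda>_. Qp_top p) UNIV) (QpN_box p P))
                (A \<inter> QpN_box p P)))"

definition Zp_linear :: "nat \<Rightarrow> ((nat \<Rightarrow> padic) \<Rightarrow> (nat \<Rightarrow> padic)) \<Rightarrow> bool" where
  "Zp_linear p f \<longleftrightarrow>
     (\<forall>\<xi>\<in>QpN p. \<forall>\<eta>\<in>QpN p. f (QpN_add p \<xi> \<eta>) = QpN_add p (f \<xi>) (f \<eta>)) \<and>
     (\<forall>a\<in>Zp p. \<forall>\<xi>\<in>QpN p. f (QpN_smult p a \<xi>) = QpN_smult p a (f \<xi>))"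

definition B_carrier :: "nat \<Rightarrow> ((nat \<Rightarrow> padic) \<Rightarrow> (nat \<Rightarrow> padic)) set" where
  "B_carrier p = {f. f \<in> extensional (QpN p) \<and> continuous_map (tau p) (tau p) f \<and> Zp_linear p f}"

definition B_ring :: "nat \<Rightarrow> ((nat \<Rightarrow> padic) \<Rightarrow> (nat \<Rightarrow> padic)) ring" where
  "B_ring p = \<lparr> carrier = B_carrier p,
                monoid.mult = (\<lambda>f g. restrict (f \<circ> g) (QpN p)),
                one = restrict id (QpN p),
                zero = restrict (\<lambda>_. QpN_zero) (QpN p),
                add = (\<lambda>f g. restrict (\<lambda>\<xi>. QpN_add p (f \<xi>) (g \<xi>)) (QpN p)) \<rparr>"

definition mat_carrier :: "('a, 'b) ring_scheme \<Rightarrow> nat \<Rightarrow> nat \<Rightarrow> (nat \<Rightarrow> nat \<Rightarrow> 'a) set" where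
  "mat_carrier R n m = {A. (\<forall>i j. i < n \<longrightarrow> j < m \<longrightarrow> A i j \<in> carrier R) \<and>
                          (\<forall>i j. \<not> (i < n \<and> j < m) \<longrightarrow> A i j = \<zero>\<^bsub>R\<^esub>)}"

definition mat_mult :: "('a, 'b) ring_scheme \<Rightarrow> nat \<Rightarrow> nat \<Rightarrow> nat \<Rightarrow>
    (nat \<Rightarrow> nat \<Rightarrow> 'a) \<Rightarrow> (nat \<Rightarrow> nat \<Rightarrow> 'a) \<Rightarrow> (nat \<Rightarrow> nat \<Rightarrow> 'a)" where
  "mat_mult R n k m A B = (\<lambda>i j. if i < n \<and> j < m
      then (\<Oplus>\<^bsub>R\<^esub> l\<in>{..<k}. A i l \<otimes>\<^bsub>R\<^esub> B l j) else \<zero>\<^bsub>R\<^esub>)"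

definition idempotents :: "('a, 'b) ring_scheme \<Rightarrow> (nat \<times> (nat \<Rightarrow> nat \<Rightarrow> 'a)) set" where
  "idempotents R = {(n, e). e \<in> mat_carrier R n n \<and> mat_mult R n n n e e = e}"

definition idem_equiv :: "('a, 'b) ring_scheme \<Rightarrow>
    ((nat \<times> (nat \<Rightarrow> nat \<Rightarrow> 'a)) \<times> (nat \<times> (nat \<Rightarrow> nat \<Rightarrow> 'a))) set" where
  "idem_equiv R = {((n, e), (m, f)). (n, e) \<in> idempotents R \<and> (m, f) \<in> idempotents R \<and>
      (\<exists>a b. a \<in> mat_carrier R n m \<and> b \<in> mat_carrier R m n \<and>
             mat_mult R n m n a b = e \<and> mat_mult R m n m b a = f)}"

definition idem_sum :: "('a, 'b) ring_scheme \<Rightarrow> nat \<times> (nat \<Rightarrow> nat \<Rightarrow> 'a) \<Rightarrow>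
    nat \<times> (nat \<Rightarrow> nat \<Rightarrow> 'a) \<Rightarrow> nat \<times> (nat \<Rightarrow> nat \<Rightarrow> 'a)" where
  "idem_sum R x y = (fst x + fst y, (\<lambda>i j.
      if i < fst x \<and> j < fst x then snd x i j
      else if fst x \<le> i \<and> i < fst x + fst y \<and> fst x \<le> j \<and> j < fst x + fst y
        then snd y (i - fst x) (j - fst x)
      else \<zero>\<^bsub>R\<^esub>))"

text \<open>Grothendieck group: formal differences [x] - [y]; [x1]-[y1] = [x2]-[y2] iff
  x1 + y2 + g ~ x2 + y1 + g for some idempotent g.\<close>
definition K0_rel :: "('a, 'b) ring_scheme \<Rightarrow>
    (((nat \<times> (nat \<Rightarrow> nat \<Rightarrow> 'a)) \<times> (nat \<times> (nat \<Rightarrow> nat \<Rightarrow> 'a))) \<times>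
     ((nat \<times> (nat \<Rightarrow> nat \<Rightarrow> 'a)) \<times> (nat \<times> (nat \<Rightarrow> nat \<Rightarrow> 'a)))) set" where
  "K0_rel R = {((x1, y1), (x2, y2)).
      x1 \<in> idempotents R \<and> y1 \<in> idempotents R \<and> x2 \<in> idempotents R \<and> y2 \<in> idempotents R \<and>
      (\<exists>g\<in>idempotents R.
         (idem_sum R (idem_sum R x1 y2) g, idem_sum R (idem_sum R x2 y1) g) \<in> idem_equiv R)}"

definition K0 :: "('a, 'b) ring_scheme \<Rightarrow>
    ((nat \<times> (nat \<Rightarrow> nat \<Rightarrow> 'a)) \<times> (nat \<times> (nat \<Rightarrow> nat \<Rightarrow> 'a))) set monoid" where
  "K0 R = \<lparr> carrier = (idempotents R \<times> idempotents R) // K0_rel R,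
            monoid.mult = (\<lambda>X Y. let u = (SOME u. u \<in> X); v = (SOME v. v \<in> Y) in
                       K0_rel R `` {(idem_sum R (fst u) (fst v), idem_sum R (snd u) (snd v))}),
            one = K0_rel R `` {((0, \<lambda>i j. \<zero>\<^bsub>R\<^esub>), (0, \<lambda>i j. \<zero>\<^bsub>R\<^esub>))} \<rparr>"

end

theory Submission
  imports Defs "HOL-Number_Theory.Cong" "HOL-Library.Nat_Bijection"
begin

text \<open>Eilenberg swindle. Write \<open>V = \<rat>\<^sub>p(\<nat>)\<close>. Since \<open>V \<cong> V\<^sup>n\<close> topologically, every idempotent matrix over
  \<open>\<B>(V)\<close> comes from an idempotent \<open>E\<close> of \<open>\<B>(V)\<close>, and it suffices to show \<open>E V \<oplus> V \<cong> V\<close>.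
  If \<open>E\<close> preserves \<open>\<int>\<^sub>p\<^sup>\<nat>\<close>, then it acts diagonally on \<open>V \<cong> \<rat>\<^sub>p(\<nat> \<times> \<nat>)\<close>, and shifting the copies of
  \<open>E V\<close> by one gives the isomorphism. In general, continuity of \<open>E\<close> at 0 provides an \<open>E\<close>-invariant
  lattice commensurable with \<open>\<int>\<^sub>p\<^sup>\<nat>\<close>; Gaussian elimination over \<open>\<int>\<^sub>p\<close>
  on finitely many coordinates moves it to \<open>\<int>\<^sub>p\<^sup>\<nat>\<close>, so that \<open>E\<close> is conjugate to an idempotent
  of the first kind.\<close>

subsection \<open>Rings whose idempotents are absorbed by the unit\<close>

text \<open>For a general \<open>E\<close> the diagonal operator \<open>(E, E, E, ...)\<close> does
  not exist: if \<open>E\<close> sends some integral vector to a non-integral one, the element of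
  \<open>V\<close> that repeats this vector in every block would get infinitely many non-integral
  coordinates. This is the obstacle that forces the passage through lattices.

  The invariant lattice is the set of integral \<open>x\<close> with \<open>E x\<close> integral. It
  is stable under \<open>E\<close> because \<open>E (E x) = E x\<close>. Continuity at 0 puts into
  it all integral vectors that are divisible by some \<open>p^M\<close> in finitely many
  coordinates, so it differs from the lattice of all integral vectors only within these coordinates
  and the elimination is finite.

  In terms of matrices, \<open>E V \<oplus> V \<cong> V\<close> says that an idempotent, after one 1
  by 1 identity is added, becomes equivalent to that identity. Since \<open>K0_rel\<close> allows a
  common summand, all formal differences are then related and a single class remains.\<close>

context ring
begin

section \<open>Finite sums in a ring\<close>

lemma finsum_swap:
  assumes "finite A" "finite B" "\<And>i j. i \<in> A \<Longrightarrow> j \<in> B \<Longrightarrow> f i j \<in> carrier R"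
  shows "(\<Oplus>i\<in>A. \<Oplus>j\<in>B. f i j) = (\<Oplus>j\<in>B. \<Oplus>i\<in>A. f i j)"
  using assms(1,3)
proof (induction A)
  case empty
  then show ?case by (simp add: finsum_zero)
next
  case (insert x A)
  have "(\<Oplus>i\<in>insert x A. \<Oplus>j\<in>B. f i j) = (\<Oplus>j\<in>B. f x j) \<oplus> (\<Oplus>j\<in>B. \<Oplus>i\<in>A. f i j)"
    using insert assms(2) by (simp add: Pi_def)
  also have "\<dots> = (\<Oplus>j\<in>B. f x j \<oplus> (\<Oplus>i\<in>A. f i j))"
    using insert assms(2) by (intro finsum_addf[symmetric]) (auto simp: Pi_def)
  also have "\<dots> = (\<Oplus>j\<in>B. \<Oplus>i\<in>insert x A. f i j)"
    using insert assms(2) by (intro finsum_cong' refl) (auto simp: Pi_def)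
  finally show ?case .
qed

lemma finsum_split:
  fixes n m :: nat
  assumes "\<And>l. l < n + m \<Longrightarrow> F l \<in> carrier R"
  shows "(\<Oplus>l\<in>{..<n + m}. F l) = (\<Oplus>l\<in>{..<n}. F l) \<oplus> (\<Oplus>l\<in>{..<m}. F (n + l))"
  using assms
proof (induction m)
  case 0
  then show ?case by (simp add: Pi_def)
next
  case (Suc m)
  have "(\<Oplus>l\<in>{..<n + Suc m}. F l) = F (n + m) \<oplus> (\<Oplus>l\<in>{..<n + m}. F l)"
    using Suc.prems by (simp add: lessThan_Suc Pi_def)
  also have "\<dots> = F (n + m) \<oplus> ((\<Oplus>l\<in>{..<n}. F l) \<oplus> (\<Oplus>l\<in>{..<m}. F (n + l)))"
    using Suc by simp
  also have "\<dots> = (\<Oplus>l\<in>{..<n}. F l) \<oplus> (F (n + m) \<oplus> (\<Oplus>l\<in>{..<m}. F (n + l)))"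
    using Suc.prems by (intro a_lcomm) (auto simp: Pi_def)
  also have "F (n + m) \<oplus> (\<Oplus>l\<in>{..<m}. F (n + l)) = (\<Oplus>l\<in>{..<Suc m}. F (n + l))"
    using Suc.prems by (simp add: lessThan_Suc Pi_def)
  finally show ?case .
qed

lemma finsum_zeroI: "(\<And>l. l \<in> A \<Longrightarrow> F l = \<zero>) \<Longrightarrow> (\<Oplus>l\<in>A. F l) = \<zero>"
  by (rule add.finprod_one_eqI)

lemma finsum_delta:
  assumes "k < (n::nat)" "\<And>l. l < n \<Longrightarrow> F l \<in> carrier R" "\<And>l. l < n \<Longrightarrow> l \<noteq> k \<Longrightarrow> F l = \<zero>"
  shows "(\<Oplus>l\<in>{..<n}. F l) = F k"
proof -
  have "(\<Oplus>l\<in>{..<n}. F l) = (\<Oplus>l\<in>{..<n}. if k = l then F l else \<zero>)"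
    by (rule finsum_cong') (use assms in auto)
  also have "\<dots> = F k" using assms by (intro finsum_singleton) auto
  finally show ?thesis .
qed

lemma finsum_sandwich:
  assumes "x \<in> carrier R" "y \<in> carrier R" "\<And>l. l < (n::nat) \<Longrightarrow> c l \<in> carrier R" "\<And>l. l < n \<Longrightarrow> d l \<in> carrier R"
  shows "(\<Oplus>l\<in>{..<n}. (x \<otimes> c l) \<otimes> (d l \<otimes> y)) = x \<otimes> (\<Oplus>l\<in>{..<n}. c l \<otimes> d l) \<otimes> y"
proof -
  have "x \<otimes> (\<Oplus>l\<in>{..<n}. c l \<otimes> d l) \<otimes> y = (\<Oplus>l\<in>{..<n}. x \<otimes> (c l \<otimes> d l)) \<otimes> y"
    using assms by (subst finsum_rdistr) (auto simp: Pi_def)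
  also have "\<dots> = (\<Oplus>l\<in>{..<n}. x \<otimes> (c l \<otimes> d l) \<otimes> y)"
    using assms by (subst finsum_ldistr) (auto simp: Pi_def)
  also have "\<dots> = (\<Oplus>l\<in>{..<n}. (x \<otimes> c l) \<otimes> (d l \<otimes> y))"
    by (rule finsum_cong') (use assms in \<open>auto simp: m_assoc\<close>)
  finally show ?thesis by simp
qed

text \<open>The column \<open>a\<close> and the row \<open>b\<close> are mutually inverse isomorphisms between the
  projective module \<open>e R\<^sup>n\<close> and the free module \<open>R\<close>.\<close>

definition splits :: "nat \<Rightarrow> (nat \<Rightarrow> nat \<Rightarrow> 'a) \<Rightarrow> (nat \<Rightarrow> 'a) \<Rightarrow> (nat \<Rightarrow> 'a) \<Rightarrow> bool" where
  "splits n e a b \<longleftrightarrow> (\<forall>i<n. a i \<in> carrier R \<and> b i \<in> carrier R) \<and>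
    (\<forall>i<n. \<forall>j<n. e i j = a i \<otimes> b j) \<and> (\<Oplus>i\<in>{..<n}. b i \<otimes> a i) = \<one>"

text \<open>The inner factors contract to the \<open>\<one>\<close> of
  \<open>splits m f c d\<close>: this is composition of maps through the free module of rank
  one.\<close>

lemma splits_mult:
  assumes e: "splits n e a b" and f: "splits m f c d" and g: "splits k g u v"
    and "i < n" "j < k"
  shows "(\<Oplus>l\<in>{..<m}. (a i \<otimes> d l) \<otimes> (c l \<otimes> v j)) = a i \<otimes> v j"
proof -
  have "(\<Oplus>l\<in>{..<m}. (a i \<otimes> d l) \<otimes> (c l \<otimes> v j)) = a i \<otimes> (\<Oplus>l\<in>{..<m}. d l \<otimes> c l) \<otimes> v j"
    using assms by (intro finsum_sandwich) (auto simp: splits_def)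
  then show ?thesis using assms by (simp add: splits_def)
qed

lemma splits_idempotent:
  assumes e: "e \<in> mat_carrier R n n" and s: "splits n e a b"
  shows "(n, e) \<in> idempotents R"
proof -
  have "mat_mult R n n n e e i j = e i j" for i j
  proof (cases "i < n \<and> j < n")
    case True
    then have "(\<Oplus>l\<in>{..<n}. e i l \<otimes> e l j) = (\<Oplus>l\<in>{..<n}. (a i \<otimes> b l) \<otimes> (a l \<otimes> b j))"
      using s by (intro finsum_cong') (auto simp: splits_def)
    also have "\<dots> = e i j" using splits_mult[OF s s s] True s by (simp add: splits_def)
    finally show ?thesis using True by (simp add: mat_mult_def)
  qed (use e in \<open>auto simp: mat_mult_def mat_carrier_def\<close>)
  then show ?thesis using e by (auto simp: idempotents_def)
qed

text \<open>Both images are isomorphic to the free module of rank one. \<open>A\<close> enters it by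
  the row \<open>d\<close> and leaves by the column \<open>a\<close>; \<open>B\<close> enters by
  \<open>b\<close> and leaves by \<open>c\<close>.\<close>

lemma splits_idem_equiv:
  assumes e: "e \<in> mat_carrier R n n" "splits n e a b" and f: "f \<in> mat_carrier R m m" "splits m f c d"
  shows "((n, e), (m, f)) \<in> idem_equiv R"
proof -
  define A where "A = (\<lambda>i k. if i < n \<and> k < m then a i \<otimes> d k else \<zero>)"
  define B where "B = (\<lambda>k i. if k < m \<and> i < n then c k \<otimes> b i else \<zero>)"
  have AB: "mat_mult R n m n A B i j = e i j" for i j
  proof (cases "i < n \<and> j < n")
    case True
    then have "(\<Oplus>l\<in>{..<m}. A i l \<otimes> B l j) = (\<Oplus>l\<in>{..<m}. (a i \<otimes> d l) \<otimes> (c l \<otimes> b j))"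
      using e f by (intro finsum_cong') (auto simp: splits_def A_def B_def)
    also have "\<dots> = e i j" using splits_mult[OF e(2) f(2) e(2)] True e by (simp add: splits_def)
    finally show ?thesis using True by (simp add: mat_mult_def)
  qed (use e in \<open>auto simp: mat_mult_def mat_carrier_def\<close>)
  have BA: "mat_mult R m n m B A i j = f i j" for i j
  proof (cases "i < m \<and> j < m")
    case True
    then have "(\<Oplus>l\<in>{..<n}. B i l \<otimes> A l j) = (\<Oplus>l\<in>{..<n}. (c i \<otimes> b l) \<otimes> (a l \<otimes> d j))"
      using e f by (intro finsum_cong') (auto simp: splits_def A_def B_def)
    also have "\<dots> = f i j" using splits_mult[OF f(2) e(2) f(2)] True f by (simp add: splits_def)
    finally show ?thesis using True by (simp add: mat_mult_def)
  qed (use f in \<open>auto simp: mat_mult_def mat_carrier_def\<close>)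
  have "A \<in> mat_carrier R n m" "B \<in> mat_carrier R m n"
    using e f by (auto simp: A_def B_def mat_carrier_def splits_def)
  then show ?thesis
    using AB BA splits_idempotent[OF e] splits_idempotent[OF f] unfolding idem_equiv_def by blast
qed

lemma idem_sum_idempotent:
  assumes x: "x \<in> idempotents R" and y: "y \<in> idempotents R"
  shows "idem_sum R x y \<in> idempotents R"
proof -
  obtain n e where xe: "x = (n, e)" by (cases x)
  obtain m f where yf: "y = (m, f)" by (cases y)
  have e: "e \<in> mat_carrier R n n" "mat_mult R n n n e e = e"
    and f: "f \<in> mat_carrier R m m" "mat_mult R m m m f f = f"
    using x y by (auto simp: xe yf idempotents_def)
  have ec: "e i j \<in> carrier R" and fc: "f i j \<in> carrier R" for i j
    using e(1) f(1) unfolding mat_carrier_def by (metis (mono_tags, lifting) mem_Collect_eq zero_closed)+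
  have ee: "(\<Oplus>l\<in>{..<n}. e i l \<otimes> e l j) = e i j" if "i < n" "j < n" for i j
    using fun_cong[OF fun_cong[OF e(2)], of i j] that by (simp add: mat_mult_def)
  have ff: "(\<Oplus>l\<in>{..<m}. f i l \<otimes> f l j) = f i j" if "i < m" "j < m" for i j
    using fun_cong[OF fun_cong[OF f(2)], of i j] that by (simp add: mat_mult_def)
  define g where "g = snd (idem_sum R x y)"
  have g: "g i j = (if i < n \<and> j < n then e i j
      else if n \<le> i \<and> i < n + m \<and> n \<le> j \<and> j < n + m then f (i - n) (j - n) else \<zero>)" for i j
    by (simp add: g_def idem_sum_def xe yf)
  have gc: "g i j \<in> carrier R" for i j
    by (simp add: g ec fc)
  have "mat_mult R (n + m) (n + m) (n + m) g g i j = g i j" for i j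
  proof (cases "i < n + m \<and> j < n + m")
    case True
    \<comment> \<open>Cutting the summation at \<open>n\<close> leaves one diagonal block to each
      half; in every other product one factor is an entry off the blocks.\<close>
    have "(\<Oplus>l\<in>{..<n + m}. g i l \<otimes> g l j) =
        (\<Oplus>l\<in>{..<n}. g i l \<otimes> g l j) \<oplus> (\<Oplus>l\<in>{..<m}. g i (n + l) \<otimes> g (n + l) j)"
      by (rule finsum_split) (simp add: gc)
    also have "\<dots> = g i j"
    proof -
      have 1: "(\<Oplus>l\<in>{..<n}. g i l \<otimes> g l j) = (if i < n \<and> j < n then e i j else \<zero>)"
      proof (cases "i < n \<and> j < n")
        case True
        then have "(\<Oplus>l\<in>{..<n}. g i l \<otimes> g l j) = (\<Oplus>l\<in>{..<n}. e i l \<otimes> e l j)"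
          by (intro finsum_cong') (auto simp: g ec)
        then show ?thesis using ee True by simp
      next
        case False
        then have "(\<Oplus>l\<in>{..<n}. g i l \<otimes> g l j) = \<zero>"
          by (intro finsum_zeroI) (auto simp: g gc ec)
        then show ?thesis by (simp only: False if_False)
      qed
      have 2: "(\<Oplus>l\<in>{..<m}. g i (n + l) \<otimes> g (n + l) j) =
          (if n \<le> i \<and> n \<le> j then f (i - n) (j - n) else \<zero>)"
      proof (cases "n \<le> i \<and> n \<le> j")
        case True
        then have "(\<Oplus>l\<in>{..<m}. g i (n + l) \<otimes> g (n + l) j) = (\<Oplus>l\<in>{..<m}. f (i - n) l \<otimes> f l (j - n))"
          using \<open>i < n + m \<and> j < n + m\<close> by (intro finsum_cong') (auto simp: g fc)
        then show ?thesis using ff[of "i - n" "j - n"] True \<open>i < n + m \<and> j < n + m\<close> by auto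
      next
        case False
        then have "(\<Oplus>l\<in>{..<m}. g i (n + l) \<otimes> g (n + l) j) = \<zero>"
          by (intro finsum_zeroI) (auto simp: g gc fc)
        then show ?thesis by (simp only: False if_False)
      qed
      show ?thesis unfolding 1 2 using True by (auto simp: g ec fc)
    qed
    finally show ?thesis using True by (simp add: mat_mult_def)
  qed (auto simp: mat_mult_def g)
  moreover have "g \<in> mat_carrier R (n + m) (n + m)"
    by (simp add: mat_carrier_def gc) (simp add: g)
  ultimately have "(n + m, g) \<in> idempotents R" by (auto simp: idempotents_def)
  then show ?thesis by (simp add: g_def idem_sum_def xe yf)
qed

text \<open>Orthogonal isometries \<open>s i\<close> with adjoints \<open>t i\<close> turn a matrix over \<open>R\<close> into an element of \<open>R\<close>.\<close>

lemma matrix_idempotent_to_ring: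
  fixes s t :: "nat \<Rightarrow> 'a"
  assumes s: "\<And>i. s i \<in> carrier R" and t: "\<And>i. t i \<in> carrier R"
    and ts: "\<And>i j. t i \<otimes> s j = (if i = j then \<one> else \<zero>)"
    and e: "(n, e) \<in> idempotents R"
  obtains E where "E \<in> carrier R" "E \<otimes> E = E"
    "\<And>i j. i < n \<Longrightarrow> j < n \<Longrightarrow> t i \<otimes> E \<otimes> s j = e i j"
    "(\<Oplus>i\<in>{..<n}. s i \<otimes> (t i \<otimes> E)) = E"
proof
  \<comment> \<open>\<open>E\<close> is the sum of all
    \<open>s i \<otimes> e i j \<otimes> t j\<close>, grouped by rows so that \<open>t k\<close>
    extracts row \<open>k\<close>.\<close>
  define r where "r = (\<lambda>i. \<Oplus>j\<in>{..<n}. e i j \<otimes> t j)"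
  define E where "E = (\<Oplus>i\<in>{..<n}. s i \<otimes> r i)"
  have ec: "e i j \<in> carrier R" if "i < n" "j < n" for i j
    using e that by (auto simp: idempotents_def mat_carrier_def)
  have ee: "(\<Oplus>l\<in>{..<n}. e i l \<otimes> e l j) = e i j" if "i < n" "j < n" for i j
  proof -
    have "mat_mult R n n n e e = e" using e by (simp add: idempotents_def)
    from fun_cong[OF fun_cong[OF this], of i j] show ?thesis using that by (simp add: mat_mult_def)
  qed
  have r: "r i \<in> carrier R" if "i < n" for i
    unfolding r_def using ec t that by (intro finsum_closed) (auto simp: Pi_def)
  show E: "E \<in> carrier R"
    unfolding E_def using r s by (intro finsum_closed) (auto simp: Pi_def)
  have tE: "t k \<otimes> E = r k" if "k < n" for k
  proof -
    have "t k \<otimes> E = (\<Oplus>i\<in>{..<n}. t k \<otimes> (s i \<otimes> r i))"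
      unfolding E_def using s r t by (subst finsum_rdistr) (auto simp: Pi_def)
    also have "\<dots> = t k \<otimes> (s k \<otimes> r k)"
      using s t r that by (intro finsum_delta) (auto simp: m_assoc[symmetric] ts)
    also have "\<dots> = r k" using s t r that by (simp add: m_assoc[symmetric] ts)
    finally show ?thesis .
  qed
  have "(\<Oplus>i\<in>{..<n}. s i \<otimes> (t i \<otimes> E)) = (\<Oplus>i\<in>{..<n}. s i \<otimes> r i)"
    by (rule finsum_cong') (use s r tE in auto)
  also have "\<dots> = E" by (simp only: E_def)
  finally show "(\<Oplus>i\<in>{..<n}. s i \<otimes> (t i \<otimes> E)) = E" .
  show "t i \<otimes> E \<otimes> s j = e i j" if ij: "i < n" "j < n" for i j
  proof -
    have "t i \<otimes> E \<otimes> s j = (\<Oplus>l\<in>{..<n}. e i l \<otimes> t l \<otimes> s j)"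
      unfolding tE[OF ij(1)] unfolding r_def using s t ec ij by (subst finsum_ldistr) (auto simp: Pi_def)
    also have "\<dots> = e i j \<otimes> t j \<otimes> s j"
      using s t ec ij by (intro finsum_delta) (auto simp: m_assoc ts)
    also have "\<dots> = e i j" using s t ec ij by (simp add: m_assoc ts)
    finally show ?thesis .
  qed
  have rE: "r i \<otimes> E = r i" if i: "i < n" for i
  proof -
    have "r i \<otimes> E = (\<Oplus>j\<in>{..<n}. e i j \<otimes> t j \<otimes> E)"
      unfolding r_def using t E ec i by (subst finsum_ldistr) (auto simp: Pi_def)
    also have "\<dots> = (\<Oplus>j\<in>{..<n}. e i j \<otimes> r j)"
      using t E ec i r by (intro finsum_cong') (auto simp: m_assoc tE)
    also have "\<dots> = (\<Oplus>j\<in>{..<n}. \<Oplus>k\<in>{..<n}. e i j \<otimes> (e j k \<otimes> t k))"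
      using t ec i by (intro finsum_cong' refl) (auto simp: r_def finsum_rdistr Pi_def)
    also have "\<dots> = (\<Oplus>k\<in>{..<n}. \<Oplus>j\<in>{..<n}. e i j \<otimes> (e j k \<otimes> t k))"
      using t ec i by (intro finsum_swap) auto
    also have "\<dots> = (\<Oplus>k\<in>{..<n}. (\<Oplus>j\<in>{..<n}. e i j \<otimes> e j k) \<otimes> t k)"
    proof (intro finsum_cong' refl)
      fix k assume k: "k \<in> {..<n}"
      have "(\<Oplus>j\<in>{..<n}. e i j \<otimes> (e j k \<otimes> t k)) = (\<Oplus>j\<in>{..<n}. e i j \<otimes> e j k \<otimes> t k)"
        using t ec i k by (intro finsum_cong' refl) (auto simp: m_assoc)
      also have "\<dots> = (\<Oplus>j\<in>{..<n}. e i j \<otimes> e j k) \<otimes> t k"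
        using t ec i k by (intro finsum_ldistr[symmetric]) auto
      finally show "(\<Oplus>j\<in>{..<n}. e i j \<otimes> (e j k \<otimes> t k)) = (\<Oplus>j\<in>{..<n}. e i j \<otimes> e j k) \<otimes> t k" .
    qed (use t ec i in \<open>auto simp: Pi_def\<close>)
    also have "\<dots> = r i"
      unfolding r_def using t ec ee i by (intro finsum_cong' refl) auto
    finally show ?thesis .
  qed
  have "E \<otimes> E = (\<Oplus>i\<in>{..<n}. s i \<otimes> r i \<otimes> E)"
    using s r E by (subst (1) E_def, subst finsum_ldistr) (auto simp: Pi_def)
  also have "\<dots> = (\<Oplus>i\<in>{..<n}. s i \<otimes> r i)"
    using s r E by (intro finsum_cong') (auto simp: m_assoc rE)
  finally show "E \<otimes> E = E" by (simp add: E_def)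
qed

text \<open>\<open>\<alpha>, \<beta>, \<gamma>, \<delta>\<close> are the components of mutually inverse isomorphisms \<open>E R \<oplus> R \<cong> R\<close>.\<close>

definition absorbed :: "'a \<Rightarrow> bool" where
  "absorbed E \<longleftrightarrow> (\<exists>\<alpha>\<in>carrier R. \<exists>\<beta>\<in>carrier R. \<exists>\<gamma>\<in>carrier R. \<exists>\<delta>\<in>carrier R.
    \<alpha> \<otimes> \<beta> = E \<and> \<gamma> \<otimes> \<delta> = \<one> \<and> \<alpha> \<otimes> \<delta> = \<zero> \<and> \<gamma> \<otimes> \<beta> = \<zero> \<and> \<beta> \<otimes> \<alpha> \<oplus> \<delta> \<otimes> \<gamma> = \<one>)"

text \<open>Conjugate idempotents have isomorphic images. Only the \<open>E\<close> side of the
  isomorphism is corrected, by \<open>w\<close> on \<open>\<alpha>\<close> and by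
  \<open>inv w\<close> on \<open>\<beta>\<close>; the free summand keeps \<open>\<gamma>\<close> and
  \<open>\<delta>\<close>.\<close>

lemma absorbed_conjugate:
  assumes w: "w \<in> Units R" and E: "E \<in> carrier R" and a: "absorbed (inv w \<otimes> E \<otimes> w)"
  shows "absorbed E"
proof -
  have wc: "w \<in> carrier R" "inv w \<in> carrier R" using w Units_closed Units_inv_closed by auto
  have ww: "w \<otimes> inv w = \<one>" "inv w \<otimes> w = \<one>" using w Units_r_inv Units_l_inv by auto
  have wx: "w \<otimes> (inv w \<otimes> x) = x" "inv w \<otimes> (w \<otimes> x) = x" if "x \<in> carrier R" for x
    using that wc ww by (simp_all add: m_assoc[symmetric])
  obtain \<alpha> \<beta> \<gamma> \<delta> where cl: "\<alpha> \<in> carrier R" "\<beta> \<in> carrier R" "\<gamma> \<in> carrier R" "\<delta> \<in> carrier R"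
    and rel: "\<alpha> \<otimes> \<beta> = inv w \<otimes> E \<otimes> w" "\<gamma> \<otimes> \<delta> = \<one>" "\<alpha> \<otimes> \<delta> = \<zero>" "\<gamma> \<otimes> \<beta> = \<zero>"
      "\<beta> \<otimes> \<alpha> \<oplus> \<delta> \<otimes> \<gamma> = \<one>"
    using a unfolding absorbed_def by blast
  have "(w \<otimes> \<alpha>) \<otimes> (\<beta> \<otimes> inv w) = w \<otimes> (\<alpha> \<otimes> \<beta>) \<otimes> inv w"
    using cl wc by (simp add: m_assoc)
  also have "\<dots> = E" unfolding rel(1) using E wc ww by (simp add: m_assoc wx)
  finally have 1: "(w \<otimes> \<alpha>) \<otimes> (\<beta> \<otimes> inv w) = E" .
  have 2: "(w \<otimes> \<alpha>) \<otimes> \<delta> = \<zero>" using cl wc rel by (simp add: m_assoc)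
  have 3: "\<gamma> \<otimes> (\<beta> \<otimes> inv w) = \<zero>" using cl wc rel by (simp add: m_assoc[symmetric])
  have "(\<beta> \<otimes> inv w) \<otimes> (w \<otimes> \<alpha>) = \<beta> \<otimes> \<alpha>" using cl wc by (simp add: m_assoc wx)
  then show ?thesis unfolding absorbed_def
    using 1 2 3 rel cl wc
    by (intro bexI[of _ "w \<otimes> \<alpha>"] bexI[of _ "\<beta> \<otimes> inv w"] bexI[of _ \<gamma>] bexI[of _ \<delta>]) simp_all
qed

definition unit_matrix :: "nat \<Rightarrow> nat \<Rightarrow> 'a" where
  "unit_matrix = (\<lambda>i j. if i < 1 \<and> j < 1 then \<one> else \<zero>)"

text \<open>The composite of \<open>e R^n \<oplus> R \<cong> E R \<oplus> R \<cong> R\<close>: the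
  first isomorphism comes from the \<open>t i\<close> and \<open>s i\<close>, the second from
  absorption. The added unit sits at index \<open>n\<close>, so \<open>\<gamma>\<close> and
  \<open>\<delta>\<close> are the last entries of \<open>a\<close> and \<open>b\<close>.\<close>

lemma idem_sum_unit_splits:
  fixes s t :: "nat \<Rightarrow> 'a"
  assumes s: "\<And>i. s i \<in> carrier R" and t: "\<And>i. t i \<in> carrier R"
    and ts: "\<And>i j. t i \<otimes> s j = (if i = j then \<one> else \<zero>)"
    and absorbed: "\<And>E. E \<in> carrier R \<Longrightarrow> E \<otimes> E = E \<Longrightarrow> absorbed E"
    and e: "(n, e) \<in> idempotents R"
  shows "\<exists>a b. splits (n + 1) (snd (idem_sum R (n, e) (1, unit_matrix))) a b"
proof -
  obtain E where E: "E \<in> carrier R" "E \<otimes> E = E"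
    and tEs: "\<And>i j. i < n \<Longrightarrow> j < n \<Longrightarrow> t i \<otimes> E \<otimes> s j = e i j"
    and stE: "(\<Oplus>i\<in>{..<n}. s i \<otimes> (t i \<otimes> E)) = E"
    by (rule matrix_idempotent_to_ring[OF s t ts e]) blast
  obtain \<alpha> \<beta> \<gamma> \<delta> where cl: "\<alpha> \<in> carrier R" "\<beta> \<in> carrier R" "\<gamma> \<in> carrier R" "\<delta> \<in> carrier R"
    and rel: "\<alpha> \<otimes> \<beta> = E" "\<gamma> \<otimes> \<delta> = \<one>" "\<alpha> \<otimes> \<delta> = \<zero>" "\<gamma> \<otimes> \<beta> = \<zero>" "\<beta> \<otimes> \<alpha> \<oplus> \<delta> \<otimes> \<gamma> = \<one>"
    using absorbed[OF E] unfolding absorbed_def by blast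
  define a where "a = (\<lambda>i. if i < n then t i \<otimes> \<alpha> else \<gamma>)"
  define b where "b = (\<lambda>i. if i < n then \<beta> \<otimes> s i else \<delta>)"
  \<comment> \<open>The sum of the \<open>s i \<otimes> t i\<close> with \<open>i < n\<close> is not
    known to be \<open>\<one>\<close>, only to fix \<open>E\<close> from the left. With
    \<open>E \<otimes> \<alpha> = \<alpha>\<close> an \<open>E\<close> can be inserted, on which
    this sum collapses.\<close>
  have E\<alpha>: "E \<otimes> \<alpha> = \<alpha>"
  proof -
    have "\<alpha> = \<alpha> \<otimes> (\<beta> \<otimes> \<alpha> \<oplus> \<delta> \<otimes> \<gamma>)" using cl rel by simp
    also have "\<dots> = \<alpha> \<otimes> \<beta> \<otimes> \<alpha> \<oplus> \<alpha> \<otimes> \<delta> \<otimes> \<gamma>" using cl by (simp add: r_distr m_assoc)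
    also have "\<dots> = E \<otimes> \<alpha>" using cl rel E by simp
    finally show ?thesis by simp
  qed
  have ab: "a i \<otimes> b j = snd (idem_sum R (n, e) (1, unit_matrix)) i j" if "i < n + 1" "j < n + 1" for i j
  proof -
    have "t i \<otimes> \<alpha> \<otimes> (\<beta> \<otimes> s j) = t i \<otimes> (\<alpha> \<otimes> \<beta>) \<otimes> s j"
      "t i \<otimes> \<alpha> \<otimes> \<delta> = t i \<otimes> (\<alpha> \<otimes> \<delta>)" "\<gamma> \<otimes> (\<beta> \<otimes> s j) = \<gamma> \<otimes> \<beta> \<otimes> s j"
      using cl s t by (simp_all add: m_assoc)
    then show ?thesis
      using that tEs cl rel s t
      by (auto simp: a_def b_def idem_sum_def unit_matrix_def)
  qed
  have "(\<Oplus>i\<in>{..<n + 1}. b i \<otimes> a i) = (\<Oplus>i\<in>{..<n}. b i \<otimes> a i) \<oplus> (\<Oplus>i\<in>{..<1}. b (n + i) \<otimes> a (n + i))"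
    using cl s t by (intro finsum_split) (auto simp: a_def b_def)
  also have "(\<Oplus>i\<in>{..<1}. b (n + i) \<otimes> a (n + i)) = \<delta> \<otimes> \<gamma>"
    using cl by (simp add: a_def b_def lessThan_Suc)
  also have "(\<Oplus>i\<in>{..<n}. b i \<otimes> a i) = (\<Oplus>i\<in>{..<n}. (\<beta> \<otimes> s i) \<otimes> (t i \<otimes> \<alpha>))"
    using cl s t by (intro finsum_cong' refl) (auto simp: a_def b_def)
  also have "\<dots> = (\<Oplus>i\<in>{..<n}. \<beta> \<otimes> (s i \<otimes> (t i \<otimes> E)) \<otimes> \<alpha>)"
    using cl s t E by (intro finsum_cong' refl) (auto simp: m_assoc E\<alpha>)
  also have "\<dots> = (\<Oplus>i\<in>{..<n}. \<beta> \<otimes> (s i \<otimes> (t i \<otimes> E))) \<otimes> \<alpha>"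
    using cl s t E by (subst finsum_ldistr) (auto simp: Pi_def)
  also have "(\<Oplus>i\<in>{..<n}. \<beta> \<otimes> (s i \<otimes> (t i \<otimes> E))) = \<beta> \<otimes> E"
    using cl s t E by (subst finsum_rdistr[symmetric]) (auto simp: Pi_def stE)
  also have "\<beta> \<otimes> E \<otimes> \<alpha> = \<beta> \<otimes> \<alpha>" using cl E by (simp add: m_assoc E\<alpha>)
  finally have "(\<Oplus>i\<in>{..<n + 1}. b i \<otimes> a i) = \<one>" using rel by simp
  then have "splits (n + 1) (snd (idem_sum R (n, e) (1, unit_matrix))) a b"
    using cl s t ab unfolding splits_def by (auto simp: a_def b_def)
  then show ?thesis by blast
qed

lemma unit_matrix_splits: "unit_matrix \<in> mat_carrier R 1 1" "splits 1 unit_matrix (\<lambda>_. \<one>) (\<lambda>_. \<one>)"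
  by (auto simp: unit_matrix_def mat_carrier_def splits_def lessThan_Suc)

theorem K0_trivial:
  fixes s t :: "nat \<Rightarrow> 'a"
  assumes s: "\<And>i. s i \<in> carrier R" and t: "\<And>i. t i \<in> carrier R"
    and ts: "\<And>i j. t i \<otimes> s j = (if i = j then \<one> else \<zero>)"
    and absorbed: "\<And>E. E \<in> carrier R \<Longrightarrow> E \<otimes> E = E \<Longrightarrow> absorbed E"
  shows "carrier (K0 R) = {\<one>\<^bsub>K0 R\<^esub>}"
proof -
  let ?I = "idempotents R" and ?u = "(1, unit_matrix) :: nat \<times> (nat \<Rightarrow> nat \<Rightarrow> 'a)"
  have u: "?u \<in> ?I" using splits_idempotent[OF unit_matrix_splits] .
  have equiv: "(idem_sum R x ?u, idem_sum R y ?u) \<in> idem_equiv R" if "x \<in> ?I" "y \<in> ?I" for x y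
  proof -
    have *: "\<exists>a b. snd (idem_sum R x ?u) \<in> mat_carrier R (fst x + 1) (fst x + 1) \<and>
        splits (fst x + 1) (snd (idem_sum R x ?u)) a b \<and> idem_sum R x ?u = (fst x + 1, snd (idem_sum R x ?u))"
      if x: "x \<in> ?I" for x
    proof -
      have "idem_sum R x ?u = (fst x + 1, snd (idem_sum R x ?u))" by (simp add: idem_sum_def)
      moreover from this have "snd (idem_sum R x ?u) \<in> mat_carrier R (fst x + 1) (fst x + 1)"
        using idem_sum_idempotent[OF x u] unfolding idempotents_def by (metis (mono_tags, lifting) case_prodD mem_Collect_eq)
      ultimately show ?thesis
        using idem_sum_unit_splits[OF s t ts absorbed, of "fst x" "snd x"] x by auto
    qed
    from *[OF that(1)] *[OF that(2)] show ?thesis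
      by (metis splits_idem_equiv)
  qed
  \<comment> \<open>The common summand permitted by \<open>K0_rel\<close> is taken to be
    \<open>?u\<close>; then any two pairs of idempotents are related.\<close>
  have rel: "K0_rel R = (?I \<times> ?I) \<times> (?I \<times> ?I)"
    unfolding K0_rel_def using u equiv idem_sum_idempotent by blast
  define z where "z = (0 :: nat, \<lambda>(i::nat) (j::nat). \<zero>)"
  have z: "z \<in> ?I"
    by (auto simp: z_def idempotents_def mat_carrier_def mat_mult_def)
  have "(?I \<times> ?I) // K0_rel R = {K0_rel R `` {(z, z)}}"
    unfolding rel quotient_def using z by auto
  then show ?thesis by (simp add: K0_def z_def)
qed

end

subsection \<open>Arithmetic of p-adic digit expansions\<close>

locale padic_base =
  fixes p :: nat
  assumes prime_p: "prime p"
begin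

section \<open>Congruence of rational numbers modulo powers of \<open>p\<close>\<close>

definition pw :: "int \<Rightarrow> rat" where "pw k = of_nat p powi k"

lemma p_gt_1: "p > 1"
  using prime_p prime_gt_1_nat by blast

lemma pw_pos [simp]: "pw k > 0"
  using p_gt_1 unfolding pw_def by (intro zero_less_power_int) auto

lemma pw_nonzero [simp]: "pw k \<noteq> 0"
  using pw_pos[of k] by linarith

lemma pw_add: "pw (a + b) = pw a * pw b"
  using p_gt_1 unfolding pw_def by (intro power_int_add) auto

lemma pw_Suc: "pw (k + 1) = pw k * of_nat p"
  using pw_add[of k 1] by (simp add: pw_def)

lemma pw_Ints: "k \<ge> 0 \<Longrightarrow> pw k \<in> \<int>"
  by (simp add: pw_def power_int_def)

text \<open>Congruence modulo \<open>p^N\<close> times the integers, also for negative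
  \<open>N\<close>. Digit operations match rational arithmetic on truncations only up to carries
  into positions from \<open>N\<close> on, and this relation absorbs them.\<close>

definition pcong :: "int \<Rightarrow> rat \<Rightarrow> rat \<Rightarrow> bool" where
  "pcong N r s \<longleftrightarrow> (\<exists>t::int. r - s = of_int t * pw N)"

lemma pcong_refl [simp]: "pcong N r r"
  unfolding pcong_def by (rule exI[of _ 0]) simp

lemma pcong_sym: "pcong N r s \<Longrightarrow> pcong N s r"
  unfolding pcong_def by (metis minus_diff_eq mult_minus_left of_int_minus)

lemma pcong_trans [trans]: "pcong N r s \<Longrightarrow> pcong N s t \<Longrightarrow> pcong N r t"
  unfolding pcong_def
proof (elim exE)
  fix a b :: int assume "r - s = of_int a * pw N" "s - t = of_int b * pw N"
  then have "r - t = of_int (a + b) * pw N" by (simp add: algebra_simps)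
  then show "\<exists>c::int. r - t = of_int c * pw N" by blast
qed

lemma pcong_add: "pcong N r s \<Longrightarrow> pcong N r' s' \<Longrightarrow> pcong N (r + r') (s + s')"
  unfolding pcong_def
proof (elim exE)
  fix a b :: int assume "r - s = of_int a * pw N" "r' - s' = of_int b * pw N"
  then have "r + r' - (s + s') = of_int (a + b) * pw N" by (simp add: algebra_simps)
  then show "\<exists>c::int. r + r' - (s + s') = of_int c * pw N" by blast
qed

lemma pcong_minus: "pcong N r s \<Longrightarrow> pcong N (- r) (- s)"
  unfolding pcong_def by (metis minus_diff_eq minus_diff_minus mult_minus_left of_int_minus)

text \<open>The precision changes by the valuation of the factor; \<open>M\<close> may be negative,
  and then precision is lost.\<close>

lemma pcong_scale: "pcong N r s \<Longrightarrow> pcong M c 0 \<Longrightarrow> pcong (N + M) (c * r) (c * s)"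
  unfolding pcong_def
proof (elim exE)
  fix a b :: int assume 1: "r - s = of_int a * pw N" "c - 0 = of_int b * pw M"
  have "c * r - c * s = c * (r - s)" by (simp add: algebra_simps)
  also have "\<dots> = of_int (a * b) * pw (N + M)" using 1 by (simp add: pw_add)
  finally show "\<exists>t::int. c * r - c * s = of_int t * pw (N + M)" by blast
qed

lemma pcong_mono: "pcong N r s \<Longrightarrow> M \<le> N \<Longrightarrow> pcong M r s"
  unfolding pcong_def
proof (elim exE)
  fix a :: int assume 1: "r - s = of_int a * pw N" and le: "M \<le> N"
  obtain b :: int where b: "pw (N - M) = of_int b" using pw_Ints[of "N - M"] le by (auto elim: Ints_cases)
  have "r - s = of_int (a * b) * pw M"
    using 1 pw_add[of M "N - M"] b by simp
  then show "\<exists>c::int. r - s = of_int c * pw M" by blast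
qed

lemma pcong_int_scale: "pcong N r s \<Longrightarrow> c \<in> \<int> \<Longrightarrow> pcong N (c * r) (c * s)"
proof -
  assume *: "pcong N r s" "c \<in> \<int>"
  have "pcong 0 c 0" using *(2) by (auto simp: pcong_def pw_def elim: Ints_cases)
  with pcong_scale[OF *(1) this] show ?thesis by simp
qed

text \<open>A half-open interval of length \<open>p^N\<close> meets each class once, which makes
  truncations canonical representatives.\<close>

lemma pcong_small_eq:
  assumes "pcong N r s" "0 \<le> r" "r < pw N" "0 \<le> s" "s < pw N"
  shows "r = s"
proof -
  obtain t :: int where t: "r - s = of_int t * pw N" using assms unfolding pcong_def by blast
  have "(of_int t :: rat) * pw N < 1 * pw N" "(- 1) * pw N < of_int t * pw N" using assms t by linarith+
  then have "(of_int t :: rat) < 1" "- 1 < (of_int t :: rat)"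
    using mult_less_cancel_right_pos[OF pw_pos[of N]] by blast+
  then have "t = 0" by linarith
  with t show ?thesis by simp
qed

section \<open>Truncations and valuations\<close>

abbreviation tr :: "padic \<Rightarrow> int \<Rightarrow> rat" where "tr \<equiv> padic_trunc p"

lemma tr_def: "tr x N = (\<Sum>k\<in>{k. k < N \<and> x k \<noteq> 0}. of_nat (x k) * pw k)"
  by (simp add: padic_trunc_def pw_def)

lemma digit_of_pw: "digit_of p k r = nat (\<lfloor>r / pw k\<rfloor> mod int p)"
  by (simp add: digit_of_def pw_def)

text \<open>The valuation bound \<open>v(x) >= n\<close>; phrased by digits it covers zero without
  an infinite valuation.\<close>

definition vge :: "int \<Rightarrow> padic \<Rightarrow> bool" where
  "vge n x \<longleftrightarrow> (\<forall>k<n. x k = 0)"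

lemma QpI: "(\<And>k. x k < p) \<Longrightarrow> vge m x \<Longrightarrow> x \<in> Qp p"
  unfolding Qp_def vge_def by blast

lemma Qp_vge: "x \<in> Qp p \<Longrightarrow> \<exists>m. vge m x"
  unfolding Qp_def vge_def by blast

lemma Zp_iff: "x \<in> Zp p \<longleftrightarrow> x \<in> Qp p \<and> vge 0 x"
  unfolding Zp_def vge_def by auto

lemma Qp_digit: "x \<in> Qp p \<Longrightarrow> x k < p"
  unfolding Qp_def by blast

lemma finite_supp: "x \<in> Qp p \<Longrightarrow> finite {k. k < (N::int) \<and> x k \<noteq> 0}"
proof -
  assume "x \<in> Qp p"
  then obtain m where "vge m x" using Qp_vge by blast
  then have "{k. k < N \<and> x k \<noteq> 0} \<subseteq> {m..<N}" unfolding vge_def by (auto simp: not_less[symmetric])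
  then show ?thesis by (rule finite_subset) simp
qed

lemma tr_Suc:
  assumes "x \<in> Qp p"
  shows "tr x (N + 1) = tr x N + of_nat (x N) * pw N"
proof (cases "x N = 0")
  case True
  then have "{k. k < N + 1 \<and> x k \<noteq> 0} = {k. k < N \<and> x k \<noteq> 0}"
    by (metis less_le zless_add1_eq)
  then show ?thesis using True by (simp add: tr_def)
next
  case False
  then have "{k. k < N + 1 \<and> x k \<noteq> 0} = insert N {k. k < N \<and> x k \<noteq> 0}" by auto
  then show ?thesis using finite_supp[OF assms, of N] by (simp add: tr_def)
qed

lemma tr_below: "vge m x \<Longrightarrow> N \<le> m \<Longrightarrow> tr x N = 0"
  unfolding tr_def vge_def by (rule sum.neutral) force

lemma tr_nonneg: "tr x N \<ge> 0"
  unfolding tr_def by (intro sum_nonneg mult_nonneg_nonneg) (auto intro: less_imp_le)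

lemma tr_less:
  assumes "x \<in> Qp p"
  shows "tr x N < pw N"
proof -
  obtain m where m: "vge m x" using Qp_vge assms by blast
  show ?thesis
  proof (cases "N \<le> m")
    case True
    then show ?thesis using tr_below[OF m] by simp
  next
    case False
    then have "m \<le> N" by simp
    then show ?thesis
    proof (induction N rule: int_ge_induct)
      case base
      then show ?case using tr_below[OF m] by simp
    next
      case (step i)
      have "x i + 1 \<le> p" using Qp_digit[OF assms, of i] by simp
      then have "of_nat (x i + 1) * pw i \<le> of_nat p * pw i"
        by (intro mult_right_mono) (auto intro: less_imp_le simp del: of_nat_add)
      then show ?case using step tr_Suc[OF assms, of i] pw_Suc[of i] by (simp add: algebra_simps)
    qed
  qed
qed

lemma tr_mod:
  assumes "x \<in> Qp p" "N \<le> T"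
  shows "pcong N (tr x T) (tr x N)"
  using assms(2)
proof (induction T rule: int_ge_induct)
  case (step i)
  have "pcong i (tr x (i + 1)) (tr x i)"
    unfolding pcong_def tr_Suc[OF assms(1)] by (rule exI[of _ "int (x i)"]) simp
  then show ?case using step pcong_mono pcong_trans by blast
qed simp

lemma tr_vge:
  assumes "x \<in> Qp p" "vge m x"
  shows "pcong m (tr x N) 0"
proof (cases "N \<le> m")
  case True
  then show ?thesis using tr_below[OF assms(2)] by simp
next
  case False
  then show ?thesis using tr_mod[OF assms(1), of m N] tr_below[OF assms(2), of m] by simp
qed

lemma vge_iff_tr:
  assumes "x \<in> Qp p"
  shows "vge m x \<longleftrightarrow> tr x m = 0"
proof
  assume *: "tr x m = 0"
  show "vge m x" unfolding vge_def
  proof (intro allI impI, rule ccontr)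
    fix k assume k: "k < m" "x k \<noteq> 0"
    then have "of_nat (x k) * pw k \<le> tr x m"
      unfolding tr_def
      by (intro member_le_sum) (use k finite_supp[OF assms, of m] in \<open>auto intro: less_imp_le\<close>)
    moreover have "of_nat (x k) * pw k > 0" using k by simp
    ultimately show False using * by linarith
  qed
qed (simp add: tr_below)

text \<open>Truncations at level \<open>k\<close> lie in \<open>[0, p^k)\<close>, so congruence at
  level \<open>N\<close> forces equality at every level up to \<open>N\<close>, and the digits are
  recovered from consecutive truncations.\<close>

lemma tr_agree_iff:
  assumes "x \<in> Qp p" "y \<in> Qp p"
  shows "(\<forall>k<N. x k = y k) \<longleftrightarrow> pcong N (tr x N) (tr y N)"
proof
  assume *: "\<forall>k<N. x k = y k"
  have "tr x N = tr y N" unfolding tr_def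
    by (rule sum.cong) (use * in auto)
  then show "pcong N (tr x N) (tr y N)" by simp
next
  assume *: "pcong N (tr x N) (tr y N)"
  have eq: "tr x k = tr y k" if "k \<le> N" for k
  proof (rule pcong_small_eq[of k])
    show "pcong k (tr x k) (tr y k)"
      using tr_mod[OF assms(1) that] tr_mod[OF assms(2) that] pcong_mono[OF * that]
        pcong_sym pcong_trans by blast
  qed (auto simp: tr_nonneg tr_less assms)
  show "\<forall>k<N. x k = y k"
  proof (intro allI impI)
    fix k assume "k < N"
    then have "tr x (k + 1) = tr y (k + 1)" "tr x k = tr y k" by (auto intro: eq)
    then show "x k = y k" using tr_Suc[OF assms(1), of k] tr_Suc[OF assms(2), of k] by simp
  qed
qed

lemma Qp_eqI:
  assumes "x \<in> Qp p" "y \<in> Qp p" "\<And>N. pcong N (tr x N) (tr y N)"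
  shows "x = y"
proof
  fix k
  show "x k = y k" using tr_agree_iff[OF assms(1,2), of "k + 1"] assms(3) by simp
qed

lemma digit_of_less: "digit_of p k r < p"
  unfolding digit_of_def using p_gt_1 by (simp add: nat_less_iff)

text \<open>The p-adic numbers as an inverse limit: residues \<open>r N\<close> that are compatible
  and vanish at low levels come from a digit expansion. Sums, negatives, products and inverses of
  units are all built by naming their \<open>r\<close>.\<close>

lemma digits_coherent:
  assumes coh: "\<And>N. pcong N (r (N + 1)) (r N)"
    and low: "\<And>N. N \<le> M \<Longrightarrow> pcong N (r N) 0"
  defines "x \<equiv> (\<lambda>k. digit_of p k (r (k + 1)))"
  shows "x \<in> Qp p" and "pcong N (tr x N) (r N)" and "vge M x"
proof -
  show v: "vge M x" unfolding vge_def
  proof (intro allI impI)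
    fix k assume "k < M"
    \<comment> \<open>Digit \<open>k\<close> is read off at level \<open>k + 1\<close>, and
      \<open>k < M\<close> still gives \<open>k + 1 \<le> M\<close>; so the quotient by
      \<open>pw k\<close> is a multiple of \<open>p\<close>.\<close>
    then obtain t :: int where t: "r (k + 1) = of_int t * pw (k + 1)"
      using low[of "k + 1"] unfolding pcong_def by auto
    then have "r (k + 1) / pw k = of_int (t * int p)" by (simp add: pw_Suc)
    then have "\<lfloor>r (k + 1) / pw k\<rfloor> = t * int p" by (simp only: floor_of_int)
    then show "x k = 0" by (simp add: x_def digit_of_pw)
  qed
  show Q: "x \<in> Qp p" using v by (intro QpI[of x M]) (auto simp: x_def digit_of_less)
  show "pcong N (tr x N) (r N)"
  proof (cases "N \<le> M")
    case True
    then show ?thesis using tr_below[OF v] low pcong_sym by force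
  next
    case False
    then have "M \<le> N" by simp
    then show ?thesis
    proof (induction N rule: int_ge_induct)
      case base
      then show ?case using tr_below[OF v] low pcong_sym by force
    next
      case (step i)
      \<comment> \<open>By coherence \<open>r (i + 1)\<close> extends the digits found so far by an
        integral multiple of \<open>pw i\<close>. These digits contribute less than
        \<open>pw i\<close>, so the floor is \<open>t\<close> and the new digit is
        \<open>t mod p\<close>; the quotient \<open>q\<close> disappears modulo
        \<open>pw (i + 1)\<close>.\<close>
      obtain t :: int where t: "r (i + 1) = tr x i + of_int t * pw i"
      proof -
        have "pcong i (r (i + 1)) (tr x i)" using step coh pcong_sym pcong_trans by blast
        then show ?thesis using that unfolding pcong_def by (metis add.commute diff_add_cancel)
      qed
      have "r (i + 1) / pw i = of_int t + tr x i / pw i"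
        unfolding t by (simp add: add_divide_distrib)
      moreover have "0 \<le> tr x i / pw i" "tr x i / pw i < 1"
        using tr_nonneg tr_less[OF Q] by (auto simp: divide_simps)
      ultimately have "\<lfloor>r (i + 1) / pw i\<rfloor> = t" by (simp add: floor_eq_iff)
      then have d: "int (x i) = t mod int p"
        using p_gt_1 by (simp add: x_def digit_of_pw)
      define q where "q = t div int p"
      have "int (x i) = t - q * int p" unfolding d q_def by (simp add: minus_div_mult_eq_mod)
      then have "of_int (int (x i)) = (of_int (t - q * int p) :: rat)" by simp
      then have t': "of_int t = (of_nat (x i) + of_int q * of_nat p :: rat)" by simp
      have "r (i + 1) - tr x (i + 1) = of_int q * pw (i + 1)"
        unfolding tr_Suc[OF Q] t t' pw_Suc by (simp add: algebra_simps)
      then have "pcong (i + 1) (r (i + 1)) (tr x (i + 1))" unfolding pcong_def by blast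
      then show ?case by (rule pcong_sym)
    qed
  qed
qed

section \<open>Addition and negation\<close>

abbreviation add (infixl "[+]" 65) where "x [+] y \<equiv> padic_add p x y"

abbreviation mult (infixl "[*]" 70) where "a [*] x \<equiv> padic_mult p a x"

lemma
  assumes "x \<in> Qp p" "y \<in> Qp p"
  shows add_Qp: "x [+] y \<in> Qp p"
    and tr_add: "pcong N (tr (x [+] y) N) (tr x N + tr y N)"
    and vge_add: "vge m x \<Longrightarrow> vge m y \<Longrightarrow> vge m (x [+] y)"
proof -
  let ?r = "\<lambda>N. tr x N + tr y N"
  have coh: "pcong N (?r (N + 1)) (?r N)" for N
    by (intro pcong_add tr_mod assms) auto
  have low: "pcong N (?r N) 0" if "vge M x" "vge M y" "N \<le> M" for N M
    using that by (simp add: tr_below)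
  obtain m1 m2 where "vge m1 x" "vge m2 y" using assms Qp_vge by meson
  then have m: "vge (min m1 m2) x" "vge (min m1 m2) y" by (auto simp: vge_def)
  show "x [+] y \<in> Qp p" "pcong N (tr (x [+] y) N) (?r N)"
    unfolding padic_add_def using digits_coherent[of ?r, OF coh low[OF m]] by blast+
  show "vge m (x [+] y)" if "vge m x" "vge m y"
    unfolding padic_add_def using digits_coherent(3)[of ?r, OF coh low[OF that]] by blast
qed


text \<open>Here \<open>digit_of\<close> meets negative rationals; floor and \<open>mod\<close>
  still yield the right digits, for instance \<open>p - 1\<close> at every position from 0 on for
  the negative of one.\<close>

definition padic_neg :: "padic \<Rightarrow> padic" where
  "padic_neg x = (\<lambda>k. digit_of p k (- tr x (k + 1)))"

lemma
  assumes "x \<in> Qp p"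
  shows neg_Qp: "padic_neg x \<in> Qp p"
    and tr_neg: "pcong N (tr (padic_neg x) N) (- tr x N)"
    and vge_neg: "vge m x \<Longrightarrow> vge m (padic_neg x)"
proof -
  let ?r = "\<lambda>N. - tr x N"
  have coh: "pcong N (?r (N + 1)) (?r N)" for N
    by (intro pcong_minus tr_mod assms) auto
  have low: "pcong N (?r N) 0" if "vge M x" "N \<le> M" for N M
    using that by (simp add: tr_below)
  obtain m1 where m1: "vge m1 x" using assms Qp_vge by meson
  show "padic_neg x \<in> Qp p" "pcong N (tr (padic_neg x) N) (?r N)"
    unfolding padic_neg_def using digits_coherent[of ?r, OF coh low[OF m1]] by blast+
  show "vge m (padic_neg x)" if "vge m x"
    unfolding padic_neg_def using digits_coherent(3)[of ?r, OF coh low[OF that]] by blast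
qed

definition padic_zero :: padic where "padic_zero = (\<lambda>_. 0)"

lemma vge_zero [simp]: "vge m padic_zero"
  by (simp add: vge_def padic_zero_def)

lemma zero_Qp [simp]: "padic_zero \<in> Qp p"
  using p_gt_1 by (intro QpI[OF _ vge_zero]) (auto simp: padic_zero_def)

lemma tr_zero [simp]: "tr padic_zero N = 0"
  using tr_below[of N padic_zero N] by simp

lemma add_comm: "x [+] y = y [+] x"
  by (simp add: padic_add_def add.commute)

lemma add_assoc:
  assumes "x \<in> Qp p" "y \<in> Qp p" "z \<in> Qp p"
  shows "x [+] y [+] z = x [+] (y [+] z)"
proof (rule Qp_eqI)
  fix N
  have "pcong N (tr (x [+] y [+] z) N) (tr (x [+] y) N + tr z N)"
    by (intro tr_add add_Qp assms)
  also have "pcong N \<dots> (tr x N + tr y N + tr z N)"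
    by (intro tr_add pcong_add assms pcong_refl)
  finally have 1: "pcong N (tr (x [+] y [+] z) N) (tr x N + tr y N + tr z N)" .
  have "pcong N (tr (x [+] (y [+] z)) N) (tr x N + tr (y [+] z) N)"
    by (intro tr_add add_Qp assms)
  also have "pcong N \<dots> (tr x N + (tr y N + tr z N))"
    by (intro tr_add pcong_add assms pcong_refl)
  finally have "pcong N (tr (x [+] (y [+] z)) N) (tr x N + tr y N + tr z N)"
    by (simp add: add.assoc)
  with 1 show "pcong N (tr (x [+] y [+] z) N) (tr (x [+] (y [+] z)) N)"
    using pcong_sym pcong_trans by blast
qed (auto intro: add_Qp assms)

lemma add_zero_left:
  assumes "x \<in> Qp p"
  shows "padic_zero [+] x = x"
proof (rule Qp_eqI)
  show "pcong N (tr (padic_zero [+] x) N) (tr x N)" for N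
    using tr_add[OF zero_Qp assms, of N] by simp
qed (auto intro: add_Qp assms)

lemma add_neg_left:
  assumes "x \<in> Qp p"
  shows "padic_neg x [+] x = padic_zero"
proof (rule Qp_eqI)
  fix N
  have "pcong N (tr (padic_neg x [+] x) N) (tr (padic_neg x) N + tr x N)"
    by (intro tr_add neg_Qp assms)
  also have "pcong N \<dots> (- tr x N + tr x N)"
    by (intro tr_neg pcong_add assms pcong_refl)
  finally show "pcong N (tr (padic_neg x [+] x) N) (tr padic_zero N)" by simp
qed (auto intro: add_Qp neg_Qp assms)

section \<open>Multiplication by p-adic integers\<close>

lemma Ints_iff_pcong: "r \<in> \<int> \<longleftrightarrow> pcong 0 r 0"
  by (auto simp: pcong_def pw_def elim: Ints_cases)

lemma tr_Ints: "a \<in> Zp p \<Longrightarrow> tr a N \<in> \<int>"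
  using tr_vge[of a 0 N] by (simp add: Zp_iff Ints_iff_pcong)

lemma vge_depth:
  assumes "x \<in> Qp p"
  shows "vge (- int (padic_depth p x)) x"
proof -
  obtain m where m: "vge m x" using Qp_vge assms by blast
  have "\<forall>k < - int (nat (- m)). x k = 0" using m unfolding vge_def by auto
  then show ?thesis unfolding padic_depth_def vge_def by (rule LeastI)
qed

text \<open>The two factors need different precision: an error in \<open>a\<close> is magnified by
  up to \<open>p^d\<close> through \<open>x\<close>, whereas an error in \<open>x\<close> is
  multiplied by the integer \<open>tr a (N + d)\<close> and does not grow.\<close>

lemma tr_mult_stable:
  assumes a: "a \<in> Zp p" and x: "x \<in> Qp p" and d: "vge (- d) x"
    and T: "N + d \<le> T" "N \<le> T'"
  shows "pcong N (tr a T * tr x T') (tr a (N + d) * tr x N)"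
proof -
  have aQ: "a \<in> Qp p" using a by (simp add: Zp_iff)
  have "pcong (N + d + - d) (tr x T' * tr a T) (tr x T' * tr a (N + d))"
    by (intro pcong_scale tr_mod[OF aQ] tr_vge[OF x] T d)
  then have "pcong N (tr a T * tr x T') (tr a (N + d) * tr x T')" by (simp add: mult.commute)
  also have "pcong N \<dots> (tr a (N + d) * tr x N)"
    by (intro pcong_int_scale tr_mod x T tr_Ints a)
  finally show ?thesis .
qed

lemma
  assumes a: "a \<in> Zp p" and x: "x \<in> Qp p"
  shows mult_Qp: "a [*] x \<in> Qp p"
    and tr_mult: "vge (- d) x \<Longrightarrow> pcong N (tr (a [*] x) N) (tr a (N + d) * tr x N)"
    and vge_mult: "vge m x \<Longrightarrow> vge m (a [*] x)"
proof -
  \<comment> \<open>The precision prescribed by \<open>padic_mult\<close>: digit \<open>k\<close> is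
    computed from both truncations at level \<open>k + 1 + D\<close>.\<close>
  define D where "D = int (padic_depth p x)"
  let ?r = "\<lambda>N. tr a (N + D) * tr x (N + D)"
  have D: "vge (- D) x" unfolding D_def by (rule vge_depth[OF x])
  have D0: "D \<ge> 0" by (simp add: D_def)
  have st: "pcong N (?r N) (tr a (N + D) * tr x N)" for N
    by (rule tr_mult_stable[OF a x D]) (use D0 in auto)
  have coh: "pcong N (?r (N + 1)) (?r N)" for N
  proof -
    have "pcong N (?r (N + 1)) (tr a (N + D) * tr x N)"
      by (rule tr_mult_stable[OF a x D]) (use D0 in auto)
    then show ?thesis using st pcong_sym pcong_trans by blast
  qed
  have low: "pcong N (?r N) 0" if "vge M x" "N \<le> M" for N M
    using st[of N] tr_below[OF that] by simp
  have eq: "a [*] x = (\<lambda>k. digit_of p k (?r (k + 1)))"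
    unfolding padic_mult_def Let_def D_def ..
  show "a [*] x \<in> Qp p"
    unfolding eq using digits_coherent[of ?r, OF coh low[OF D]] by blast
  show "vge m (a [*] x)" if "vge m x"
    unfolding eq using digits_coherent(3)[of ?r, OF coh low[OF that]] by blast
  assume d: "vge (- d) x"
  \<comment> \<open>Passing through a common depth frees the law from \<open>padic_depth\<close>:
    any bound \<open>d\<close> will do. Distributivity needs one \<open>d\<close> valid for both
    summands and for their sum.\<close>
  define e where "e = max d D"
  have e: "vge (- e) x" "d \<le> e" "D \<le> e" using d D unfolding e_def by (auto simp: vge_def max_def)
  have "pcong N (tr (a [*] x) N) (?r N)"
    unfolding eq using digits_coherent(2)[of ?r, OF coh low[OF D]] by blast
  also have "pcong N (?r N) (tr a (N + D) * tr x N)" by (rule st)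
  also have "pcong N \<dots> (tr a (N + e) * tr x N)"
    by (rule pcong_sym, rule tr_mult_stable[OF a x D]) (use e in auto)
  also have "pcong N \<dots> (tr a (N + d) * tr x N)"
    by (rule tr_mult_stable[OF a x d]) (use e in auto)
  finally show "pcong N (tr (a [*] x) N) (tr a (N + d) * tr x N)" .
qed

lemma common_depth:
  assumes "x \<in> Qp p" "y \<in> Qp p"
  obtains d where "d \<ge> 0" "vge (- d) x" "vge (- d) y"
proof
  let ?d = "max (int (padic_depth p x)) (int (padic_depth p y))"
  show "?d \<ge> 0" "vge (- ?d) x" "vge (- ?d) y"
    using vge_depth[OF assms(1)] vge_depth[OF assms(2)] by (auto simp: vge_def)
qed

lemma mult_add_right:
  assumes a: "a \<in> Zp p" and x: "x \<in> Qp p" and y: "y \<in> Qp p"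
  shows "a [*] (x [+] y) = a [*] x [+] a [*] y"
proof (rule Qp_eqI)
  fix N
  obtain d where d: "vge (- d) x" "vge (- d) y" using common_depth x y by blast
  have "pcong N (tr (a [*] (x [+] y)) N) (tr a (N + d) * tr (x [+] y) N)"
    by (intro tr_mult a x y d add_Qp vge_add)
  also have "pcong N \<dots> (tr a (N + d) * (tr x N + tr y N))"
    by (intro pcong_int_scale tr_add x y tr_Ints a)
  finally have 1: "pcong N (tr (a [*] (x [+] y)) N) (tr a (N + d) * tr x N + tr a (N + d) * tr y N)"
    by (simp add: distrib_left)
  have "pcong N (tr (a [*] x [+] a [*] y) N) (tr (a [*] x) N + tr (a [*] y) N)"
    by (intro tr_add mult_Qp a x y)
  also have "pcong N \<dots> (tr a (N + d) * tr x N + tr a (N + d) * tr y N)"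
    by (intro pcong_add tr_mult a x y d)
  finally show "pcong N (tr (a [*] (x [+] y)) N) (tr (a [*] x [+] a [*] y) N)"
    using 1 pcong_sym pcong_trans by blast
qed (intro add_Qp mult_Qp assms)+

lemma Zp_Qp: "a \<in> Zp p \<Longrightarrow> a \<in> Qp p"
  by (simp add: Zp_iff)

lemma neg_Zp: "a \<in> Zp p \<Longrightarrow> padic_neg a \<in> Zp p"
  by (simp add: Zp_iff neg_Qp vge_neg)

lemma zero_Zp [simp]: "padic_zero \<in> Zp p"
  by (simp add: Zp_iff)

text \<open>Modulo \<open>p^N\<close> both sides are the product of the same three truncations. In
  this form the law says that multiplication by a fixed integral coefficient is
  \<open>Zp p\<close>-linear.\<close>

lemma mult_left_commute:
  assumes a: "a \<in> Zp p" and b: "b \<in> Zp p" and x: "x \<in> Qp p"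
  shows "a [*] (b [*] x) = b [*] (a [*] x)"
proof (rule Qp_eqI)
  fix N
  obtain d where d: "vge (- d) x" using common_depth x by blast
  have *: "pcong N (tr (a [*] (b [*] x)) N) (tr a (N + d) * (tr b (N + d) * tr x N))"
    if a: "a \<in> Zp p" and b: "b \<in> Zp p" for a b
  proof -
    have "pcong N (tr (a [*] (b [*] x)) N) (tr a (N + d) * tr (b [*] x) N)"
      by (intro tr_mult a b x d mult_Qp vge_mult)
    also have "pcong N \<dots> (tr a (N + d) * (tr b (N + d) * tr x N))"
      by (intro pcong_int_scale tr_mult b x d tr_Ints a)
    finally show ?thesis .
  qed
  show "pcong N (tr (a [*] (b [*] x)) N) (tr (b [*] (a [*] x)) N)"
    using *[OF a b] pcong_sym[OF *[OF b a]] by (simp add: mult.left_commute pcong_trans)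
qed (intro mult_Qp assms)+

lemma mult_commute:
  assumes a: "a \<in> Zp p" and b: "b \<in> Zp p"
  shows "a [*] b = b [*] a"
proof (rule Qp_eqI)
  fix N
  have *: "pcong N (tr (a [*] b) N) (tr a N * tr b N)"
    if "a \<in> Zp p" "b \<in> Zp p" for a b
    using tr_mult[of a b 0 N] that by (simp add: Zp_iff)
  show "pcong N (tr (a [*] b) N) (tr (b [*] a) N)"
    using *[OF a b] pcong_sym[OF *[OF b a]] by (simp add: mult.commute pcong_trans)
qed (intro mult_Qp assms Zp_Qp)+

definition padic_one :: padic where "padic_one = (\<lambda>k. if k = 0 then 1 else 0)"

lemma one_Zp [simp]: "padic_one \<in> Zp p"
proof -
  have "vge 0 padic_one" by (simp add: vge_def padic_one_def)
  moreover have "padic_one \<in> Qp p"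
    using p_gt_1 by (intro QpI[OF _ calculation]) (auto simp: padic_one_def)
  ultimately show ?thesis by (simp add: Zp_iff)
qed

lemma tr_one: "N > 0 \<Longrightarrow> tr padic_one N = 1"
proof -
  assume "N > 0"
  then have "{k. k < N \<and> padic_one k \<noteq> 0} = {0}" by (auto simp: padic_one_def)
  then show ?thesis by (simp add: tr_def) (simp add: padic_one_def pw_def)
qed

lemma mult_one_right:
  assumes a: "a \<in> Zp p"
  shows "a [*] padic_one = a"
proof (rule Qp_eqI)
  fix N
  have *: "pcong N (tr (a [*] padic_one) N) (tr a N * tr padic_one N)"
    using tr_mult[of a padic_one 0 N] one_Zp a by (simp add: Zp_iff)
  show "pcong N (tr (a [*] padic_one) N) (tr a N)"
  proof (cases "N > 0")
    case True
    with * show ?thesis by (simp add: tr_one)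
  next
    case False
    with * show ?thesis using tr_below[of 0 a N] a by (simp add: Zp_iff)
  qed
qed (intro mult_Qp assms Zp_Qp one_Zp)+

lemma mult_zero_right: "a \<in> Zp p \<Longrightarrow> a [*] padic_zero = padic_zero"
  by (rule Qp_eqI) (use tr_mult[of a padic_zero 0] in \<open>auto intro: mult_Qp\<close>)

lemma mult_zero_left:
  assumes x: "x \<in> Qp p"
  shows "padic_zero [*] x = padic_zero"
proof (rule Qp_eqI)
  fix N
  obtain d where d: "vge (- d) x" using common_depth x by blast
  show "pcong N (tr (padic_zero [*] x) N) (tr padic_zero N)"
    using tr_mult[OF zero_Zp x d, of N] by simp
qed (auto intro: mult_Qp x)

text \<open>Multiplication by \<open>p^m\<close>, where \<open>m\<close> may be negative. The laws
  for \<open>padic_mult\<close> have an integral first factor and do not cover division by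
  \<open>p\<close>.\<close>

definition shift :: "int \<Rightarrow> padic \<Rightarrow> padic" where
  "shift m x = (\<lambda>k. x (k - m))"

lemma vge_shift [simp]: "vge n (shift m x) \<longleftrightarrow> vge (n - m) x"
  unfolding vge_def shift_def
  by (metis add_diff_cancel_right' diff_add_cancel diff_less_eq less_diff_eq)

lemma shift_Qp:
  assumes "x \<in> Qp p"
  shows "shift m x \<in> Qp p"
proof -
  obtain n where "vge n x" using Qp_vge assms by blast
  then have "vge (n + m) (shift m x)" by simp
  then show ?thesis by (rule QpI[rotated]) (simp add: shift_def Qp_digit assms)
qed

lemma shift_shift [simp]: "shift m (shift n x) = shift (m + n) x"
  by (simp add: shift_def fun_eq_iff algebra_simps)

lemma shift_0 [simp]: "shift 0 x = x"
  by (simp add: shift_def)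

lemma tr_shift: "tr (shift m x) N = pw m * tr x (N - m)"
proof -
  have "tr (shift m x) N = (\<Sum>k\<in>(\<lambda>k. k + m) ` {k. k < N - m \<and> x k \<noteq> 0}. of_nat (shift m x k) * pw k)"
    unfolding tr_def
  proof (rule sum.cong)
    show "{k. k < N \<and> shift m x k \<noteq> 0} = (\<lambda>k. k + m) ` {k. k < N - m \<and> x k \<noteq> 0}"
      unfolding shift_def
    proof (intro equalityI subsetI)
      fix k assume "k \<in> {k. k < N \<and> x (k - m) \<noteq> 0}"
      then show "k \<in> (\<lambda>k. k + m) ` {k. k < N - m \<and> x k \<noteq> 0}"
        by (intro image_eqI[of _ _ "k - m"]) auto
    qed auto
  qed simp
  also have "\<dots> = (\<Sum>k | k < N - m \<and> x k \<noteq> 0. of_nat (x k) * pw (k + m))"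
    by (subst sum.reindex) (auto simp: inj_on_def shift_def)
  also have "\<dots> = pw m * tr x (N - m)"
    unfolding tr_def sum_distrib_left by (rule sum.cong) (simp_all add: pw_add mult_ac)
  finally show ?thesis .
qed

lemma pcong_pw: "pcong m (pw m) 0"
  unfolding pcong_def by (rule exI[of _ 1]) simp

lemma shift_add:
  assumes x: "x \<in> Qp p" and y: "y \<in> Qp p"
  shows "shift m (x [+] y) = shift m x [+] shift m y"
proof (rule Qp_eqI)
  fix N
  have "pcong (N - m + m) (pw m * tr (x [+] y) (N - m)) (pw m * (tr x (N - m) + tr y (N - m)))"
    by (intro pcong_scale tr_add x y pcong_pw)
  then have 1: "pcong N (tr (shift m (x [+] y)) N) (tr (shift m x) N + tr (shift m y) N)"
    by (simp add: tr_shift distrib_left)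
  show "pcong N (tr (shift m (x [+] y)) N) (tr (shift m x [+] shift m y) N)"
    using 1 tr_add[OF shift_Qp[OF x] shift_Qp[OF y]] pcong_sym pcong_trans by blast
qed (intro shift_Qp add_Qp x y)+

lemma shift_mult:
  assumes a: "a \<in> Zp p" and x: "x \<in> Qp p"
  shows "shift m (a [*] x) = a [*] shift m x"
proof (rule Qp_eqI)
  fix N
  obtain d where d: "vge (- d) x" using common_depth x by blast
  have "pcong (N - m + m) (pw m * tr (a [*] x) (N - m)) (pw m * (tr a (N - m + d) * tr x (N - m)))"
    by (intro pcong_scale tr_mult a x d pcong_pw)
  then have 1: "pcong N (tr (shift m (a [*] x)) N) (tr a (N - m + d) * tr (shift m x) N)"
    by (simp add: tr_shift mult_ac)
  have "pcong N (tr (a [*] shift m x) N) (tr a (N + (d - m)) * tr (shift m x) N)"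
    by (rule tr_mult[OF a shift_Qp[OF x]]) (use d in simp)
  then show "pcong N (tr (shift m (a [*] x)) N) (tr (a [*] shift m x) N)"
    using 1 by (metis pcong_sym pcong_trans add_diff_eq diff_add_eq)
qed (intro shift_Qp mult_Qp a x)+

text \<open>A non-zero digit at position 0 makes every truncation at a positive level an integer
  prime to \<open>p\<close>, hence invertible modulo \<open>p^N\<close>. Inverses modulo
  \<open>p^N\<close> are unique, so they form a coherent sequence.\<close>

lemma unit_inverse:
  assumes x: "x \<in> Zp p" and x0: "x 0 \<noteq> 0"
  obtains c where "c \<in> Zp p" "c [*] x = padic_one"
proof -
  have xQ: "x \<in> Qp p" and x0': "vge 0 x" using x by (auto simp: Zp_iff)
  have "\<exists>c::int. pcong N (of_int c * tr x N) 1" if "N > 0" for N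
  proof -
    obtain u where u: "tr x N = of_int u" using tr_Ints[OF x] Ints_cases by blast
    have "\<not> int p dvd u"
    proof
      assume "int p dvd u"
      then obtain k where "u = int p * k" by blast
      then have "pcong 1 (tr x N) 0" unfolding u pcong_def by (auto simp: pw_def)
      then have "pcong 1 (tr x 1) 0"
        using tr_mod[OF xQ, of 1 N] that pcong_sym pcong_trans by (metis int_one_le_iff_zero_less)
      then have "tr x 1 = 0"
        by (rule pcong_small_eq) (auto simp: tr_nonneg tr_less xQ)
      then have "vge 1 x" using vge_iff_tr[OF xQ] by simp
      then show False using x0 by (simp add: vge_def)
    qed
    then have "coprime u (int p)"
      using prime_p by (metis coprime_commute prime_imp_coprime prime_int_nat_transfer nat_int of_nat_0_le_iff prime_nat_int_transfer)
    then have "coprime u (int p ^ nat N)" by simp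
    then obtain c where "[u * c = 1] (mod (int p ^ nat N))"
      using cong_solve_coprime_int by blast
    then obtain k where "u * c - 1 = int p ^ nat N * k" by (auto simp: cong_iff_dvd_diff)
    then have "of_int (u * c - 1) = (of_int (int p ^ nat N * k) :: rat)" by presburger
    then have "of_int c * tr x N - 1 = of_int k * pw N"
      using that by (simp add: u pw_def power_int_def mult_ac)
    then show ?thesis unfolding pcong_def by blast
  qed
  then obtain c :: "int \<Rightarrow> int" where c: "\<And>N. N > 0 \<Longrightarrow> pcong N (of_int (c N) * tr x N) 1"
    by metis
  \<comment> \<open>At levels \<open>N \<le> 0\<close> every integer is congruent to 0, and the
    value 0 meets the low-level condition of \<open>digits_coherent\<close>.\<close>
  define r where "r = (\<lambda>N. if N > 0 then of_int (c N) else 0 :: rat)"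
  have low: "pcong N (r N) 0" if "N \<le> 0" for N
    using that by (simp add: r_def)
  have coh: "pcong N (r (N + 1)) (r N)" for N
  proof (cases "N > 0")
    case True
    \<comment> \<open>Uniqueness of inverses: modulo \<open>p^N\<close> the product
      \<open>?c * ?c' * tr x N\<close> is congruent to both \<open>?c'\<close> and
      \<open>?c\<close>.\<close>
    let ?c = "of_int (c N) :: rat" and ?c' = "of_int (c (N + 1)) :: rat"
    have "pcong N (?c' * 1) (?c' * (?c * tr x N))"
      by (intro pcong_int_scale pcong_sym[OF c] True) auto
    then have 1: "pcong N ?c' (?c * ?c' * tr x N)" by (simp add: mult_ac)
    have 2: "pcong N \<dots> (?c * ?c' * tr x (N + 1))"
      by (intro pcong_int_scale pcong_sym[OF tr_mod] xQ) auto
    have "pcong N (?c * (?c' * tr x (N + 1))) (?c * 1)"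
      by (intro pcong_int_scale pcong_mono[OF c]) (use True in auto)
    then have "pcong N (?c * ?c' * tr x (N + 1)) ?c" by (simp add: mult_ac)
    with 1 2 have "pcong N ?c' ?c" using pcong_trans by blast
    then show ?thesis using True by (simp add: r_def)
  next
    case False
    then have "pcong 0 (r (N + 1)) (r N)"
      by (auto simp: r_def Ints_iff_pcong[symmetric])
    then show ?thesis using pcong_mono False by simp
  qed
  define y where "y = (\<lambda>k. digit_of p k (r (k + 1)))"
  have y: "y \<in> Zp p" and tr_y: "pcong N (tr y N) (r N)" for N
    unfolding Zp_iff y_def using digits_coherent[of r 0, OF coh low] by blast+
  have "y [*] x = padic_one"
  proof (rule Qp_eqI)
    fix N
    have *: "pcong N (tr (y [*] x) N) (tr y N * tr x N)"
      using tr_mult[of y x 0 N] x y by (simp add: Zp_iff)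
    show "pcong N (tr (y [*] x) N) (tr padic_one N)"
    proof (cases "N > 0")
      case True
      have "pcong N (tr x N * tr y N) (tr x N * r N)"
        by (intro pcong_int_scale tr_y tr_Ints x)
      then have "pcong N (tr y N * tr x N) (of_int (c N) * tr x N)"
        using True by (simp add: r_def mult.commute)
      with * c[OF True] show ?thesis unfolding tr_one[OF True] using pcong_trans by blast
    next
      case False
      then show ?thesis using * tr_below[OF x0', of N] tr_below[of 0 padic_one N] one_Zp
        by (simp add: Zp_iff)
    qed
  qed (intro mult_Qp y xQ Zp_Qp one_Zp)+
  with y show ?thesis using that by blast
qed

subsection \<open>The topology of the restricted product\<close>

lemma openin_Qp_top:
  "openin (Qp_top p) U \<longleftrightarrow>
    U \<subseteq> Qp p \<and> (\<forall>x\<in>U. \<exists>n::int. {y \<in> Qp p. \<forall>k<n. y k = x k} \<subseteq> U)"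
proof -
  have "istopology (\<lambda>U. U \<subseteq> Qp p \<and> (\<forall>x\<in>U. \<exists>n::int. {y \<in> Qp p. \<forall>k<n. y k = x k} \<subseteq> U))"
    unfolding istopology_def
  proof (intro conjI allI impI ballI)
    fix S T x
    assume "S \<subseteq> Qp p \<and> (\<forall>x\<in>S. \<exists>n::int. {y \<in> Qp p. \<forall>k<n. y k = x k} \<subseteq> S)"
      "T \<subseteq> Qp p \<and> (\<forall>x\<in>T. \<exists>n::int. {y \<in> Qp p. \<forall>k<n. y k = x k} \<subseteq> T)" "x \<in> S \<inter> T"
    then obtain m n :: int where "{y \<in> Qp p. \<forall>k<m. y k = x k} \<subseteq> S" "{y \<in> Qp p. \<forall>k<n. y k = x k} \<subseteq> T"
      by (meson IntE)
    then have "{y \<in> Qp p. \<forall>k<max m n. y k = x k} \<subseteq> S \<inter> T" by auto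
    then show "\<exists>n::int. {y \<in> Qp p. \<forall>k<n. y k = x k} \<subseteq> S \<inter> T" by blast
  next
    fix \<K> x
    assume K: "\<forall>S\<in>\<K>. S \<subseteq> Qp p \<and> (\<forall>x\<in>S. \<exists>n::int. {y \<in> Qp p. \<forall>k<n. y k = x k} \<subseteq> S)" and "x \<in> \<Union>\<K>"
    then obtain S where S: "S \<in> \<K>" "x \<in> S" by blast
    with K obtain n :: int where "{y \<in> Qp p. \<forall>k<n. y k = x k} \<subseteq> S" by meson
    with S show "\<exists>n::int. {y \<in> Qp p. \<forall>k<n. y k = x k} \<subseteq> \<Union>\<K>" by blast
  qed blast+
  then show ?thesis unfolding Qp_top_def by simp
qed

lemma topspace_Qp_top [simp]: "topspace (Qp_top p) = Qp p"
proof (rule antisym)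
  show "Qp p \<subseteq> topspace (Qp_top p)"
    by (rule openin_subset) (unfold openin_Qp_top, blast)
  show "topspace (Qp_top p) \<subseteq> Qp p"
    using openin_topspace[of "Qp_top p"] unfolding openin_Qp_top by blast
qed

text \<open>The ultrametric situation: every point of a ball is a centre of it.\<close>

lemma openin_Qp_ball: "openin (Qp_top p) {y \<in> Qp p. \<forall>k<(n::int). y k = x k}"
  unfolding openin_Qp_top
proof (intro conjI ballI)
  fix z assume "z \<in> {y \<in> Qp p. \<forall>k<n. y k = x k}"
  then have "{y \<in> Qp p. \<forall>k<n. y k = z k} \<subseteq> {y \<in> Qp p. \<forall>k<n. y k = x k}" by auto
  then show "\<exists>n'. {y \<in> Qp p. \<forall>k<n'. y k = z k} \<subseteq> {y \<in> Qp p. \<forall>k<n. y k = x k}" by blast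
qed blast

abbreviation V :: "(nat \<Rightarrow> padic) set" where "V \<equiv> QpN p"

definition agree :: "int \<Rightarrow> nat set \<Rightarrow> (nat \<Rightarrow> padic) \<Rightarrow> (nat \<Rightarrow> padic) \<Rightarrow> bool" where
  "agree n K \<xi> \<eta> \<longleftrightarrow> (\<forall>j. \<forall>k<0. \<eta> j k = \<xi> j k) \<and> (\<forall>j\<in>K. \<forall>k<n. \<eta> j k = \<xi> j k)"

lemma V_Qp: "\<xi> \<in> V \<Longrightarrow> \<xi> i \<in> Qp p"
  by (simp add: QpN_def)

lemma openin_tau_box:
  "openin (tau p) A \<longleftrightarrow> A \<subseteq> V \<and>
      (\<forall>P. finite P \<longrightarrow>
         openin (subtopology (product_topology (\<lambda>_. Qp_top p) UNIV) (QpN_box p P))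
                (A \<inter> QpN_box p P))"
proof -
  have "istopology (\<lambda>A. A \<subseteq> V \<and>
      (\<forall>P. finite P \<longrightarrow>
         openin (subtopology (product_topology (\<lambda>_. Qp_top p) UNIV) (QpN_box p P))
                (A \<inter> QpN_box p P)))"
    unfolding istopology_def
  proof (intro conjI allI impI)
    fix S T P
    assume S: "S \<subseteq> V \<and> (\<forall>P. finite P \<longrightarrow>
         openin (subtopology (product_topology (\<lambda>_. Qp_top p) UNIV) (QpN_box p P)) (S \<inter> QpN_box p P))"
      and T: "T \<subseteq> V \<and> (\<forall>P. finite P \<longrightarrow>
         openin (subtopology (product_topology (\<lambda>_. Qp_top p) UNIV) (QpN_box p P)) (T \<inter> QpN_box p P))"
      and P: "finite (P :: nat set)"
    have "openin (subtopology (product_topology (\<lambda>_. Qp_top p) UNIV) (QpN_box p P))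
        ((S \<inter> QpN_box p P) \<inter> (T \<inter> QpN_box p P))"
      using S T P by (intro openin_Int[of _ "S \<inter> _" "T \<inter> _"]) blast+
    also have "(S \<inter> QpN_box p P) \<inter> (T \<inter> QpN_box p P) = S \<inter> T \<inter> QpN_box p P" by blast
    finally show "openin (subtopology (product_topology (\<lambda>_. Qp_top p) UNIV) (QpN_box p P))
        (S \<inter> T \<inter> QpN_box p P)" .
  next
    fix \<K> P
    assume K: "\<forall>S\<in>\<K>. S \<subseteq> V \<and> (\<forall>P. finite P \<longrightarrow>
         openin (subtopology (product_topology (\<lambda>_. Qp_top p) UNIV) (QpN_box p P)) (S \<inter> QpN_box p P))"
      and P: "finite (P :: nat set)"
    have "openin (subtopology (product_topology (\<lambda>_. Qp_top p) UNIV) (QpN_box p P))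
        (\<Union>S\<in>\<K>. S \<inter> QpN_box p P)"
      using K P by (intro openin_Union) blast
    also have "(\<Union>S\<in>\<K>. S \<inter> QpN_box p P) = \<Union>\<K> \<inter> QpN_box p P" by blast
    finally show "openin (subtopology (product_topology (\<lambda>_. Qp_top p) UNIV) (QpN_box p P))
        (\<Union>\<K> \<inter> QpN_box p P)" .
  qed blast+
  then show ?thesis unfolding tau_def by simp
qed

lemma box_subset: "finite P \<Longrightarrow> QpN_box p P \<subseteq> V"
proof
  fix \<xi> assume P: "finite P" and \<xi>: "\<xi> \<in> QpN_box p P"
  have "{i. \<xi> i \<notin> Zp p} \<subseteq> P" using \<xi> by (auto simp: QpN_box_def)
  moreover have "\<xi> i \<in> Qp p" for i
    using \<xi> Zp_Qp by (cases "i \<in> P") (auto simp: QpN_box_def)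
  ultimately show "\<xi> \<in> V" using P by (auto simp: QpN_def intro: finite_subset)
qed

text \<open>Integrality concerns the digits below 0, and \<open>agree\<close> fixes all of them; so
  a neighbourhood stays in each box that contains its centre.\<close>

lemma agree_box:
  assumes "\<xi> \<in> QpN_box p P" "\<eta> \<in> V" "agree n K \<xi> \<eta>"
  shows "\<eta> \<in> QpN_box p P"
proof -
  have "\<eta> j \<in> Zp p" if "j \<notin> P" for j
  proof -
    have "\<xi> j \<in> Zp p" using assms(1) that by (simp add: QpN_box_def)
    then show ?thesis using assms V_Qp[OF assms(2), of j] by (simp add: Zp_def agree_def)
  qed
  then show ?thesis using V_Qp[OF assms(2)] by (simp add: QpN_box_def)
qed

text \<open>The sets \<open>{\<eta> \<in> V. agree n K \<xi> \<eta>}\<close> with \<open>K\<close> finite form a neighbourhood base of \<open>\<xi>\<close>.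
  The agreement of all digits below 0 is what distinguishes \<open>\<tau>\<close> from the product topology.\<close>

lemma openin_tau:
  "openin (tau p) A \<longleftrightarrow>
    A \<subseteq> V \<and> (\<forall>\<xi>\<in>A. \<exists>n K. finite K \<and> {\<eta> \<in> V. agree n K \<xi> \<eta>} \<subseteq> A)"
proof (intro iffI conjI ballI)
  assume A: "openin (tau p) A"
  then show AV: "A \<subseteq> V" by (simp add: openin_tau_box)
  fix \<xi> assume \<xi>: "\<xi> \<in> A"
  \<comment> \<open>The non-integral coordinates of \<open>\<xi>\<close> select the box in which the
    openness of \<open>A\<close> is exploited.\<close>
  define P where "P = {i. \<xi> i \<notin> Zp p}"
  have P: "finite P" using AV \<xi> by (auto simp: P_def QpN_def)
  have box: "\<xi> \<in> QpN_box p P" using AV \<xi> by (auto simp: P_def QpN_box_def QpN_def)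
  obtain T where T: "openin (product_topology (\<lambda>_. Qp_top p) UNIV) T" "A \<inter> QpN_box p P = T \<inter> QpN_box p P"
    using A P by (auto simp: openin_tau_box openin_subtopology)
  then have "\<xi> \<in> T" using \<xi> box by blast
  then obtain U where U: "finite {i. U i \<noteq> Qp p}" "\<And>i. openin (Qp_top p) (U i)"
      "\<xi> \<in> Pi\<^sub>E UNIV U" "Pi\<^sub>E UNIV U \<subseteq> T"
    using T(1) unfolding openin_product_topology_alt by auto
  have "\<exists>n::int. {y \<in> Qp p. \<forall>k<n. y k = \<xi> i k} \<subseteq> U i" for i
  proof -
    have "\<xi> i \<in> U i" using U(3) by (rule PiE_mem) simp
    then show ?thesis using U(2)[of i] unfolding openin_Qp_top by blast
  qed
  then have "\<exists>n :: nat \<Rightarrow> int. \<forall>i. {y \<in> Qp p. \<forall>k<n i. y k = \<xi> i k} \<subseteq> U i"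
    by (intro choice allI)
  then obtain n :: "nat \<Rightarrow> int" where n: "\<And>i. {y \<in> Qp p. \<forall>k<n i. y k = \<xi> i k} \<subseteq> U i" by blast
  define K where "K = {i. U i \<noteq> Qp p}"
  define N where "N = Max (insert 0 (n ` K))"
  have N: "n i \<le> N" if "i \<in> K" for i
    unfolding N_def using U(1) that by (intro Max_ge) (auto simp: K_def)
  have "{\<eta> \<in> V. agree N K \<xi> \<eta>} \<subseteq> A"
  proof clarify
    fix \<eta> assume \<eta>: "\<eta> \<in> V" "agree N K \<xi> \<eta>"
    have "\<eta> i \<in> U i" for i
    proof (cases "i \<in> K")
      case True
      then show ?thesis using n[of i] N[OF True] \<eta> V_Qp[OF \<eta>(1), of i]
        by (auto simp: agree_def)
    next
      case False
      then show ?thesis using V_Qp[OF \<eta>(1), of i] by (simp add: K_def)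
    qed
    then have "\<eta> \<in> T" using U(4) by auto
    then show "\<eta> \<in> A" using T(2) agree_box[OF box \<eta>] by blast
  qed
  then show "\<exists>n K. finite K \<and> {\<eta> \<in> V. agree n K \<xi> \<eta>} \<subseteq> A"
    using U(1) unfolding K_def by blast
next
  assume A: "A \<subseteq> V \<and> (\<forall>\<xi>\<in>A. \<exists>n K. finite K \<and> {\<eta> \<in> V. agree n K \<xi> \<eta>} \<subseteq> A)"
  show "openin (tau p) A" unfolding openin_tau_box
  proof (intro conjI allI impI)
    fix P :: "nat set" assume P: "finite P"
    show "openin (subtopology (product_topology (\<lambda>_. Qp_top p) UNIV) (QpN_box p P)) (A \<inter> QpN_box p P)"
    proof (subst openin_subopen, intro ballI)
      fix \<xi> assume \<xi>: "\<xi> \<in> A \<inter> QpN_box p P"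
      then obtain n K where K: "finite K" "{\<eta> \<in> V. agree n K \<xi> \<eta>} \<subseteq> A" using A by blast
      \<comment> \<open>On \<open>P\<close> the box does not control the digits below 0, so
        \<open>max n 0\<close> fixes them as well; outside \<open>P\<close> they vanish by
        integrality.\<close>
      define U where "U = (\<lambda>i. if i \<in> P \<union> K then {y \<in> Qp p. \<forall>k<max n 0. y k = \<xi> i k} else Qp p)"
      have \<xi>Q: "\<xi> i \<in> Qp p" for i using \<xi> box_subset[OF P] V_Qp by blast
      have "openin (product_topology (\<lambda>_. Qp_top p) UNIV) (Pi\<^sub>E UNIV U)"
      proof (rule product_topology_basis)
        have "{i. U i \<noteq> topspace (Qp_top p)} \<subseteq> P \<union> K" by (auto simp: U_def)
        then show "finite {i. U i \<noteq> topspace (Qp_top p)}" using P K by (auto intro: finite_subset)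
        have "openin (Qp_top p) (Qp p)" using openin_topspace[of "Qp_top p"] by simp
        then show "openin (Qp_top p) (U i)" for i
          unfolding U_def using openin_Qp_ball by auto
      qed
      then have "openin (subtopology (product_topology (\<lambda>_. Qp_top p) UNIV) (QpN_box p P))
          (Pi\<^sub>E UNIV U \<inter> QpN_box p P)"
        unfolding openin_subtopology by blast
      moreover have "\<xi> \<in> Pi\<^sub>E UNIV U \<inter> QpN_box p P"
        using \<xi> \<xi>Q by (auto simp: U_def)
      moreover have "Pi\<^sub>E UNIV U \<inter> QpN_box p P \<subseteq> A \<inter> QpN_box p P"
      proof clarify
        fix \<eta> assume \<eta>: "\<eta> \<in> Pi\<^sub>E UNIV U" "\<eta> \<in> QpN_box p P"
        have U: "\<eta> i \<in> U i" for i using \<eta>(1) by (rule PiE_mem) simp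
        have dig: "\<eta> i k = \<xi> i k" if "i \<in> P \<union> K" "k < max n 0" for i k
          using U[of i] that by (simp add: U_def)
        have "\<eta> j k = \<xi> j k" if "k < 0" for j k
        proof (cases "j \<in> P")
          case False
          then have "\<eta> j \<in> Zp p" "\<xi> j \<in> Zp p" using \<eta>(2) \<xi> by (auto simp: QpN_box_def)
          then show ?thesis using that by (simp add: Zp_def)
        qed (use dig that in auto)
        then have "agree n K \<xi> \<eta>" using dig by (auto simp: agree_def)
        then show "\<eta> \<in> A" using K(2) \<eta>(2) box_subset[OF P] by blast
      qed
      ultimately show "\<exists>T. openin (subtopology (product_topology (\<lambda>_. Qp_top p) UNIV) (QpN_box p P)) T
          \<and> \<xi> \<in> T \<and> T \<subseteq> A \<inter> QpN_box p P" by blast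
    qed
  qed (use A in blast)
qed

lemma topspace_tau [simp]: "topspace (tau p) = V"
proof (rule antisym)
  show "V \<subseteq> topspace (tau p)"
    by (rule openin_subset) (unfold openin_tau, blast)
  show "topspace (tau p) \<subseteq> V"
    using openin_topspace[of "tau p"] unfolding openin_tau by blast
qed

lemma continuous_map_tau_iff:
  "continuous_map (tau p) (tau p) f \<longleftrightarrow> f \<in> V \<rightarrow> V \<and>
    (\<forall>\<xi>\<in>V. \<forall>n K. finite K \<longrightarrow>
      (\<exists>m Q. finite Q \<and> (\<forall>\<eta>\<in>V. agree m Q \<xi> \<eta> \<longrightarrow> agree n K (f \<xi>) (f \<eta>))))"
    (is "?l \<longleftrightarrow> ?r")
proof
  assume f: ?l
  have fV: "f \<in> V \<rightarrow> V" using f by (auto simp: continuous_map_def)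
  have "\<exists>m Q. finite Q \<and> (\<forall>\<eta>\<in>V. agree m Q \<xi> \<eta> \<longrightarrow> agree n K (f \<xi>) (f \<eta>))"
    if \<xi>: "\<xi> \<in> V" and K: "finite K" for \<xi> n K
  proof -
    let ?B = "{\<eta> \<in> V. agree n K (f \<xi>) \<eta>}"
    have "openin (tau p) ?B" unfolding openin_tau
    proof (intro conjI ballI)
      fix \<eta> assume \<eta>: "\<eta> \<in> ?B"
      have "{\<zeta> \<in> V. agree n K \<eta> \<zeta>} \<subseteq> ?B" using \<eta> by (auto simp: agree_def)
      then show "\<exists>n' K'. finite K' \<and> {\<zeta> \<in> V. agree n' K' \<eta> \<zeta>} \<subseteq> ?B" using K by blast
    qed blast
    then have "openin (tau p) {\<eta> \<in> V. f \<eta> \<in> ?B}" using f by (auto simp: continuous_map_def)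
    moreover have "\<xi> \<in> {\<eta> \<in> V. f \<eta> \<in> ?B}" using \<xi> fV by (auto simp: agree_def)
    ultimately obtain m Q where "finite Q" "{\<eta> \<in> V. agree m Q \<xi> \<eta>} \<subseteq> {\<eta> \<in> V. f \<eta> \<in> ?B}"
      unfolding openin_tau by meson
    then show ?thesis by blast
  qed
  with fV show ?r by blast
next
  assume f: ?r
  have "openin (tau p) {\<xi> \<in> V. f \<xi> \<in> U}" if U: "openin (tau p) U" for U
    unfolding openin_tau
  proof (intro conjI ballI)
    fix \<xi> assume \<xi>: "\<xi> \<in> {\<xi> \<in> V. f \<xi> \<in> U}"
    then obtain n K where K: "finite K" "{\<eta> \<in> V. agree n K (f \<xi>) \<eta>} \<subseteq> U"
      using U unfolding openin_tau by blast
    obtain m Q where Q: "finite Q" "\<forall>\<eta>\<in>V. agree m Q \<xi> \<eta> \<longrightarrow> agree n K (f \<xi>) (f \<eta>)"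
      using f \<xi> K(1) by blast
    have "{\<eta> \<in> V. agree m Q \<xi> \<eta>} \<subseteq> {\<xi> \<in> V. f \<xi> \<in> U}"
      using Q(2) K(2) f by blast
    with Q(1) show "\<exists>n K. finite K \<and> {\<eta> \<in> V. agree n K \<xi> \<eta>} \<subseteq> {\<xi> \<in> V. f \<xi> \<in> U}" by blast
  qed blast
  then show ?l using f by (auto simp: continuous_map_def)
qed

subsection \<open>The ring of continuous operators\<close>

abbreviation vadd (infixl "[++]" 65) where "\<xi> [++] \<eta> \<equiv> QpN_add p \<xi> \<eta>"

abbreviation smult (infixl "[**]" 70) where "a [**] \<xi> \<equiv> QpN_smult p a \<xi>"

definition vneg :: "(nat \<Rightarrow> padic) \<Rightarrow> nat \<Rightarrow> padic" where
  "vneg \<xi> = (\<lambda>i. padic_neg (\<xi> i))"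

lemma zero_apply [simp]: "QpN_zero i = padic_zero"
  by (simp add: QpN_zero_def padic_zero_def)

lemma vadd_apply [simp]: "(\<xi> [++] \<eta>) i = \<xi> i [+] \<eta> i"
  by (simp add: QpN_add_def)

lemma smult_apply [simp]: "(a [**] \<xi>) i = a [*] \<xi> i"
  by (simp add: QpN_smult_def)

lemma V_iff: "\<xi> \<in> V \<longleftrightarrow> (\<forall>i. \<xi> i \<in> Qp p) \<and> finite {i. \<not> vge 0 (\<xi> i)}"
  unfolding QpN_def mem_Collect_eq Zp_iff by (rule conj_cong) auto

lemma V_map:
  assumes \<xi>: "\<xi> \<in> V" and f: "\<And>i. f i (\<xi> i) \<in> Qp p" "\<And>i. vge 0 (\<xi> i) \<Longrightarrow> vge 0 (f i (\<xi> i))"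
  shows "(\<lambda>i. f i (\<xi> i)) \<in> V"
proof -
  have "{i. \<not> vge 0 (f i (\<xi> i))} \<subseteq> {i. \<not> vge 0 (\<xi> i)}" using f(2) by blast
  then show ?thesis using \<xi> f(1) by (auto simp: V_iff intro: finite_subset)
qed

lemma zero_V [simp]: "QpN_zero \<in> V"
  by (simp add: V_iff)

lemma vneg_V: "\<xi> \<in> V \<Longrightarrow> vneg \<xi> \<in> V"
  unfolding vneg_def by (rule V_map) (auto intro: neg_Qp vge_neg V_Qp)

lemma smult_V: "a \<in> Zp p \<Longrightarrow> \<xi> \<in> V \<Longrightarrow> a [**] \<xi> \<in> V"
  unfolding QpN_smult_def by (rule V_map) (auto intro: mult_Qp vge_mult V_Qp)

lemma vadd_V:
  assumes "\<xi> \<in> V" "\<eta> \<in> V"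
  shows "\<xi> [++] \<eta> \<in> V"
proof -
  have "{i. \<not> vge 0 ((\<xi> [++] \<eta>) i)} \<subseteq> {i. \<not> vge 0 (\<xi> i)} \<union> {i. \<not> vge 0 (\<eta> i)}"
    using vge_add[OF V_Qp[OF assms(1)] V_Qp[OF assms(2)]] by auto
  moreover have "(\<xi> [++] \<eta>) i \<in> Qp p" for i
    using assms by (simp add: V_iff add_Qp)
  ultimately show ?thesis using assms unfolding V_iff by (auto intro: finite_subset)
qed

lemma vadd_comm: "\<xi> [++] \<eta> = \<eta> [++] \<xi>"
  by (rule ext) (simp add: add_comm)

lemma vadd_assoc: "\<xi> \<in> V \<Longrightarrow> \<eta> \<in> V \<Longrightarrow> \<zeta> \<in> V \<Longrightarrow> \<xi> [++] \<eta> [++] \<zeta> = \<xi> [++] (\<eta> [++] \<zeta>)"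
  by (rule ext) (simp add: add_assoc V_Qp)

lemma vadd_zero_left: "\<xi> \<in> V \<Longrightarrow> QpN_zero [++] \<xi> = \<xi>"
  by (rule ext) (simp add: add_zero_left V_Qp)

lemma vadd_zero_right: "\<xi> \<in> V \<Longrightarrow> \<xi> [++] QpN_zero = \<xi>"
  by (simp add: vadd_comm[of \<xi>] vadd_zero_left)

lemma vadd_neg_left: "\<xi> \<in> V \<Longrightarrow> vneg \<xi> [++] \<xi> = QpN_zero"
  by (rule ext) (simp add: add_neg_left V_Qp vneg_def)

lemma vadd_neg_right: "\<xi> \<in> V \<Longrightarrow> \<xi> [++] vneg \<xi> = QpN_zero"
  by (simp add: vadd_comm[of \<xi>] vadd_neg_left)

lemma vadd_left_cancel:
  assumes "\<xi> \<in> V" "\<eta> \<in> V" "\<zeta> \<in> V" "\<xi> [++] \<eta> = \<xi> [++] \<zeta>"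
  shows "\<eta> = \<zeta>"
proof -
  have "\<eta> = vneg \<xi> [++] (\<xi> [++] \<eta>)" if "\<eta> \<in> V" for \<eta>
    using that assms(1) by (simp add: vadd_assoc[symmetric] vneg_V vadd_neg_left vadd_zero_left)
  then show ?thesis using assms by metis
qed

lemma smult_add: "a \<in> Zp p \<Longrightarrow> \<xi> \<in> V \<Longrightarrow> \<eta> \<in> V \<Longrightarrow> a [**] (\<xi> [++] \<eta>) = a [**] \<xi> [++] a [**] \<eta>"
  by (rule ext) (simp add: mult_add_right V_Qp)

text \<open>Turns the digitwise topology into a group topology: agreement up to position
  \<open>n\<close> depends only on the difference, in spite of carries.\<close>

lemma digits_agree_iff:
  assumes "x \<in> Qp p" "y \<in> Qp p"
  shows "(\<forall>k<n. y k = x k) \<longleftrightarrow> vge n (padic_neg x [+] y)"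
proof -
  let ?d = "padic_neg x [+] y"
  have d: "?d \<in> Qp p" by (intro add_Qp neg_Qp assms)
  have "pcong n (tr ?d n) (tr (padic_neg x) n + tr y n)"
    by (intro tr_add neg_Qp assms)
  also have "pcong n \<dots> (- tr x n + tr y n)"
    by (intro pcong_add tr_neg assms pcong_refl)
  finally have *: "pcong n (tr ?d n) (- tr x n + tr y n)" .
  have "vge n ?d \<longleftrightarrow> tr ?d n = 0" by (rule vge_iff_tr[OF d])
  also have "\<dots> \<longleftrightarrow> pcong n (tr ?d n) 0"
    using pcong_small_eq[of n "tr ?d n" 0] tr_nonneg tr_less[OF d] by auto
  also have "\<dots> \<longleftrightarrow> pcong n (- tr x n + tr y n) 0"
    using * pcong_sym pcong_trans by blast
  also have "\<dots> \<longleftrightarrow> pcong n (tr y n) (tr x n)" by (simp add: pcong_def)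
  also have "\<dots> \<longleftrightarrow> (\<forall>k<n. y k = x k)" using tr_agree_iff[OF assms(2,1)] by simp
  finally show ?thesis by simp
qed

text \<open>Open subgroups that form a neighbourhood base at 0. All coordinates stay integral even
  for negative \<open>n\<close>, in accordance with \<open>agree\<close>.\<close>

definition nbd :: "int \<Rightarrow> nat set \<Rightarrow> (nat \<Rightarrow> padic) set" where
  "nbd n K = {\<xi> \<in> V. (\<forall>j. vge 0 (\<xi> j)) \<and> (\<forall>j\<in>K. vge n (\<xi> j))}"

lemma agree_iff_nbd:
  assumes "\<xi> \<in> V" "\<eta> \<in> V"
  shows "agree n K \<xi> \<eta> \<longleftrightarrow> vneg \<xi> [++] \<eta> \<in> nbd n K"
  using assms vadd_V[OF vneg_V[OF assms(1)] assms(2)]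
  by (simp add: agree_def nbd_def digits_agree_iff V_Qp vneg_def)

text \<open>An additive map commutes with differences, and \<open>agree\<close> depends only on the
  difference; so continuity at 0 spreads to all points by translation.\<close>

lemma continuous_additive_iff:
  assumes fV: "f \<in> V \<rightarrow> V"
    and add: "\<And>\<xi> \<eta>. \<xi> \<in> V \<Longrightarrow> \<eta> \<in> V \<Longrightarrow> f (\<xi> [++] \<eta>) = f \<xi> [++] f \<eta>"
  shows "continuous_map (tau p) (tau p) f \<longleftrightarrow>
    (\<forall>n K. finite K \<longrightarrow> (\<exists>m Q. finite Q \<and> f ` nbd m Q \<subseteq> nbd n K))"
proof -
  have f0: "f QpN_zero = QpN_zero"
  proof (rule vadd_left_cancel)
    show "f QpN_zero [++] f QpN_zero = f QpN_zero [++] QpN_zero"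
      using add[of QpN_zero QpN_zero] fV vadd_zero_left[of QpN_zero] vadd_zero_right[of "f QpN_zero"]
      by (simp add: Pi_iff)
  qed (use fV in auto)
  have fneg: "f (vneg \<xi>) = vneg (f \<xi>)" if \<xi>: "\<xi> \<in> V" for \<xi>
  proof (rule vadd_left_cancel[of "f \<xi>"])
    have "f \<xi> [++] f (vneg \<xi>) = f (\<xi> [++] vneg \<xi>)"
      using add[OF \<xi> vneg_V[OF \<xi>]] by simp
    then show "f \<xi> [++] f (vneg \<xi>) = f \<xi> [++] vneg (f \<xi>)"
      using \<xi> fV by (simp add: vadd_neg_right f0 Pi_iff)
  qed (use fV \<xi> vneg_V in auto)
  have diff: "vneg (f \<xi>) [++] f \<eta> = f (vneg \<xi> [++] \<eta>)" if "\<xi> \<in> V" "\<eta> \<in> V" for \<xi> \<eta>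
    using that add[of "vneg \<xi>" \<eta>] fneg vneg_V by simp
  have n0: "vneg QpN_zero [++] \<zeta> = \<zeta>" if "\<zeta> \<in> V" for \<zeta>
    using vadd_neg_left[of QpN_zero] vadd_zero_right[OF vneg_V[OF zero_V]] vadd_zero_left[OF that] by simp
  show ?thesis unfolding continuous_map_tau_iff
  proof (intro iffI conjI ballI allI impI)
    fix n K assume "f \<in> V \<rightarrow> V \<and>
      (\<forall>\<xi>\<in>V. \<forall>n K. finite K \<longrightarrow> (\<exists>m Q. finite Q \<and> (\<forall>\<eta>\<in>V. agree m Q \<xi> \<eta> \<longrightarrow> agree n K (f \<xi>) (f \<eta>))))"
      "finite (K::nat set)"
    then obtain m Q where Q: "finite Q" "\<forall>\<eta>\<in>V. agree m Q QpN_zero \<eta> \<longrightarrow> agree n K (f QpN_zero) (f \<eta>)"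
      by (meson zero_V)
    have "f ` nbd m Q \<subseteq> nbd n K"
    proof clarify
      fix \<eta> assume \<eta>: "\<eta> \<in> nbd m Q"
      then have V: "\<eta> \<in> V" "f \<eta> \<in> V" using fV by (auto simp: nbd_def)
      have "agree m Q QpN_zero \<eta>" using \<eta> agree_iff_nbd[OF zero_V V(1)] by (simp add: n0 V)
      then have "agree n K QpN_zero (f \<eta>)" using Q(2) V(1) f0 by simp
      then show "f \<eta> \<in> nbd n K" using agree_iff_nbd[OF zero_V V(2)] by (simp add: n0 V)
    qed
    with Q(1) show "\<exists>m Q. finite Q \<and> f ` nbd m Q \<subseteq> nbd n K" by blast
  next
    fix \<xi> n K assume *: "\<forall>n K. finite K \<longrightarrow> (\<exists>m Q. finite Q \<and> f ` nbd m Q \<subseteq> nbd n K)"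
      and \<xi>: "\<xi> \<in> V" and K: "finite (K::nat set)"
    obtain m Q where Q: "finite Q" "f ` nbd m Q \<subseteq> nbd n K" using *[rule_format, OF K] by meson
    have "agree n K (f \<xi>) (f \<eta>)" if \<eta>: "\<eta> \<in> V" and ag: "agree m Q \<xi> \<eta>" for \<eta>
    proof -
      have fV': "f \<xi> \<in> V" "f \<eta> \<in> V" using fV \<xi> \<eta> by blast+
      have "f (vneg \<xi> [++] \<eta>) \<in> nbd n K"
        using Q(2) ag unfolding agree_iff_nbd[OF \<xi> \<eta>] by blast
      then show ?thesis unfolding agree_iff_nbd[OF fV'] diff[OF \<xi> \<eta>] .
    qed
    with Q(1) show "\<exists>m Q. finite Q \<and> (\<forall>\<eta>\<in>V. agree m Q \<xi> \<eta> \<longrightarrow> agree n K (f \<xi>) (f \<eta>))" by blast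
  qed (use fV in auto)
qed

section \<open>Closure of the operators under the ring operations\<close>

abbreviation BV where "BV \<equiv> B_carrier p"

lemma B_iff:
  "f \<in> BV \<longleftrightarrow> f \<in> extensional V \<and> f \<in> V \<rightarrow> V \<and>
    (\<forall>\<xi>\<in>V. \<forall>\<eta>\<in>V. f (\<xi> [++] \<eta>) = f \<xi> [++] f \<eta>) \<and>
    (\<forall>a\<in>Zp p. \<forall>\<xi>\<in>V. f (a [**] \<xi>) = a [**] f \<xi>) \<and>
    (\<forall>n K. finite K \<longrightarrow> (\<exists>m Q. finite Q \<and> f ` nbd m Q \<subseteq> nbd n K))"
proof (cases "f \<in> V \<rightarrow> V \<and> (\<forall>\<xi>\<in>V. \<forall>\<eta>\<in>V. f (\<xi> [++] \<eta>) = f \<xi> [++] f \<eta>)")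
  case True
  then show ?thesis
    using continuous_additive_iff[of f] unfolding B_carrier_def Zp_linear_def by auto
next
  case False
  then show ?thesis
    using continuous_map_tau_iff[of f] unfolding B_carrier_def Zp_linear_def by blast
qed

lemma
  assumes "f \<in> BV"
  shows B_V: "\<xi> \<in> V \<Longrightarrow> f \<xi> \<in> V"
    and B_add: "\<xi> \<in> V \<Longrightarrow> \<eta> \<in> V \<Longrightarrow> f (\<xi> [++] \<eta>) = f \<xi> [++] f \<eta>"
    and B_smult: "a \<in> Zp p \<Longrightarrow> \<xi> \<in> V \<Longrightarrow> f (a [**] \<xi>) = a [**] f \<xi>"
proof -
  note 1 = assms[unfolded B_iff, THEN conjunct2]
  note 2 = 1[THEN conjunct2]
  show "\<xi> \<in> V \<Longrightarrow> f \<xi> \<in> V"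
    "\<xi> \<in> V \<Longrightarrow> \<eta> \<in> V \<Longrightarrow> f (\<xi> [++] \<eta>) = f \<xi> [++] f \<eta>"
    "a \<in> Zp p \<Longrightarrow> \<xi> \<in> V \<Longrightarrow> f (a [**] \<xi>) = a [**] f \<xi>"
    using 1[THEN conjunct1] 2[THEN conjunct1] 2[THEN conjunct2, THEN conjunct1]
    by (simp_all add: Pi_iff)
qed

lemma B_nbd:
  assumes f: "f \<in> BV" and K: "finite K"
  obtains m Q where "finite Q" "f ` nbd m Q \<subseteq> nbd n K"
proof -
  have "\<forall>n K. finite K \<longrightarrow> (\<exists>m Q. finite Q \<and> f ` nbd m Q \<subseteq> nbd n K)"
    using f unfolding B_iff by (elim conjE)
  from this[rule_format, OF K, of n] show thesis using that by (elim exE conjE)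
qed

lemma B_eqI:
  assumes "f \<in> BV" "g \<in> BV" "\<And>\<xi>. \<xi> \<in> V \<Longrightarrow> f \<xi> = g \<xi>"
  shows "f = g"
proof (rule extensionalityI)
  show "f \<in> extensional V" "g \<in> extensional V"
    using assms(1,2) unfolding B_carrier_def by blast+
qed (rule assms(3))

text \<open>Introduction rule for operators given by a formula; \<open>restrict\<close> supplies the
  extensionality by which equality in the ring is equality on \<open>V\<close>.\<close>

lemma restrict_B:
  assumes V: "\<And>\<xi>. \<xi> \<in> V \<Longrightarrow> F \<xi> \<in> V"
    and "\<And>\<xi> \<eta>. \<xi> \<in> V \<Longrightarrow> \<eta> \<in> V \<Longrightarrow> F (\<xi> [++] \<eta>) = F \<xi> [++] F \<eta>"
    and "\<And>a \<xi>. a \<in> Zp p \<Longrightarrow> \<xi> \<in> V \<Longrightarrow> F (a [**] \<xi>) = a [**] F \<xi>"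
    and nbd: "\<And>n K. finite K \<Longrightarrow> \<exists>m Q. finite Q \<and> (\<forall>\<xi>\<in>nbd m Q. F \<xi> \<in> nbd n K)"
  shows "restrict F V \<in> BV"
  unfolding B_iff
proof (intro conjI ballI allI impI)
  fix n K assume K: "finite (K::nat set)"
  obtain m Q where Q: "finite Q" "\<forall>\<xi>\<in>nbd m Q. F \<xi> \<in> nbd n K"
    using nbd[OF K, of n] by (elim exE conjE)
  have "restrict F V ` nbd m Q \<subseteq> nbd n K" using Q(2) by (auto simp: nbd_def)
  with Q(1) show "\<exists>m Q. finite Q \<and> restrict F V ` nbd m Q \<subseteq> nbd n K" by blast
qed (use assms in \<open>auto simp: vadd_V smult_V\<close>)

lemma B_ring_simps [simp]:
  "carrier (B_ring p) = BV"
  "\<one>\<^bsub>B_ring p\<^esub> = restrict id V"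
  "\<zero>\<^bsub>B_ring p\<^esub> = restrict (\<lambda>_. QpN_zero) V"
  by (simp_all add: B_ring_def)

lemma B_mult_apply: "\<xi> \<in> V \<Longrightarrow> (f \<otimes>\<^bsub>B_ring p\<^esub> g) \<xi> = f (g \<xi>)"
  by (simp add: B_ring_def)

lemma B_add_apply: "\<xi> \<in> V \<Longrightarrow> (f \<oplus>\<^bsub>B_ring p\<^esub> g) \<xi> = f \<xi> [++] g \<xi>"
  by (simp add: B_ring_def)

lemma nbd_V: "\<xi> \<in> nbd n K \<Longrightarrow> \<xi> \<in> V"
  by (simp add: nbd_def)

lemma nbd_add: "\<xi> \<in> nbd n K \<Longrightarrow> \<eta> \<in> nbd n K \<Longrightarrow> \<xi> [++] \<eta> \<in> nbd n K"
  by (simp add: nbd_def vadd_V vge_add V_Qp)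

lemma nbd_mono: "m \<le> n \<Longrightarrow> K \<subseteq> L \<Longrightarrow> nbd n L \<subseteq> nbd m K"
  by (auto simp: nbd_def vge_def)

lemma B_mult_closed:
  assumes f: "f \<in> BV" and g: "g \<in> BV"
  shows "f \<otimes>\<^bsub>B_ring p\<^esub> g \<in> BV"
proof -
  have "restrict (\<lambda>\<xi>. f (g \<xi>)) V \<in> BV"
  proof (rule restrict_B)
    fix n K assume K: "finite (K::nat set)"
    obtain m Q where Q: "finite Q" "f ` nbd m Q \<subseteq> nbd n K" using B_nbd[OF f K] .
    obtain m' Q' where Q': "finite Q'" "g ` nbd m' Q' \<subseteq> nbd m Q" using B_nbd[OF g Q(1)] .
    with Q have "\<forall>\<xi>\<in>nbd m' Q'. f (g \<xi>) \<in> nbd n K" by blast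
    with Q'(1) show "\<exists>m Q. finite Q \<and> (\<forall>\<xi>\<in>nbd m Q. f (g \<xi>) \<in> nbd n K)" by blast
  qed (simp_all add: B_V[OF f] B_V[OF g] B_add[OF f] B_add[OF g] B_smult[OF f] B_smult[OF g])
  moreover have "f \<otimes>\<^bsub>B_ring p\<^esub> g = restrict (\<lambda>\<xi>. f (g \<xi>)) V"
    by (simp add: B_ring_def o_def)
  ultimately show ?thesis by simp
qed

lemma vadd_swap:
  assumes "\<xi> \<in> V" "\<eta> \<in> V" "\<zeta> \<in> V" "\<theta> \<in> V"
  shows "(\<xi> [++] \<eta>) [++] (\<zeta> [++] \<theta>) = (\<xi> [++] \<zeta>) [++] (\<eta> [++] \<theta>)"
proof -
  have "(\<xi> [++] \<eta>) [++] (\<zeta> [++] \<theta>) = \<xi> [++] ((\<eta> [++] \<zeta>) [++] \<theta>)"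
    using assms by (simp add: vadd_assoc vadd_V)
  also have "\<dots> = (\<xi> [++] \<zeta>) [++] (\<eta> [++] \<theta>)"
    using assms by (simp add: vadd_assoc vadd_V vadd_comm[of \<eta> \<zeta>])
  finally show ?thesis .
qed

lemma B_add_closed:
  assumes f: "f \<in> BV" and g: "g \<in> BV"
  shows "f \<oplus>\<^bsub>B_ring p\<^esub> g \<in> BV"
proof -
  have "restrict (\<lambda>\<xi>. f \<xi> [++] g \<xi>) V \<in> BV"
  proof (rule restrict_B)
    fix n K assume K: "finite (K::nat set)"
    obtain m Q where Q: "finite Q" "f ` nbd m Q \<subseteq> nbd n K" using B_nbd[OF f K] .
    obtain m' Q' where Q': "finite Q'" "g ` nbd m' Q' \<subseteq> nbd n K" using B_nbd[OF g K] .
    have "nbd (max m m') (Q \<union> Q') \<subseteq> nbd m Q \<inter> nbd m' Q'"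
      using nbd_mono[of m "max m m'" Q "Q \<union> Q'"] nbd_mono[of m' "max m m'" Q' "Q \<union> Q'"] by auto
    then have "\<forall>\<xi>\<in>nbd (max m m') (Q \<union> Q'). f \<xi> [++] g \<xi> \<in> nbd n K"
      using Q(2) Q'(2) by (blast intro: nbd_add)
    then show "\<exists>m Q. finite Q \<and> (\<forall>\<xi>\<in>nbd m Q. f \<xi> [++] g \<xi> \<in> nbd n K)" using Q(1) Q'(1) by blast
  qed (simp_all add: B_V[OF f] B_V[OF g] B_add[OF f] B_add[OF g] B_smult[OF f] B_smult[OF g]
        smult_add vadd_V vadd_swap)
  then show ?thesis by (simp add: B_ring_def)
qed

lemma B_one_closed: "restrict id V \<in> BV"
  by (rule restrict_B) auto

lemma nbd_zero [simp]: "QpN_zero \<in> nbd n K"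
  by (simp add: nbd_def)

lemma B_zero_closed: "restrict (\<lambda>_. QpN_zero) V \<in> BV"
proof (rule restrict_B)
  show "QpN_zero = a [**] QpN_zero" if "a \<in> Zp p" for a
    using that by (auto simp: fun_eq_iff mult_zero_right)
qed (auto simp: vadd_zero_left)

lemma B_neg_closed:
  assumes f: "f \<in> BV"
  shows "restrict (\<lambda>\<xi>. vneg (f \<xi>)) V \<in> BV"
proof (rule restrict_B)
  \<comment> \<open>Negatives are unique, so the linearity of \<open>vneg\<close> follows from the
    group laws and needs no computation with digits.\<close>
  have neg: "\<zeta> = vneg \<xi>" if "\<xi> \<in> V" "\<zeta> \<in> V" "\<xi> [++] \<zeta> = QpN_zero" for \<xi> \<zeta>
    using that by (metis vadd_left_cancel vadd_neg_right vneg_V)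
  show "vneg (f (\<xi> [++] \<eta>)) = vneg (f \<xi>) [++] vneg (f \<eta>)" if "\<xi> \<in> V" "\<eta> \<in> V" for \<xi> \<eta>
  proof (rule neg[symmetric])
    have "f \<xi> \<in> V" "f \<eta> \<in> V" using that B_V[OF f] by auto
    then show "f (\<xi> [++] \<eta>) [++] (vneg (f \<xi>) [++] vneg (f \<eta>)) = QpN_zero"
      using that by (simp add: B_add[OF f], subst vadd_swap)
        (simp_all add: vneg_V vadd_neg_right vadd_zero_left)
  qed (use that B_V[OF f] in \<open>auto simp: vneg_V vadd_V\<close>)
  show "vneg (f (a [**] \<xi>)) = a [**] vneg (f \<xi>)" if "a \<in> Zp p" "\<xi> \<in> V" for a \<xi>
  proof (rule neg[symmetric])
    have "f \<xi> \<in> V" using that B_V[OF f] by auto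
    then show "f (a [**] \<xi>) [++] a [**] vneg (f \<xi>) = QpN_zero"
      using that by (simp add: B_smult[OF f] smult_add[symmetric] vneg_V vadd_neg_right)
        (auto simp: fun_eq_iff mult_zero_right)
  qed (use that B_V[OF f] in \<open>auto simp: vneg_V vadd_V smult_V\<close>)
  fix n K assume K: "finite (K::nat set)"
  obtain m Q where Q: "finite Q" "f ` nbd m Q \<subseteq> nbd n K" using B_nbd[OF f K] .
  have "vneg \<xi> \<in> nbd n K" if "\<xi> \<in> nbd n K" for \<xi>
    using that vneg_V by (auto simp: nbd_def vneg_def vge_neg V_Qp)
  then show "\<exists>m Q. finite Q \<and> (\<forall>\<xi>\<in>nbd m Q. vneg (f \<xi>) \<in> nbd n K)" using Q by blast
qed (simp add: vneg_V B_V[OF f])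

lemma ring_B: "ring (B_ring p)"
proof (rule ringI)
  show "abelian_group (B_ring p)"
  proof (rule abelian_groupI)
    fix f g h assume "f \<in> carrier (B_ring p)" "g \<in> carrier (B_ring p)" "h \<in> carrier (B_ring p)"
    then have f: "f \<in> BV" and g: "g \<in> BV" and h: "h \<in> BV" by auto
    show "f \<oplus>\<^bsub>B_ring p\<^esub> g \<oplus>\<^bsub>B_ring p\<^esub> h = f \<oplus>\<^bsub>B_ring p\<^esub> (g \<oplus>\<^bsub>B_ring p\<^esub> h)"
      by (rule B_eqI)
        (simp_all add: f g h B_add_closed B_add_apply vadd_assoc B_V[OF f] B_V[OF g] B_V[OF h])
  next
    fix f assume "f \<in> carrier (B_ring p)"
    then have f: "f \<in> BV" by simp
    show "\<zero>\<^bsub>B_ring p\<^esub> \<oplus>\<^bsub>B_ring p\<^esub> f = f"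
      by (rule B_eqI)
        (simp_all add: f B_add_closed B_zero_closed B_add_apply vadd_zero_left B_V[OF f])
    have "restrict (\<lambda>\<xi>. vneg (f \<xi>)) V \<oplus>\<^bsub>B_ring p\<^esub> f = \<zero>\<^bsub>B_ring p\<^esub>"
      by (rule B_eqI)
        (simp_all add: f B_add_closed B_zero_closed B_neg_closed B_add_apply vadd_neg_left B_V[OF f])
    then show "\<exists>g\<in>carrier (B_ring p). g \<oplus>\<^bsub>B_ring p\<^esub> f = \<zero>\<^bsub>B_ring p\<^esub>"
      using B_neg_closed[OF f] by auto
  next
    show "f \<oplus>\<^bsub>B_ring p\<^esub> g = g \<oplus>\<^bsub>B_ring p\<^esub> f" for f g
      by (simp add: B_ring_def vadd_comm)
  qed (auto simp: B_add_closed B_zero_closed)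
  show "Group.monoid (B_ring p)"
  proof (rule monoidI)
    fix f g h assume "f \<in> carrier (B_ring p)" "g \<in> carrier (B_ring p)" "h \<in> carrier (B_ring p)"
    then have f: "f \<in> BV" and g: "g \<in> BV" and h: "h \<in> BV" by auto
    show "f \<otimes>\<^bsub>B_ring p\<^esub> g \<otimes>\<^bsub>B_ring p\<^esub> h = f \<otimes>\<^bsub>B_ring p\<^esub> (g \<otimes>\<^bsub>B_ring p\<^esub> h)"
      by (rule B_eqI) (simp_all add: f g h B_mult_closed B_mult_apply B_V[OF h])
  next
    fix f assume "f \<in> carrier (B_ring p)"
    then have f: "f \<in> BV" by simp
    show "\<one>\<^bsub>B_ring p\<^esub> \<otimes>\<^bsub>B_ring p\<^esub> f = f"
      by (rule B_eqI) (use f B_one_closed in \<open>simp_all add: B_mult_closed B_mult_apply B_V[OF f]\<close>)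
    show "f \<otimes>\<^bsub>B_ring p\<^esub> \<one>\<^bsub>B_ring p\<^esub> = f"
      by (rule B_eqI) (use f B_one_closed in \<open>simp_all add: B_mult_closed B_mult_apply\<close>)
  qed (use B_one_closed in \<open>auto simp: B_mult_closed\<close>)
  fix f g h assume "f \<in> carrier (B_ring p)" "g \<in> carrier (B_ring p)" "h \<in> carrier (B_ring p)"
  then have f: "f \<in> BV" and g: "g \<in> BV" and h: "h \<in> BV" by auto
  show "(f \<oplus>\<^bsub>B_ring p\<^esub> g) \<otimes>\<^bsub>B_ring p\<^esub> h = f \<otimes>\<^bsub>B_ring p\<^esub> h \<oplus>\<^bsub>B_ring p\<^esub> g \<otimes>\<^bsub>B_ring p\<^esub> h"
    by (rule B_eqI) (simp_all add: f g h B_mult_closed B_add_closed B_mult_apply B_add_apply B_V[OF h] del: vadd_apply)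
  show "h \<otimes>\<^bsub>B_ring p\<^esub> (f \<oplus>\<^bsub>B_ring p\<^esub> g) = h \<otimes>\<^bsub>B_ring p\<^esub> f \<oplus>\<^bsub>B_ring p\<^esub> h \<otimes>\<^bsub>B_ring p\<^esub> g"
    by (rule B_eqI)
      (simp_all add: f g h B_mult_closed B_add_closed B_mult_apply B_add_apply B_V[OF f] B_V[OF g] B_add[OF h] del: vadd_apply)
qed

subsection \<open>Coordinate operators and lattices\<close>

declare B_ring_simps [simp del]

abbreviation R where "R \<equiv> B_ring p"

sublocale B: ring R
  by (rule ring_B)

lemma R_carrier [simp]: "carrier R = BV"
  by (rule B_ring_simps)

lemma R_one_apply [simp]: "\<xi> \<in> V \<Longrightarrow> \<one>\<^bsub>R\<^esub> \<xi> = \<xi>"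
  by (simp add: B_ring_simps)

lemma R_zero_apply [simp]: "\<xi> \<in> V \<Longrightarrow> \<zero>\<^bsub>R\<^esub> \<xi> = QpN_zero"
  by (simp add: B_ring_simps)

lemma R_one_B [simp]: "\<one>\<^bsub>R\<^esub> \<in> BV" and R_zero_B [simp]: "\<zero>\<^bsub>R\<^esub> \<in> BV"
  using B.one_closed B.zero_closed by simp_all

section \<open>Reindexing, scaling and elementary operators\<close>

definition pull :: "(nat \<Rightarrow> nat) \<Rightarrow> (nat \<Rightarrow> padic) \<Rightarrow> nat \<Rightarrow> padic" where
  "pull \<sigma> = restrict (\<lambda>\<xi> i. \<xi> (\<sigma> i)) V"

text \<open>Extension by zero along \<open>\<sigma>\<close>; for injective \<open>\<sigma>\<close>
  it has the left inverse \<open>pull \<sigma>\<close>.\<close>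

definition push :: "(nat \<Rightarrow> nat) \<Rightarrow> (nat \<Rightarrow> padic) \<Rightarrow> nat \<Rightarrow> padic" where
  "push \<sigma> = restrict (\<lambda>\<xi> j. if j \<in> range \<sigma> then \<xi> (inv_into UNIV \<sigma> j) else padic_zero) V"

text \<open>Injectivity prevents a single non-integral coordinate from being read at infinitely many
  places.\<close>

lemma pull_B:
  assumes \<sigma>: "inj \<sigma>"
  shows "pull \<sigma> \<in> BV"
  unfolding pull_def
proof (rule restrict_B)
  fix \<xi> assume \<xi>: "\<xi> \<in> V"
  have "{i. \<not> vge 0 (\<xi> (\<sigma> i))} = \<sigma> -` {i. \<not> vge 0 (\<xi> i)}" by auto
  then show V: "(\<lambda>i. \<xi> (\<sigma> i)) \<in> V"
    using \<xi> finite_vimageI[OF _ \<sigma>, of "{i. \<not> vge 0 (\<xi> i)}"] by (simp add: V_iff)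
next
  fix n K assume K: "finite (K::nat set)"
  have "(\<lambda>i. \<xi> (\<sigma> i)) \<in> nbd n K" if \<xi>: "\<xi> \<in> nbd n (\<sigma> ` K)" for \<xi>
  proof -
    have "{i. \<not> vge 0 (\<xi> (\<sigma> i))} = {}" using \<xi> by (auto simp: nbd_def)
    then have "(\<lambda>i. \<xi> (\<sigma> i)) \<in> V" using \<xi> by (simp add: V_iff nbd_def)
    then show ?thesis using \<xi> by (simp add: nbd_def)
  qed
  then show "\<exists>m Q. finite Q \<and> (\<forall>\<xi>\<in>nbd m Q. (\<lambda>i. \<xi> (\<sigma> i)) \<in> nbd n K)"
    using K by (intro exI[of _ n] exI[of _ "\<sigma> ` K"]) simp
qed (simp_all add: fun_eq_iff)

lemma pull_apply [simp]: "\<xi> \<in> V \<Longrightarrow> pull \<sigma> \<xi> i = \<xi> (\<sigma> i)"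
  by (simp add: pull_def)

lemma push_B:
  assumes \<sigma>: "inj \<sigma>"
  shows "push \<sigma> \<in> BV"
  unfolding push_def
proof (rule restrict_B)
  let ?F = "\<lambda>\<xi> j. if j \<in> range \<sigma> then \<xi> (inv_into UNIV \<sigma> j) else padic_zero"
  show V: "?F \<xi> \<in> V" if \<xi>: "\<xi> \<in> V" for \<xi>
  proof -
    have "{j. \<not> vge 0 (?F \<xi> j)} \<subseteq> \<sigma> ` {i. \<not> vge 0 (\<xi> i)}"
      using \<sigma> by (auto split: if_splits)
    then have "finite {j. \<not> vge 0 (?F \<xi> j)}" 
      by (rule finite_subset) (use \<xi> in \<open>simp add: V_iff\<close>)
    then show ?thesis using \<xi> by (simp add: V_iff)
  qed
  fix n K assume K: "finite (K::nat set)"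
  have "?F \<xi> \<in> nbd n K" if \<xi>: "\<xi> \<in> nbd n (\<sigma> -` K)" for \<xi>
    using \<xi> V[of \<xi>] \<sigma> by (auto simp: nbd_def)
  then show "\<exists>m Q. finite Q \<and> (\<forall>\<xi>\<in>nbd m Q. ?F \<xi> \<in> nbd n K)"
    using finite_vimageI[OF K \<sigma>] by (intro exI[of _ n] exI[of _ "\<sigma> -` K"]) simp
next
  show "(\<lambda>j. if j \<in> range \<sigma> then (\<xi> [++] \<eta>) (inv_into UNIV \<sigma> j) else padic_zero) =
      (\<lambda>j. if j \<in> range \<sigma> then \<xi> (inv_into UNIV \<sigma> j) else padic_zero) [++]
      (\<lambda>j. if j \<in> range \<sigma> then \<eta> (inv_into UNIV \<sigma> j) else padic_zero)" for \<xi> \<eta>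
    by (rule ext) (simp add: add_zero_left)
qed (auto simp: fun_eq_iff mult_zero_right)

lemma push_apply [simp]: "inj \<sigma> \<Longrightarrow> \<xi> \<in> V \<Longrightarrow> push \<sigma> \<xi> (\<sigma> i) = \<xi> i"
  by (simp add: push_def)

lemma push_apply_outside: "\<xi> \<in> V \<Longrightarrow> j \<notin> range \<sigma> \<Longrightarrow> push \<sigma> \<xi> j = padic_zero"
  by (simp add: push_def)

definition scl :: "int \<Rightarrow> nat set \<Rightarrow> (nat \<Rightarrow> padic) \<Rightarrow> nat \<Rightarrow> padic" where
  "scl m Q = restrict (\<lambda>\<xi> i. if i \<in> Q then shift m (\<xi> i) else \<xi> i) V"

text \<open>For \<open>m < 0\<close> every coordinate in \<open>Q\<close> can become non-integral,
  so finiteness of \<open>Q\<close> is what keeps the image in \<open>V\<close>.\<close>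

lemma scl_B:
  assumes Q: "finite Q"
  shows "scl m Q \<in> BV"
  unfolding scl_def
proof (rule restrict_B)
  let ?F = "\<lambda>\<xi> i. if i \<in> Q then shift m (\<xi> i) else \<xi> i"
  show V: "?F \<xi> \<in> V" if \<xi>: "\<xi> \<in> V" for \<xi>
  proof -
    have "{i. \<not> vge 0 (?F \<xi> i)} \<subseteq> Q \<union> {i. \<not> vge 0 (\<xi> i)}" by auto
    then have "finite {i. \<not> vge 0 (?F \<xi> i)}" 
      by (rule finite_subset) (use \<xi> Q in \<open>simp add: V_iff\<close>)
    then show ?thesis using \<xi> by (simp add: V_iff shift_Qp)
  qed
  fix n K assume K: "finite (K::nat set)"
  \<comment> \<open>Coordinates in \<open>Q\<close> must have valuation at least
    \<open>max n 0\<close> after the shift, hence at least \<open>max n 0 - m\<close> before it; the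
    other coordinates in \<open>K\<close> need \<open>n\<close>.\<close>
  define m' where "m' = max (max n 0 - m) n"
  have "?F \<xi> \<in> nbd n K" if \<xi>: "\<xi> \<in> nbd m' (K \<union> Q)" for \<xi>
    using \<xi> V[of \<xi>] by (auto simp: nbd_def m'_def vge_def shift_def)
  then show "\<exists>m Q. finite Q \<and> (\<forall>\<xi>\<in>nbd m Q. ?F \<xi> \<in> nbd n K)"
    using K Q by (intro exI[of _ m'] exI[of _ "K \<union> Q"]) simp
qed (auto simp: fun_eq_iff shift_add shift_mult V_Qp)

lemma scl_apply [simp]: "\<xi> \<in> V \<Longrightarrow> scl m Q \<xi> i = (if i \<in> Q then shift m (\<xi> i) else \<xi> i)"
  by (simp add: scl_def)

lemma scl_inverse:
  assumes Q: "finite Q"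
  shows "scl m Q \<otimes>\<^bsub>R\<^esub> scl (- m) Q = \<one>\<^bsub>R\<^esub>"
proof (rule B_eqI)
  fix \<xi> assume \<xi>: "\<xi> \<in> V"
  then have "scl (- m) Q \<xi> \<in> V" using scl_B[OF Q] B_V by blast
  with \<xi> show "(scl m Q \<otimes>\<^bsub>R\<^esub> scl (- m) Q) \<xi> = \<one>\<^bsub>R\<^esub> \<xi>"
    by (auto simp: B_mult_apply fun_eq_iff)
qed (simp_all add: B_mult_closed scl_B Q)

lemma scl_Units: "finite Q \<Longrightarrow> scl m Q \<in> Units R"
  using scl_inverse[of Q m] scl_inverse[of Q "- m"] scl_B unfolding Units_def by auto

definition rank_one :: "(nat \<Rightarrow> padic) \<Rightarrow> nat \<Rightarrow> (nat \<Rightarrow> padic) \<Rightarrow> nat \<Rightarrow> padic" where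
  "rank_one z i = restrict (\<lambda>\<xi> j. z j [*] \<xi> i) V"

lemma rank_one_apply [simp]: "\<xi> \<in> V \<Longrightarrow> rank_one z i \<xi> j = z j [*] \<xi> i"
  by (simp add: rank_one_def)

text \<open>A matrix whose only non-zero column is \<open>z\<close>, at place \<open>i\<close>.
  Since \<open>\<xi> i\<close> may be non-integral, infinitely many non-zero entries of
  \<open>z\<close> could lead out of \<open>V\<close>.\<close>

lemma rank_one_B:
  assumes z: "\<And>j. z j \<in> Zp p" and fin: "finite {j. z j \<noteq> padic_zero}"
  shows "rank_one z i \<in> BV"
  unfolding rank_one_def
proof (rule restrict_B)
  let ?F = "\<lambda>\<xi> j. z j [*] \<xi> i"
  show V: "?F \<xi> \<in> V" if \<xi>: "\<xi> \<in> V" for \<xi>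
  proof -
    have "{j. \<not> vge 0 (?F \<xi> j)} \<subseteq> {j. z j \<noteq> padic_zero}"
      using mult_zero_left[OF V_Qp[OF \<xi>]] by auto
    then have "finite {j. \<not> vge 0 (?F \<xi> j)}" by (rule finite_subset) (rule fin)
    then show ?thesis using \<xi> z by (simp add: V_iff mult_Qp)
  qed
  fix n K assume K: "finite (K::nat set)"
  have "?F \<xi> \<in> nbd n K" if \<xi>: "\<xi> \<in> nbd n {i}" for \<xi>
    using \<xi> V[of \<xi>] by (auto simp: nbd_def vge_mult z V_Qp)
  then show "\<exists>m Q. finite Q \<and> (\<forall>\<xi>\<in>nbd m Q. ?F \<xi> \<in> nbd n K)"
    by (intro exI[of _ n] exI[of _ "{i}"]) simp
qed (auto simp: fun_eq_iff mult_add_right mult_left_commute z V_Qp)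

text \<open>With \<open>z i\<close> zero the rank-one operator squares to zero, so changing its sign
  gives the inverse.\<close>

lemma transvection_Units:
  assumes z: "\<And>j. z j \<in> Zp p" and fin: "finite {j. z j \<noteq> padic_zero}" and zi: "z i = padic_zero"
  shows "\<one>\<^bsub>R\<^esub> \<oplus>\<^bsub>R\<^esub> rank_one z i \<in> Units R"
proof -
  let ?W = "rank_one z i"
  have W: "?W \<in> carrier R" using rank_one_B z fin by simp
  have WW: "?W \<otimes>\<^bsub>R\<^esub> ?W = \<zero>\<^bsub>R\<^esub>"
  proof (rule B_eqI)
    fix \<xi> assume \<xi>: "\<xi> \<in> V"
    then have "?W \<xi> \<in> V" using W B_V by simp
    with \<xi> show "(?W \<otimes>\<^bsub>R\<^esub> ?W) \<xi> = \<zero>\<^bsub>R\<^esub> \<xi>"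
      by (auto simp: B_mult_apply fun_eq_iff zi mult_zero_left mult_zero_right z V_Qp)
  qed (use W in \<open>simp_all add: B_mult_closed\<close>)
  let ?a = "\<one>\<^bsub>R\<^esub> \<oplus>\<^bsub>R\<^esub> ?W" and ?b = "\<one>\<^bsub>R\<^esub> \<ominus>\<^bsub>R\<^esub> ?W"
  have a: "?a \<in> carrier R" and b: "?b \<in> carrier R"
    using W B.minus_closed[OF B.one_closed W] B.add.m_closed[OF B.one_closed W] by simp_all
  have "?a \<otimes>\<^bsub>R\<^esub> ?b = \<one>\<^bsub>R\<^esub>" "?b \<otimes>\<^bsub>R\<^esub> ?a = \<one>\<^bsub>R\<^esub>"
    using W WW by (simp_all only: B.minus_eq B.l_distr B.r_distr B.r_minus B.l_minus B.one_closed
        B.add.inv_closed B.add.m_closed B.l_one B.r_one B.minus_zero B.r_zero B.m_closed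
        B.add.m_assoc B.r_neg B.l_neg B.zero_closed B.a_inv_closed)
  then show ?thesis using a b unfolding Units_def by blast
qed

section \<open>Lattices commensurable with \<open>ZN\<close>\<close>

definition ZN :: "(nat \<Rightarrow> padic) set" where "ZN = nbd 0 {}"

lemma ZN_iff: "\<xi> \<in> ZN \<longleftrightarrow> \<xi> \<in> V \<and> (\<forall>j. vge 0 (\<xi> j))"
  by (simp add: ZN_def nbd_def)

lemma ZN_I: "(\<And>j. \<xi> j \<in> Zp p) \<Longrightarrow> \<xi> \<in> ZN"
  by (simp add: ZN_iff V_iff Zp_iff)

lemma ZN_D: "\<xi> \<in> ZN \<Longrightarrow> \<xi> j \<in> Zp p"
  by (simp add: ZN_iff V_iff Zp_iff)

lemma vge_mono: "vge n x \<Longrightarrow> m \<le> n \<Longrightarrow> vge m x"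
  by (simp add: vge_def)

lemma vge_add_cancel:
  assumes "x \<in> Qp p" "y \<in> Qp p" "vge n y" "vge n (x [+] y)"
  shows "vge n x"
proof -
  have "padic_neg y [+] (y [+] x) = padic_neg y [+] y [+] x"
    by (rule add_assoc[symmetric]) (auto intro: assms neg_Qp)
  then have "x = padic_neg y [+] (x [+] y)"
    using assms by (simp add: add_neg_left add_zero_left add_comm[of x y])
  then show ?thesis using assms by (metis vge_add vge_neg neg_Qp add_Qp)
qed

text \<open>A \<open>Zp p\<close>-module between \<open>ZN\<close> and \<open>p^(-m)\<close> times
  \<open>ZN\<close> that exceeds \<open>ZN\<close> only in the coordinates of \<open>P\<close>. The
  set \<open>P\<close> bounds the elimination that is still to be done.\<close>

definition lattice :: "nat set \<Rightarrow> (nat \<Rightarrow> padic) set \<Rightarrow> bool" where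
  "lattice P L \<longleftrightarrow> L \<subseteq> V \<and> ZN \<subseteq> L \<and> (\<forall>\<xi>\<in>L. \<forall>\<eta>\<in>L. \<xi> [++] \<eta> \<in> L) \<and> (\<forall>a\<in>Zp p. \<forall>\<xi>\<in>L. a [**] \<xi> \<in> L) \<and>
    (\<forall>\<xi>\<in>L. \<forall>j. j \<notin> P \<longrightarrow> vge 0 (\<xi> j)) \<and> (\<exists>m::nat. \<forall>\<xi>\<in>L. \<forall>j. vge (- int m) (\<xi> j))"

text \<open>The pivot \<open>x i\<close> has minimal valuation among all coordinates of all elements of \<open>L\<close>, so clearing
  with it needs only coefficients in \<open>\<int>\<^sub>p\<close>.\<close>

lemma lattice_pivot:
  assumes P: "finite P" and L: "lattice P L" and ne: "L \<noteq> ZN"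
  obtains m :: nat and i x where "i \<in> P" "x \<in> L" "x i = shift (- int m) padic_one"
    "\<And>j. j \<notin> P \<Longrightarrow> x j = padic_zero" "\<And>\<xi> j. \<xi> \<in> L \<Longrightarrow> vge (- int m) (\<xi> j)"
proof -
  have LV: "L \<subseteq> V" and ZL: "ZN \<subseteq> L" and Ladd: "\<And>\<xi> \<eta>. \<xi> \<in> L \<Longrightarrow> \<eta> \<in> L \<Longrightarrow> \<xi> [++] \<eta> \<in> L"
    and Lsm: "\<And>a \<xi>. a \<in> Zp p \<Longrightarrow> \<xi> \<in> L \<Longrightarrow> a [**] \<xi> \<in> L"
    and Lout: "\<And>\<xi> j. \<xi> \<in> L \<Longrightarrow> j \<notin> P \<Longrightarrow> vge 0 (\<xi> j)"
    and Lbd: "\<exists>m::nat. \<forall>\<xi>\<in>L. \<forall>j. vge (- int m) (\<xi> j)"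
    using L unfolding lattice_def by blast+
  define m where "m = (LEAST m::nat. \<forall>\<xi>\<in>L. \<forall>j. vge (- int m) (\<xi> j))"
  have m: "vge (- int m) (\<xi> j)" if "\<xi> \<in> L" for \<xi> j
    using LeastI_ex[OF Lbd] that unfolding m_def by blast
  have "m \<noteq> 0"
  proof
    assume "m = 0"
    then have "L \<subseteq> ZN" using m LV by (auto simp: ZN_iff)
    with ZL ne show False by blast
  qed
  \<comment> \<open>By minimality of \<open>m\<close> some coordinate has valuation exactly
    \<open>- m\<close>. As \<open>m\<close> is positive, \<open>m - 1\<close> is a genuine
    predecessor.\<close>
  then have "\<not> (\<forall>\<xi>\<in>L. \<forall>j. vge (- int (m - 1)) (\<xi> j))"
    unfolding m_def by (intro not_less_Least) simp
  then obtain x i where x: "x \<in> L" and nx: "\<not> vge (1 - int m) (x i)"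
    using \<open>m \<noteq> 0\<close> by (auto simp: of_nat_diff)
  have i: "i \<in> P"
  proof (rule ccontr)
    assume "i \<notin> P"
    then have "vge 0 (x i)" by (rule Lout[OF x])
    then show False using nx vge_mono[of 0 "x i" "1 - int m"] \<open>m \<noteq> 0\<close> by simp
  qed
  have xQ: "x j \<in> Qp p" for j using LV x V_Qp by blast
  define y where "y = shift (int m) (x i)"
  have y: "y \<in> Zp p" unfolding Zp_iff y_def using m[OF x] xQ by (simp add: shift_Qp)
  have "y 0 \<noteq> 0"
  proof
    assume "y 0 = 0"
    then have "x i (- int m) = 0" by (simp add: y_def shift_def)
    moreover have "x i k = 0" if "k < - int m" for k
      using m[OF x, of i] that unfolding vge_def by blast
    moreover have "k < - int m \<or> k = - int m" if "k < 1 - int m" for k using that by linarith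
    ultimately have "vge (1 - int m) (x i)" unfolding vge_def by blast
    then show False using nx by contradiction
  qed
  \<comment> \<open>\<open>x i\<close> is \<open>p^(-m)\<close> times the unit \<open>y\<close>;
    multiplication by the inverse of \<open>y\<close> normalises the pivot.\<close>
  then obtain c where c: "c \<in> Zp p" "c [*] y = padic_one" using unit_inverse[OF y] by blast
  have cx: "c [**] x \<in> L" by (rule Lsm[OF c(1) x])
  then have cxV: "c [**] x \<in> V" using LV by blast
  have cxi: "c [*] x i = shift (- int m) padic_one"
  proof -
    have "shift (- int m) (c [*] y) = c [*] shift (- int m) y"
      by (rule shift_mult[OF c(1) Zp_Qp[OF y]])
    then show ?thesis using c(2) by (simp add: y_def)
  qed
  define x' where "x' = (\<lambda>j. if j \<in> P then (c [**] x) j else padic_zero)"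
  \<comment> \<open>\<open>w\<close> cancels the coordinates outside \<open>P\<close>. They are
    integral, so \<open>w\<close> lies in \<open>ZN\<close> and adding it does not leave
    \<open>L\<close>.\<close>
  define w where "w = (\<lambda>j. if j \<in> P then padic_zero else padic_neg ((c [**] x) j))"
  have "w \<in> ZN"
  proof (rule ZN_I)
    fix j
    have "j \<notin> P \<Longrightarrow> (c [**] x) j \<in> Zp p"
      using Lout[OF cx, of j] V_Qp[OF cxV, of j] by (simp add: Zp_iff)
    then show "w j \<in> Zp p" by (auto simp: w_def neg_Zp)
  qed
  then have "c [**] x [++] w \<in> L" using cx ZL Ladd by blast
  also have "c [**] x [++] w = x'"
  proof
    fix j
    have Q: "(c [**] x) j \<in> Qp p" by (rule V_Qp[OF cxV])
    show "(c [**] x [++] w) j = x' j"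
      using add_neg_left[OF Q] add_zero_left[OF Q]
        add_comm[of "(c [**] x) j" "padic_neg ((c [**] x) j)"] add_comm[of "(c [**] x) j" padic_zero]
      by (simp add: w_def x'_def)
  qed
  finally have x': "x' \<in> L" .
  show thesis
    by (rule that[of i x' m]) (use i x' cxi m in \<open>auto simp: x'_def\<close>)
qed

text \<open>\<open>u\<close> sends the basis vector at \<open>i\<close> to the pivot vector
  \<open>x\<close> and fixes the others. An integral \<open>\<xi>\<close> thus goes to an integral
  vector plus \<open>\<xi> i [**] x\<close>, which lies in \<open>L\<close>; conversely, the minimal
  valuation of the pivot makes coordinate \<open>i\<close> of the preimage of \<open>L\<close>
  integral, so \<open>i\<close> leaves \<open>P\<close>.\<close>

lemma lattice_reduce:
  assumes P: "finite P" and L: "lattice P L" and ne: "L \<noteq> ZN"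
  obtains u i where "u \<in> Units R" "i \<in> P" "lattice (P - {i}) {\<xi> \<in> V. u \<xi> \<in> L}"
proof -
  obtain m :: nat and i x where i: "i \<in> P" and x: "x \<in> L" and xi: "x i = shift (- int m) padic_one"
    and xout: "\<And>j. j \<notin> P \<Longrightarrow> x j = padic_zero" and m: "\<And>\<xi> j. \<xi> \<in> L \<Longrightarrow> vge (- int m) (\<xi> j)"
    by (rule lattice_pivot[OF P L ne]) blast
  have LV: "L \<subseteq> V" and ZL: "ZN \<subseteq> L" and Ladd: "\<And>\<xi> \<eta>. \<xi> \<in> L \<Longrightarrow> \<eta> \<in> L \<Longrightarrow> \<xi> [++] \<eta> \<in> L"
    and Lsm: "\<And>a \<xi>. a \<in> Zp p \<Longrightarrow> \<xi> \<in> L \<Longrightarrow> a [**] \<xi> \<in> L"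
    and Lout: "\<And>\<xi> j. \<xi> \<in> L \<Longrightarrow> j \<notin> P \<Longrightarrow> vge 0 (\<xi> j)"
    using L unfolding lattice_def by blast+
  have xQ: "x j \<in> Qp p" for j using LV x V_Qp by blast
  have sh0: "shift k padic_zero = padic_zero" for k by (simp add: shift_def padic_zero_def)
  \<comment> \<open>The factor \<open>p^m\<close> compensates for \<open>scl\<close>, which acts
    first and divides coordinate \<open>i\<close> by \<open>p^m\<close>. Minimality of the pivot
    makes the entries integral.\<close>
  define z where "z = (\<lambda>j. if j = i then padic_zero else shift (int m) (x j))"
  have z: "z j \<in> Zp p" for j
    using m[OF x] xQ by (simp add: z_def Zp_iff shift_Qp)
  have zi: "z i = padic_zero" by (simp add: z_def)
  have zout: "z j = padic_zero" if "j \<notin> P" for j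
    using xout[OF that] by (simp add: z_def sh0)
  have fin: "finite {j. z j \<noteq> padic_zero}"
    by (rule finite_subset[OF _ P]) (use zout in blast)
  define u where "u = (\<one>\<^bsub>R\<^esub> \<oplus>\<^bsub>R\<^esub> rank_one z i) \<otimes>\<^bsub>R\<^esub> scl (- int m) {i}"
  have u: "u \<in> Units R" unfolding u_def
    by (intro B.Units_m_closed transvection_Units z fin zi scl_Units) simp
  then have uB: "u \<in> BV" using B.Units_closed by simp
  have u_i: "u \<xi> i = shift (- int m) (\<xi> i)" and
    u_j: "j \<noteq> i \<Longrightarrow> u \<xi> j = \<xi> j [+] z j [*] shift (- int m) (\<xi> i)" if \<xi>: "\<xi> \<in> V" for \<xi> j
  proof -
    have s: "scl (- int m) {i} \<xi> \<in> V" using \<xi> scl_B B_V by blast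
    have *: "u \<xi> j = scl (- int m) {i} \<xi> j [+] z j [*] shift (- int m) (\<xi> i)" for j
      using \<xi> s by (simp add: u_def B_mult_apply B_add_apply)
    show "j \<noteq> i \<Longrightarrow> u \<xi> j = \<xi> j [+] z j [*] shift (- int m) (\<xi> i)" using *[of j] \<xi> by simp
    have Q: "shift (- int m) (\<xi> i) \<in> Qp p" by (intro shift_Qp V_Qp \<xi>)
    show "u \<xi> i = shift (- int m) (\<xi> i)"
      using *[of i] \<xi> Q by (simp add: zi mult_zero_left add_comm[of _ padic_zero] add_zero_left)
  qed
  let ?L = "{\<xi> \<in> V. u \<xi> \<in> L}"
  \<comment> \<open>The gain of this step: \<open>u\<close> divides coordinate \<open>i\<close> by
    \<open>p^m\<close>, yet the result has valuation at least \<open>- m\<close>.\<close>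
  have int_i: "vge 0 (\<xi> i)" if "\<xi> \<in> ?L" for \<xi>
    using m[of "u \<xi>" i] that by (simp add: u_i)
  have "lattice (P - {i}) ?L"
    unfolding lattice_def
  proof (intro conjI ballI allI impI exI[of _ m])
    show "ZN \<subseteq> ?L"
    proof
      fix \<xi> assume \<xi>: "\<xi> \<in> ZN"
      then have \<xi>V: "\<xi> \<in> V" and \<xi>Z: "\<And>j. \<xi> j \<in> Zp p" by (auto simp: ZN_iff ZN_D)
      define \<xi>' where "\<xi>' = (\<lambda>j. if j = i then padic_zero else \<xi> j)"
      have "\<xi>' \<in> ZN" by (rule ZN_I) (simp add: \<xi>'_def \<xi>Z)
      then have "\<xi>' [++] \<xi> i [**] x \<in> L" using ZL Ladd Lsm x \<xi>Z by blast
      also have "\<xi>' [++] \<xi> i [**] x = u \<xi>"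
      proof
        fix j
        show "(\<xi>' [++] \<xi> i [**] x) j = u \<xi> j"
        proof (cases "j = i")
          case True
          have "\<xi> i [*] x i = shift (- int m) (\<xi> i)"
            unfolding xi shift_mult[OF \<xi>Z Zp_Qp[OF one_Zp], symmetric] by (simp add: mult_one_right \<xi>Z)
          then show ?thesis
            using True \<xi>V by (simp add: \<xi>'_def u_i add_zero_left shift_Qp V_Qp)
        next
          case False
          have "z j [*] shift (- int m) (\<xi> i) = shift (- int m) (\<xi> i [*] z j)"
            by (simp add: shift_mult[symmetric] z \<xi>Z Zp_Qp mult_commute)
          also have "\<dots> = \<xi> i [*] x j"
            using False by (simp add: shift_mult z \<xi>Z Zp_Qp) (simp add: z_def)
          finally show ?thesis using False \<xi>V by (simp add: \<xi>'_def u_j)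
        qed
      qed
      finally show "\<xi> \<in> ?L" using \<xi>V by simp
    qed
  next
    fix \<xi> j assume \<xi>: "\<xi> \<in> ?L" and j: "j \<notin> P - {i}"
    show "vge 0 (\<xi> j)"
    proof (cases "j = i")
      case False
      then have "j \<notin> P" using j by simp
      have \<xi>V: "\<xi> \<in> V" using \<xi> by simp
      have "u \<xi> j = \<xi> j"
        unfolding u_j[OF \<xi>V False] zout[OF \<open>j \<notin> P\<close>]
        by (simp add: mult_zero_left add_comm[of _ padic_zero] add_zero_left shift_Qp V_Qp \<xi>V)
      then show ?thesis using Lout[of "u \<xi>" j] \<xi> \<open>j \<notin> P\<close> by simp
    qed (use int_i \<xi> in simp)
  next
    fix \<xi> j assume \<xi>: "\<xi> \<in> ?L"
    then have \<xi>V: "\<xi> \<in> V" by simp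
    show "vge (- int m) (\<xi> j)"
    proof (cases "j = i")
      case True
      then show ?thesis using int_i[OF \<xi>] vge_mono[of 0 _ "- int m"] by simp
    next
      case False
      show ?thesis
      proof (rule vge_add_cancel[where y = "z j [*] shift (- int m) (\<xi> i)"])
        show "vge (- int m) (\<xi> j [+] z j [*] shift (- int m) (\<xi> i))"
          using m[of "u \<xi>" j] \<xi> by (simp add: u_j[OF \<xi>V False])
        show "vge (- int m) (z j [*] shift (- int m) (\<xi> i))"
          by (rule vge_mult[OF z]) (use int_i[OF \<xi>] \<xi>V in \<open>simp_all add: shift_Qp V_Qp\<close>)
      qed (use \<xi>V z in \<open>simp_all add: mult_Qp shift_Qp V_Qp\<close>)
    qed
  qed (auto simp: vadd_V smult_V B_add[OF uB] B_smult[OF uB] Ladd Lsm)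
  from that[OF u i this] show thesis .
qed

text \<open>Each elimination removes a coordinate from \<open>P\<close> and replaces
  \<open>L\<close> by its preimage; it is possible as long as \<open>L\<close> differs from
  \<open>ZN\<close>, so the process ends at \<open>ZN\<close>. The product of the units used carries
  \<open>ZN\<close> onto \<open>L\<close>.\<close>

lemma lattice_unit:
  assumes "finite P" "lattice P L"
  shows "\<exists>u\<in>Units R. \<forall>\<xi>\<in>V. u \<xi> \<in> L \<longleftrightarrow> \<xi> \<in> ZN"
  using assms
proof (induction P arbitrary: L rule: finite_psubset_induct)
  case (psubset P)
  show ?case
  proof (cases "L = ZN")
    case True
    then show ?thesis by (intro bexI[of _ "\<one>\<^bsub>R\<^esub>"]) auto
  next
    case False
    obtain u1 i where u1: "u1 \<in> Units R" "i \<in> P" "lattice (P - {i}) {\<xi> \<in> V. u1 \<xi> \<in> L}"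
      by (rule lattice_reduce[OF psubset.hyps psubset.prems False])
    then have "P - {i} \<subset> P" by blast
    then obtain u2 where u2: "u2 \<in> Units R" "\<forall>\<xi>\<in>V. u2 \<xi> \<in> {\<xi> \<in> V. u1 \<xi> \<in> L} \<longleftrightarrow> \<xi> \<in> ZN"
      using psubset.IH[OF _ u1(3)] by blast
    have "u2 \<xi> \<in> V" if "\<xi> \<in> V" for \<xi> using B.Units_closed[OF u2(1)] that B_V by simp
    then show ?thesis using u2 u1(1)
      by (intro bexI[of _ "u1 \<otimes>\<^bsub>R\<^esub> u2"]) (auto simp: B_mult_apply)
  qed
qed

subsection \<open>The swindle\<close>

text \<open>\<open>prod_encode\<close> identifies the index set with pairs, so an element of
  \<open>V\<close> becomes a sequence of blocks; \<open>col n\<close> enumerates the indices of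
  block \<open>n\<close>.\<close>

abbreviation col :: "nat \<Rightarrow> nat \<Rightarrow> nat" where
  "col n \<equiv> \<lambda>i. prod_encode (n, i)"

abbreviation blk :: "nat \<Rightarrow> (nat \<Rightarrow> padic) \<Rightarrow> nat \<Rightarrow> padic" where
  "blk n \<equiv> pull (col n)"

lemma inj_col: "inj (col n)"
  by (auto simp: inj_def)

lemma blk_B: "blk n \<in> BV"
  by (rule pull_B[OF inj_col])

lemma blk_V: "\<xi> \<in> V \<Longrightarrow> blk n \<xi> \<in> V"
  using blk_B B_V by blast

lemma blk_eqI:
  assumes "\<xi> \<in> V" "\<eta> \<in> V" "\<And>n. blk n \<xi> = blk n \<eta>"
  shows "\<xi> = \<eta>"
proof
  fix k
  obtain n i where k: "k = prod_encode (n, i)" by (metis prod_decode_inverse surj_pair)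
  show "\<xi> k = \<eta> k" using fun_cong[OF assms(3)[of n], of i] assms(1,2) by (simp add: k)
qed

text \<open>Only for \<open>e\<close> preserving \<open>\<int>\<^sub>p\<^sup>\<nat>\<close> does the diagonal operator \<open>(e, e, e, \<dots>)\<close> act on
  \<open>V \<cong> \<rat>\<^sub>p(\<nat> \<times> \<nat>)\<close>.\<close>

definition diag :: "((nat \<Rightarrow> padic) \<Rightarrow> nat \<Rightarrow> padic) \<Rightarrow> (nat \<Rightarrow> padic) \<Rightarrow> nat \<Rightarrow> padic" where
  "diag e = restrict (\<lambda>\<xi> k. e (blk (fst (prod_decode k)) \<xi>) (snd (prod_decode k))) V"

text \<open>An element of \<open>V\<close> has only finitely many non-integral blocks, and
  \<open>e\<close> keeps all the others integral. The images of the finitely many exceptional blocks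
  contribute finitely many non-integral coordinates each.\<close>

lemma diag_B:
  assumes e: "e \<in> BV" and pres: "\<And>\<xi>. \<xi> \<in> ZN \<Longrightarrow> e \<xi> \<in> ZN"
  shows "diag e \<in> BV"
  unfolding diag_def
proof (rule restrict_B)
  let ?F = "\<lambda>\<xi> k. e (blk (fst (prod_decode k)) \<xi>) (snd (prod_decode k))"
  have eV: "e (blk n \<xi>) \<in> V" if "\<xi> \<in> V" for \<xi> n
    using that blk_V B_V[OF e] by blast
  show V: "?F \<xi> \<in> V" if \<xi>: "\<xi> \<in> V" for \<xi>
  proof -
    define N where "N = fst ` prod_decode ` {k. \<not> vge 0 (\<xi> k)}"
    have N: "finite N" using \<xi> by (simp add: N_def V_iff)
    have out: "e (blk n \<xi>) \<in> ZN" if "n \<notin> N" for n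
    proof (rule pres)
      have "vge 0 (\<xi> (prod_encode (n, i)))" for i
        using that unfolding N_def by (force simp: image_iff)
      then show "blk n \<xi> \<in> ZN" using \<xi> by (simp add: ZN_iff blk_V)
    qed
    have "{k. \<not> vge 0 (?F \<xi> k)} \<subseteq> (\<Union>n\<in>N. col n ` {i. \<not> vge 0 (e (blk n \<xi>) i)})"
    proof
      fix k assume k: "k \<in> {k. \<not> vge 0 (?F \<xi> k)}"
      obtain n i where ni: "k = prod_encode (n, i)" by (metis prod_decode_inverse surj_pair)
      then have "\<not> vge 0 (e (blk n \<xi>) i)" using k by simp
      moreover from this have "n \<in> N" using out[of n] by (auto simp: ZN_iff)
      ultimately show "k \<in> (\<Union>n\<in>N. col n ` {i. \<not> vge 0 (e (blk n \<xi>) i)})" using ni by blast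
    qed
    moreover have "finite (\<Union>n\<in>N. col n ` {i. \<not> vge 0 (e (blk n \<xi>) i)})"
      using N eV[OF \<xi>] by (simp add: V_iff)
    ultimately have "finite {k. \<not> vge 0 (?F \<xi> k)}" by (rule finite_subset)
    then show ?thesis using eV[OF \<xi>] by (simp add: V_iff)
  qed
  fix n K assume K: "finite (K::nat set)"
  define K1 where "K1 = fst ` prod_decode ` K"
  define K2 where "K2 = snd ` prod_decode ` K"
  have fin: "finite K1" "finite K2" using K by (simp_all add: K1_def K2_def)
  obtain m Q where Q: "finite Q" "e ` nbd m Q \<subseteq> nbd n K2" using B_nbd[OF e fin(2)] .
  \<comment> \<open>One copy of \<open>Q\<close> in each of the finitely many blocks that
    \<open>K\<close> meets; in the remaining blocks integrality is enough, and \<open>pres\<close>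
    provides it.\<close>
  define Q' where "Q' = (\<Union>b\<in>K1. col b ` Q)"
  have "?F \<xi> \<in> nbd n K" if \<xi>: "\<xi> \<in> nbd m Q'" for \<xi>
  proof -
    have \<xi>V: "\<xi> \<in> V" using \<xi> by (rule nbd_V)
    have "blk b \<xi> \<in> ZN" for b using \<xi> \<xi>V by (simp add: ZN_iff blk_V nbd_def)
    then have 0: "vge 0 (e (blk b \<xi>) i)" for b i using pres by (simp add: ZN_iff)
    have n: "vge n (e (blk b \<xi>) i)" if "prod_encode (b, i) \<in> K" for b i
    proof -
      have b: "b \<in> K1" "i \<in> K2" using that by (force simp: K1_def K2_def)+
      then have "blk b \<xi> \<in> nbd m Q" using \<xi> \<xi>V by (auto simp: nbd_def blk_V Q'_def)
      then have "e (blk b \<xi>) \<in> nbd n K2" using Q(2) by blast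
      then show ?thesis using b by (simp add: nbd_def)
    qed
    have "vge n (?F \<xi> k)" if "k \<in> K" for k
      using n[of "fst (prod_decode k)" "snd (prod_decode k)"] that by simp
    then show ?thesis using V[OF \<xi>V] 0 by (simp add: nbd_def)
  qed
  then show "\<exists>m Q. finite Q \<and> (\<forall>\<xi>\<in>nbd m Q. ?F \<xi> \<in> nbd n K)"
    using fin Q(1) by (intro exI[of _ m] exI[of _ Q']) (simp add: Q'_def)
qed (simp_all add: fun_eq_iff B_add[OF blk_B] B_smult[OF blk_B] B_add[OF e] B_smult[OF e] blk_V)

lemma blk_diag:
  assumes e: "e \<in> BV" and pres: "\<And>\<xi>. \<xi> \<in> ZN \<Longrightarrow> e \<xi> \<in> ZN" and \<xi>: "\<xi> \<in> V"
  shows "blk n (diag e \<xi>) = e (blk n \<xi>)"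
proof
  have "diag e \<xi> \<in> V" using B_V[OF diag_B[OF e pres]] \<xi> by blast
  then show "blk n (diag e \<xi>) i = e (blk n \<xi>) i" for i
    using \<xi> by (simp add: diag_def)
qed

section \<open>Moving the blocks\<close>

definition next_col :: "nat \<Rightarrow> nat" where
  "next_col k = prod_encode (Suc (fst (prod_decode k)), snd (prod_decode k))"

lemma next_col_encode [simp]: "next_col (prod_encode (n, i)) = prod_encode (Suc n, i)"
  by (simp add: next_col_def)

lemma inj_next_col: "inj next_col"
  unfolding inj_def
proof (intro allI impI)
  fix k l assume "next_col k = next_col l"
  then have "prod_decode k = prod_decode l" by (simp add: next_col_def prod_eq_iff)
  then show "k = l" by (metis prod_decode_inverse)
qed

lemma blk_pull_next_col:
  assumes "\<xi> \<in> V"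
  shows "blk n (pull next_col \<xi>) = blk (Suc n) \<xi>"
  using assms B_V[OF pull_B[OF inj_next_col] assms] by (simp add: fun_eq_iff)

lemma blk_push_next_col:
  assumes \<xi>: "\<xi> \<in> V"
  shows "blk 0 (push next_col \<xi>) = QpN_zero" "blk (Suc n) (push next_col \<xi>) = blk n \<xi>"
proof -
  have V: "push next_col \<xi> \<in> V" by (rule B_V[OF push_B[OF inj_next_col] \<xi>])
  have "prod_encode (0, i) \<notin> range next_col" for i
    by (auto simp: next_col_def)
  then show "blk 0 (push next_col \<xi>) = QpN_zero"
    using V \<xi> by (auto simp: push_apply_outside)
  show "blk (Suc n) (push next_col \<xi>) = blk n \<xi>"
  proof
    fix i
    show "blk (Suc n) (push next_col \<xi>) i = blk n \<xi> i"
      using V \<xi> push_apply[OF inj_next_col \<xi>, of "prod_encode (n, i)"] by simp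
  qed
qed

lemma blk_push_col:
  assumes \<xi>: "\<xi> \<in> V"
  shows "blk m (push (col n) \<xi>) = (if m = n then \<xi> else QpN_zero)"
proof
  fix i
  have V: "push (col n) \<xi> \<in> V" by (rule B_V[OF push_B[OF inj_col] \<xi>])
  show "blk m (push (col n) \<xi>) i = (if m = n then \<xi> else QpN_zero) i"
  proof (cases "m = n")
    case True
    then show ?thesis using V \<xi> push_apply[OF inj_col \<xi>, of n i] by simp
  next
    case False
    then have "prod_encode (m, i) \<notin> range (col n)" by auto
    then show ?thesis using V \<xi> False by (simp add: push_apply_outside)
  qed
qed

lemma B_zero:
  assumes f: "f \<in> BV"
  shows "f QpN_zero = QpN_zero"
proof (rule vadd_left_cancel)
  show "f QpN_zero [++] f QpN_zero = f QpN_zero [++] QpN_zero"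
    using B_add[OF f, of QpN_zero QpN_zero] B_V[OF f, of QpN_zero]
    by (simp add: vadd_zero_left vadd_zero_right)
qed (simp_all add: B_V[OF f])

text \<open>Each block splits into its \<open>e\<close> part and its complementary \<open>f\<close>
  part. \<open>\<delta>\<close> keeps all \<open>f\<close> parts and moves every \<open>e\<close>
  part one block up, which leaves room for exactly one copy of the image of \<open>e\<close> in
  block 0; \<open>\<beta>\<close> fills it. \<open>\<gamma>\<close> and \<open>\<alpha>\<close> undo
  this.\<close>

lemma absorbed_if_integral:
  assumes e: "e \<in> BV" and ee: "e \<otimes>\<^bsub>R\<^esub> e = e" and pres: "\<And>\<xi>. \<xi> \<in> ZN \<Longrightarrow> e \<xi> \<in> ZN"
  shows "B.absorbed e"
proof -
  \<comment> \<open>The complementary idempotent \<open>\<one> - e\<close>; it preserves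
    \<open>ZN\<close> too, so it also acts diagonally.\<close>
  define f where "f = restrict (\<lambda>\<xi>. vneg (e \<xi>)) V \<oplus>\<^bsub>R\<^esub> \<one>\<^bsub>R\<^esub>"
  have f: "f \<in> BV" unfolding f_def by (intro B_add_closed B_neg_closed e R_one_B)
  have fa: "f \<xi> = vneg (e \<xi>) [++] \<xi>" if "\<xi> \<in> V" for \<xi>
    using that by (simp add: f_def B_add_apply)
  have eV: "e \<xi> \<in> V" and fV: "f \<xi> \<in> V" if "\<xi> \<in> V" for \<xi> using that B_V e f by blast+
  have e2: "e (e \<xi>) = e \<xi>" if "\<xi> \<in> V" for \<xi>
    using fun_cong[OF ee, of \<xi>] that by (simp add: B_mult_apply)
  have sum: "e \<xi> [++] f \<xi> = \<xi>" if "\<xi> \<in> V" for \<xi>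
    using that by (simp add: fa vadd_assoc[symmetric] eV vneg_V vadd_neg_right vadd_zero_left)
  have fe: "f (e \<xi>) = QpN_zero" if "\<xi> \<in> V" for \<xi>
    using that by (simp add: fa eV e2 vadd_neg_left)
  have ef: "e (f \<xi>) = QpN_zero" if \<xi>: "\<xi> \<in> V" for \<xi>
  proof (rule vadd_left_cancel[of "e \<xi>"])
    have "e \<xi> = e (e \<xi> [++] f \<xi>)" by (simp add: sum \<xi>)
    also have "\<dots> = e \<xi> [++] e (f \<xi>)" using \<xi> by (simp add: B_add[OF e] eV fV e2)
    finally show "e \<xi> [++] e (f \<xi>) = e \<xi> [++] QpN_zero" using \<xi> by (simp add: vadd_zero_right eV)
  qed (use \<xi> in \<open>simp_all add: eV fV\<close>)
  have f2: "f (f \<xi>) = f \<xi>" if \<xi>: "\<xi> \<in> V" for \<xi>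
    using sum[OF fV[OF \<xi>]] \<xi> by (simp add: ef vadd_zero_left fV)
  have fpres: "f \<xi> \<in> ZN" if "\<xi> \<in> ZN" for \<xi>
  proof -
    have \<xi>: "\<xi> \<in> V" "e \<xi> \<in> ZN" using that pres by (auto simp: ZN_iff)
    then show ?thesis using that fV[OF \<xi>(1)]
      by (simp add: fa ZN_iff vge_add vge_neg vneg_def neg_Qp V_Qp)
  qed
  note e0 = B_zero[OF e] and f0 = B_zero[OF f]
  define \<alpha> where "\<alpha> = e \<otimes>\<^bsub>R\<^esub> blk 0"
  define \<beta> where "\<beta> = push (col 0) \<otimes>\<^bsub>R\<^esub> e"
  define \<gamma> where "\<gamma> = diag e \<otimes>\<^bsub>R\<^esub> pull next_col \<oplus>\<^bsub>R\<^esub> diag f"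
  define \<delta> where "\<delta> = push next_col \<otimes>\<^bsub>R\<^esub> diag e \<oplus>\<^bsub>R\<^esub> diag f"
  note pB = pull_B[OF inj_next_col] push_B[OF inj_next_col] push_B[OF inj_col]
    diag_B[OF e pres] diag_B[OF f fpres]
  have \<alpha>: "\<alpha> \<in> BV" and \<beta>: "\<beta> \<in> BV" and \<gamma>: "\<gamma> \<in> BV" and \<delta>: "\<delta> \<in> BV"
    unfolding \<alpha>_def \<beta>_def \<gamma>_def \<delta>_def by (auto intro!: B_mult_closed B_add_closed e blk_B pB)
  have V: "pull next_col \<xi> \<in> V" "push next_col \<xi> \<in> V" "push (col n) \<xi> \<in> V" "diag e \<xi> \<in> V" "diag f \<xi> \<in> V"
      "\<alpha> \<xi> \<in> V" "\<beta> \<xi> \<in> V" "\<gamma> \<xi> \<in> V" "\<delta> \<xi> \<in> V" if "\<xi> \<in> V" for \<xi> n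
    using that by (simp_all add: pB[THEN B_V] \<alpha>[THEN B_V] \<beta>[THEN B_V] \<gamma>[THEN B_V] \<delta>[THEN B_V])
  have a: "\<alpha> \<xi> = e (blk 0 \<xi>)" if "\<xi> \<in> V" for \<xi>
    using that by (simp add: \<alpha>_def B_mult_apply)
  have b: "blk n (\<beta> \<xi>) = (if n = 0 then e \<xi> else QpN_zero)" if "\<xi> \<in> V" for n \<xi>
    using that by (simp add: \<beta>_def B_mult_apply blk_push_col eV)
  have c: "blk n (\<gamma> \<xi>) = e (blk (Suc n) \<xi>) [++] f (blk n \<xi>)" if "\<xi> \<in> V" for n \<xi>
    using that V(1,4,5)
    by (simp add: \<gamma>_def B_mult_apply B_add_apply B_add[OF blk_B] blk_diag[OF e pres] blk_diag[OF f fpres]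
        blk_pull_next_col del: vadd_apply pull_apply)
  have d: "blk 0 (\<delta> \<xi>) = f (blk 0 \<xi>)" "blk (Suc n) (\<delta> \<xi>) = e (blk n \<xi>) [++] f (blk (Suc n) \<xi>)"
    if "\<xi> \<in> V" for n \<xi>
    using that V(2,4,5) fV[OF blk_V]
    by (simp_all add: \<delta>_def B_mult_apply B_add_apply B_add[OF blk_B] blk_diag[OF e pres] blk_diag[OF f fpres]
        blk_push_next_col vadd_zero_left del: vadd_apply pull_apply)
  note simps = B_mult_apply B_add_apply B_add[OF blk_B] B_add[OF e] B_add[OF f] a b c d blk_V eV fV V
    e2 f2 fe ef e0 f0 sum vadd_zero_left vadd_zero_right vadd_V
  have "\<alpha> \<otimes>\<^bsub>R\<^esub> \<beta> = e"
    by (rule B_eqI) (simp_all add: \<alpha> \<beta> e B_mult_closed simps del: vadd_apply pull_apply)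
  moreover have "\<alpha> \<otimes>\<^bsub>R\<^esub> \<delta> = \<zero>\<^bsub>R\<^esub>"
    by (rule B_eqI) (simp_all add: \<alpha> \<delta> B_mult_closed simps del: vadd_apply pull_apply zero_apply)
  moreover have "\<gamma> \<otimes>\<^bsub>R\<^esub> \<delta> = \<one>\<^bsub>R\<^esub>"
  proof (rule B_eqI)
    fix \<xi> assume \<xi>: "\<xi> \<in> V"
    have blk: "blk n (\<gamma> (\<delta> \<xi>)) = blk n \<xi>" for n
      \<comment> \<open>Block 0 is special: there the \<open>e\<close> part comes from outside,
        while in block \<open>Suc n\<close> it comes from block \<open>n\<close>.\<close>
      by (cases n) (simp_all add: \<xi> simps del: vadd_apply pull_apply)
    have "\<gamma> (\<delta> \<xi>) = \<xi>" by (rule blk_eqI[OF _ \<xi> blk]) (intro V \<xi>)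
    then show "(\<gamma> \<otimes>\<^bsub>R\<^esub> \<delta>) \<xi> = \<one>\<^bsub>R\<^esub> \<xi>" using \<xi> by (simp add: B_mult_apply)
  qed (simp_all add: \<gamma> \<delta> B_mult_closed)
  moreover have "\<gamma> \<otimes>\<^bsub>R\<^esub> \<beta> = \<zero>\<^bsub>R\<^esub>"
  proof (rule B_eqI)
    fix \<xi> assume \<xi>: "\<xi> \<in> V"
    have blk: "blk n (\<gamma> (\<beta> \<xi>)) = blk n QpN_zero" for n
      by (simp add: \<xi> simps B_zero[OF blk_B] del: vadd_apply pull_apply)
    have "\<gamma> (\<beta> \<xi>) = QpN_zero" by (rule blk_eqI[OF _ zero_V blk]) (intro V \<xi>)
    then show "(\<gamma> \<otimes>\<^bsub>R\<^esub> \<beta>) \<xi> = \<zero>\<^bsub>R\<^esub> \<xi>" using \<xi> by (simp add: B_mult_apply del: zero_apply)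
  qed (simp_all add: \<gamma> \<beta> B_mult_closed)
  moreover have "\<beta> \<otimes>\<^bsub>R\<^esub> \<alpha> \<oplus>\<^bsub>R\<^esub> \<delta> \<otimes>\<^bsub>R\<^esub> \<gamma> = \<one>\<^bsub>R\<^esub>"
  proof (rule B_eqI)
    fix \<xi> assume \<xi>: "\<xi> \<in> V"
    have blk: "blk n (\<beta> (\<alpha> \<xi>) [++] \<delta> (\<gamma> \<xi>)) = blk n \<xi>" for n
      by (cases n) (simp_all add: \<xi> simps del: vadd_apply pull_apply)
    have "\<beta> (\<alpha> \<xi>) [++] \<delta> (\<gamma> \<xi>) = \<xi>" by (rule blk_eqI[OF _ \<xi> blk]) (intro vadd_V V \<xi>)
    then show "(\<beta> \<otimes>\<^bsub>R\<^esub> \<alpha> \<oplus>\<^bsub>R\<^esub> \<delta> \<otimes>\<^bsub>R\<^esub> \<gamma>) \<xi> = \<one>\<^bsub>R\<^esub> \<xi>"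
      using \<xi> by (simp add: B_mult_apply B_add_apply)
  qed (simp_all add: \<alpha> \<beta> \<gamma> \<delta> B_mult_closed B_add_closed)
  ultimately show ?thesis unfolding B.absorbed_def using \<alpha> \<beta> \<gamma> \<delta> by auto
qed

lemma idempotent_absorbed:
  assumes E: "E \<in> BV" and EE: "E \<otimes>\<^bsub>R\<^esub> E = E"
  shows "B.absorbed E"
proof -
  obtain m Q where Q: "finite Q" "E ` nbd m Q \<subseteq> nbd 0 {}" using B_nbd[OF E finite.emptyI] .
  \<comment> \<open>A non-negative exponent lets \<open>D\<close> map \<open>ZN\<close> into itself;
    raising the exponent only shrinks the neighbourhood, so the bound on \<open>E\<close>
    persists.\<close>
  define M where "M = nat m"
  have M: "E \<xi> \<in> ZN" if "\<xi> \<in> nbd (int M) Q" for \<xi>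
  proof -
    have "nbd (int M) Q \<subseteq> nbd m Q" by (rule nbd_mono) (simp_all add: M_def)
    then show ?thesis using Q(2) that unfolding ZN_def by blast
  qed
  define D where "D = scl (int M) Q"
  \<comment> \<open>The invariant lattice pulled back by \<open>D\<close>. Since \<open>D\<close>
    carries \<open>ZN\<close> into \<open>nbd (int M) Q\<close>, the pullback contains
    \<open>ZN\<close>, as \<open>lattice\<close> demands.\<close>
  define L where "L = {\<xi> \<in> V. D \<xi> \<in> ZN \<and> E (D \<xi>) \<in> ZN}"
  have D: "D \<in> BV" "D \<in> Units R" unfolding D_def using scl_B scl_Units Q(1) by blast+
  have DV: "D \<xi> \<in> V" if "\<xi> \<in> V" for \<xi> using that B_V D by blast
  have E2: "E (E \<xi>) = E \<xi>" if "\<xi> \<in> V" for \<xi>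
    using fun_cong[OF EE, of \<xi>] that by (simp add: B_mult_apply)
  have ZN_add: "\<xi> [++] \<eta> \<in> ZN" if "\<xi> \<in> ZN" "\<eta> \<in> ZN" for \<xi> \<eta>
    using that nbd_add unfolding ZN_def by blast
  have ZN_smult: "a [**] \<xi> \<in> ZN" if "a \<in> Zp p" "\<xi> \<in> ZN" for a \<xi>
    using that by (simp add: ZN_iff smult_V vge_mult V_Qp)
  have "lattice Q L" unfolding lattice_def
  proof (intro conjI ballI allI impI exI[of _ M])
    show "ZN \<subseteq> L"
    proof
      fix \<xi> assume \<xi>: "\<xi> \<in> ZN"
      then have \<xi>V: "\<xi> \<in> V" and 0: "vge 0 (\<xi> j)" for j by (auto simp: ZN_iff)
      have "D \<xi> \<in> nbd (int M) Q"
        using DV[OF \<xi>V] \<xi>V 0 vge_mono[OF 0, of "- int M"] by (auto simp: nbd_def D_def)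
      moreover from this have "D \<xi> \<in> ZN" by (simp add: nbd_def ZN_iff)
      ultimately show "\<xi> \<in> L" using \<xi>V M by (simp add: L_def)
    qed
    show "vge 0 (\<xi> j)" if "\<xi> \<in> L" "j \<notin> Q" for \<xi> j
    proof -
      have "\<xi> \<in> V" "vge 0 (D \<xi> j)" using that by (auto simp: L_def ZN_iff)
      then show ?thesis using that by (simp add: D_def)
    qed
    show "vge (- int M) (\<xi> j)" if "\<xi> \<in> L" for \<xi> j
    proof -
      have "\<xi> \<in> V" "vge 0 (D \<xi> j)" using that by (auto simp: L_def ZN_iff)
      then show ?thesis using vge_mono[of 0 "\<xi> j" "- int M"] by (auto simp: D_def split: if_splits)
    qed
  qed (auto simp: L_def vadd_V smult_V B_add[OF D(1)] B_smult[OF D(1)] B_add[OF E] B_smult[OF E]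
      DV ZN_add ZN_smult)
  then obtain u where u: "u \<in> Units R" "\<And>\<xi>. \<xi> \<in> V \<Longrightarrow> u \<xi> \<in> L \<longleftrightarrow> \<xi> \<in> ZN"
    using lattice_unit[OF Q(1)] by blast
  \<comment> \<open>\<open>w\<close> carries \<open>ZN\<close> onto the set of integral
    \<open>x\<close> with \<open>E x\<close> integral, so the conjugate of \<open>E\<close> by
    \<open>w\<close> preserves \<open>ZN\<close>.\<close>
  define w where "w = D \<otimes>\<^bsub>R\<^esub> u"
  have w: "w \<in> Units R" unfolding w_def by (rule B.Units_m_closed[OF D(2) u(1)])
  let ?e = "inv\<^bsub>R\<^esub> w \<otimes>\<^bsub>R\<^esub> E \<otimes>\<^bsub>R\<^esub> w"
  have wc: "w \<in> carrier R" "inv\<^bsub>R\<^esub> w \<in> carrier R" and Ec: "E \<in> carrier R"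
    using w B.Units_closed B.Units_inv_closed E by auto
  have ec: "?e \<in> carrier R" by (intro B.m_closed wc Ec)
  then have e: "?e \<in> BV" by simp
  have we: "w \<otimes>\<^bsub>R\<^esub> ?e = E \<otimes>\<^bsub>R\<^esub> w"
  proof -
    have "w \<otimes>\<^bsub>R\<^esub> ?e = w \<otimes>\<^bsub>R\<^esub> inv\<^bsub>R\<^esub> w \<otimes>\<^bsub>R\<^esub> E \<otimes>\<^bsub>R\<^esub> w"
      using wc Ec by (simp only: B.m_assoc B.m_closed)
    also have "\<dots> = E \<otimes>\<^bsub>R\<^esub> w" using wc Ec B.Units_r_inv[OF w] by (simp only: B.l_one)
    finally show ?thesis .
  qed
  have ee: "?e \<otimes>\<^bsub>R\<^esub> ?e = ?e"
  proof -
    have "?e \<otimes>\<^bsub>R\<^esub> ?e = inv\<^bsub>R\<^esub> w \<otimes>\<^bsub>R\<^esub> E \<otimes>\<^bsub>R\<^esub> (w \<otimes>\<^bsub>R\<^esub> ?e)"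
      using wc Ec by (simp only: B.m_assoc B.m_closed)
    also have "\<dots> = inv\<^bsub>R\<^esub> w \<otimes>\<^bsub>R\<^esub> (E \<otimes>\<^bsub>R\<^esub> E) \<otimes>\<^bsub>R\<^esub> w"
      unfolding we using wc Ec by (simp only: B.m_assoc B.m_closed)
    finally show ?thesis unfolding EE .
  qed
  have "?e \<xi> \<in> ZN" if "\<xi> \<in> ZN" for \<xi>
  proof -
    have \<xi>: "\<xi> \<in> V" using that by (simp add: ZN_iff)
    have uB: "u \<in> BV" using u(1) B.Units_closed by simp
    have eV: "?e \<xi> \<in> V" by (rule B_V[OF e \<xi>])
    have uV: "u \<xi> \<in> V" "u (?e \<xi>) \<in> V" using uB \<xi> eV B_V by blast+
    have uL: "u \<xi> \<in> L" using u(2)[OF \<xi>] that by simp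
    have "(w \<otimes>\<^bsub>R\<^esub> ?e) \<xi> = (E \<otimes>\<^bsub>R\<^esub> w) \<xi>" by (simp only: we)
    then have *: "D (u (?e \<xi>)) = E (D (u \<xi>))"
      using \<xi> eV by (simp only: w_def B_mult_apply)
    \<comment> \<open>Idempotency enters here: \<open>E (D (u \<xi>))\<close> is integral and equals
      its own image under \<open>E\<close>, so both conditions in \<open>L\<close> hold.\<close>
    have "u (?e \<xi>) \<in> L"
      using uL uV DV E2[of "D (u \<xi>)"] unfolding L_def by (simp add: *)
    then show ?thesis using u(2)[OF eV] by simp
  qed
  then have "B.absorbed ?e" by (intro absorbed_if_integral e ee)
  then show ?thesis by (rule B.absorbed_conjugate[OF w Ec])
qed

text \<open>The embeddings of \<open>V\<close> as its blocks are infinitely many orthogonal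
  isometries, so one family serves idempotent matrices of every size.\<close>

lemma K0_B_trivial: "carrier (K0 R) = {\<one>\<^bsub>K0 R\<^esub>}"
proof (rule B.K0_trivial)
  show "push (col i) \<in> carrier R" "pull (col i) \<in> carrier R" for i
    using push_B[OF inj_col] pull_B[OF inj_col] by simp_all
  show "pull (col i) \<otimes>\<^bsub>R\<^esub> push (col j) = (if i = j then \<one>\<^bsub>R\<^esub> else \<zero>\<^bsub>R\<^esub>)" for i j
    by (rule B_eqI)
      (simp_all add: B_mult_closed push_B[OF inj_col] blk_B B_mult_apply blk_push_col fun_eq_iff
        del: pull_apply)
qed (auto intro: idempotent_absorbed)

end

theorem theorem3p16:
  fixes p :: nat
  assumes "prime p"
  shows "carrier (K0 (B_ring p)) = {\<one>\<^bsub>K0 (B_ring p)\<^esub>}"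
  by (rule padic_base.K0_B_trivial) (unfold_locales, rule assms)

end
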